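(* Let $n\ge 1$, $\lambda>0$, and let $d\nu = f\,d\gamma$ be a probability measure on $\mathbb{R}^n$ which is centered, i.e. $\int_{\mathbb{R}^n} x\, d\nu = 0$, and which belongs to the class $\mathcal{P}(\lambda)$. Then $$\mathrm{H}(\nu) \,\le\, \frac{c(\lambda)}{2}\, \mathrm{I}(\nu),$$ where $$c(\lambda) = \frac{1-\lambda+\lambda\log\lambda}{(1-\lambda)^2} < 1 \quad (\lambda\neq 1), \qquad c(1)=\tfrac12 .$$
   Context: $\gamma$ is the standard Gaussian measure on $\mathbb{R}^n$, $d\gamma(x) = (2\pi)^{-n/2}e^{-|x|^2/2}dx$. For a probability measure $d\nu=f\,d\gamma$, the relative entropy is $\mathrm{H}(\nu)=\int_{\mathbb{R}^n} f\log f\,d\gamma$ and the Fisher information is $\mathrm{I}(\nu)=\int_{\mathbb{R}^n}\frac{|\nabla f|^2}{f}\,d\gamma$ (integral over $\{f>0\}$). Standing convention: the density $f\ge 0$ is regular enough (weakly differentiable, $f\in W^{1,1}_{loc}$) for these quantities to be well-defined, and they are finite. $\mathcal{P}(\lambda)$ is the class of Borel probability measures $\nu$ on $\mathbb{R}^n$ satisfying a Poincaré inequality with constant $\lambda>0$: for every smooth $g:\mathbb{R}^n\to\mathbb{R}$ with $\int g\,d\nu=0$, $\lambda\int_{\mathbb{R}^n} g^2\,d\nu\le\int_{\mathbb{R}^n}|\nabla g|^2\,d\nu$. *)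

theory Defs
  imports "HOL-Probability.Probability"
begin

definition std_gaussian :: "'a::euclidean_space measure" where
  "std_gaussian = density lborel
     (\<lambda>x. ennreal ((2 * pi) powr (- real DIM('a) / 2) * exp (- (norm x)\<^sup>2 / 2)))"

definition partial_deriv :: "'a::euclidean_space \<Rightarrow> ('a \<Rightarrow> real) \<Rightarrow> 'a \<Rightarrow> real" where
  "partial_deriv i g x = frechet_derivative g (at x) i"

definition grad :: "('a::euclidean_space \<Rightarrow> real) \<Rightarrow> 'a \<Rightarrow> 'a" where
  "grad g x = (\<Sum>i\<in>Basis. partial_deriv i g x *\<^sub>R i)"

text \<open>The class of k times continuously differentiable functions on the whole space.\<close>

fun Ck :: "nat \<Rightarrow> ('a::euclidean_space \<Rightarrow> real) \<Rightarrow> bool" where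
  "Ck 0 g \<longleftrightarrow> continuous_on UNIV g"
| "Ck (Suc k) g \<longleftrightarrow> g differentiable_on UNIV \<and> (\<forall>i\<in>Basis. Ck k (partial_deriv i g))"

definition smooth :: "('a::euclidean_space \<Rightarrow> real) \<Rightarrow> bool" where
  "smooth g \<longleftrightarrow> (\<forall>k. Ck k g)"

definition test_function :: "('a::euclidean_space \<Rightarrow> real) \<Rightarrow> bool" where
  "test_function \<phi> \<longleftrightarrow> smooth \<phi> \<and> (\<exists>K. compact K \<and> (\<forall>x. x \<notin> K \<longrightarrow> \<phi> x = 0))"

definition locally_integrable :: "('a::euclidean_space \<Rightarrow> 'b::euclidean_space) \<Rightarrow> bool" where
  "locally_integrable f \<longleftrightarrow> (\<forall>K. compact K \<longrightarrow> set_integrable lborel K f)"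

text \<open>\<open>has_weak_gradient f Df\<close> says that f lies in the local Sobolev space of exponents (1,1) and
  that Df is a version of its weak gradient, which is unique up to Lebesgue-null sets.\<close>

definition has_weak_gradient :: "('a::euclidean_space \<Rightarrow> real) \<Rightarrow> ('a \<Rightarrow> 'a) \<Rightarrow> bool" where
  "has_weak_gradient f Df \<longleftrightarrow> locally_integrable f \<and> locally_integrable Df \<and>
     (\<forall>\<phi>. test_function \<phi> \<longrightarrow> (\<forall>i\<in>Basis.
        (\<integral>x. f x * partial_deriv i \<phi> x \<partial>lborel) = - (\<integral>x. (Df x \<bullet> i) * \<phi> x \<partial>lborel)))"

text \<open>Both functionals below take the density f with respect to the Gaussian measure. Since
  \<open>ln 0 = 0\<close>, the entropy integrand vanishes where f does. The Bochner integral
  is 0 for a non-integrable integrand, so finiteness has to be assumed separately.\<close>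

definition rel_entropy :: "('a::euclidean_space \<Rightarrow> real) \<Rightarrow> real" where
  "rel_entropy f = (\<integral>x. f x * ln (f x) \<partial>std_gaussian)"

definition rel_entropy_finite :: "('a::euclidean_space \<Rightarrow> real) \<Rightarrow> bool" where
  "rel_entropy_finite f \<longleftrightarrow> integrable std_gaussian (\<lambda>x. f x * ln (f x))"

definition fisher_information :: "('a::euclidean_space \<Rightarrow> real) \<Rightarrow> ('a \<Rightarrow> 'a) \<Rightarrow> real" where
  "fisher_information f Df =
     (LINT x:{x. f x > 0}|std_gaussian. (norm (Df x))\<^sup>2 / f x)"

definition fisher_information_finite :: "('a::euclidean_space \<Rightarrow> real) \<Rightarrow> ('a \<Rightarrow> 'a) \<Rightarrow> bool" where
  "fisher_information_finite f Df \<longleftrightarrow>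
     set_integrable std_gaussian {x. f x > 0} (\<lambda>x. (norm (Df x))\<^sup>2 / f x)"

text \<open>The quadratic terms are integrated in the extended nonnegative reals, so that infinite
  values are treated as such: the inequality is trivial if the right-hand side is infinite.\<close>

definition poincare_class :: "real \<Rightarrow> 'a::euclidean_space measure set" where
  "poincare_class lam = {\<nu>. prob_space \<nu> \<and> sets \<nu> = sets borel \<and>
     (\<forall>g. smooth g \<longrightarrow> integrable \<nu> g \<longrightarrow> (\<integral>x. g x \<partial>\<nu>) = 0 \<longrightarrow>
        ennreal lam * (\<integral>\<^sup>+x. ennreal ((g x)\<^sup>2) \<partial>\<nu>)
          \<le> (\<integral>\<^sup>+x. ennreal ((norm (grad g x))\<^sup>2) \<partial>\<nu>))}"

definition centered :: "'a::euclidean_space measure \<Rightarrow> bool" where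
  "centered \<nu> \<longleftrightarrow> integrable \<nu> (\<lambda>x. x) \<and> (\<integral>x. x \<partial>\<nu>) = 0"

definition lsi_const :: "real \<Rightarrow> real" where
  "lsi_const lam =
     (if lam = 1 then 1 / 2 else (1 - lam + lam * ln lam) / (1 - lam)\<^sup>2)"

end

theory Submission
  imports Defs
begin

text \<open>Let \<open>P\<^sub>t\<close> be the Ornstein-Uhlenbeck semigroup. De Bruijn's identity writes the entropy as the time
  integral of the Fisher information \<open>I(P\<^sub>t f)\<close>, and since \<open>\<nabla> P\<^sub>t f = e\<^sup>-\<^sup>t P\<^sub>t \<nabla> f\<close> it is enough to contract
  \<open>\<integral> \<bar>P\<^sub>t \<nabla> f\<bar>\<^sup>2 / P\<^sub>t f\<close>. By duality this amounts to bounding the variance of \<open>P\<^sub>t g\<close> under \<open>\<nu>\<close> by a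
  multiple of \<open>\<integral> P\<^sub>t (g\<^sup>2) d\<nu>\<close>; here centering enters, making \<open>\<nabla> f\<close> have mean zero. The reverse local
  inequality \<open>(e\<^sup>2\<^sup>t - 1) \<bar>\<nabla> P\<^sub>t g\<bar>\<^sup>2 \<le> P\<^sub>t (g\<^sup>2) - (P\<^sub>t g)\<^sup>2\<close> (Bessel's inequality for the first Hermite
  coefficients) combined with the spectral gap of \<open>\<nu>\<close>, applied to the smooth function \<open>P\<^sub>t g\<close>, gives
  the factor \<open>1 / (1 + lam (e\<^sup>2\<^sup>t - 1))\<close>, whose integral against \<open>e\<^sup>-\<^sup>2\<^sup>t dt\<close> is half the constant.
  Sobolev regularity is handled by saturating f and by mollifying with \<open>P\<^sub>t\<close> itself.\<close>

section \<open>The Gaussian measure\<close>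

text \<open>The Poincare inequality and the centering are known for f alone, whereas the dissipation
  formula needs densities bounded above and away from 0, which f need not be. Hence the
  regularisation is removed inside the time integral before any contraction, with the Fisher
  information of f as dominating constant, and only the limiting integrand is contracted. In the
  duality step the variance V of \<open>ou c g\<close> appears on both sides: lam V <= c^2 / (1 -
  c^2) (E - V), with E the integral of \<open>ou c\<close> of g^2. Solving for V gives the factor,
  and Young's inequality with this factor as weight lets half of the tested quantity be absorbed.
  The saturation a r / (a + r) has squared derivative at most its value divided by r, so it does not
  increase the Fisher information; large a recovers f, while small a isolates the zero set of f,
  where the weak gradient must be shown negligible because the Fisher information does not see it.
  In the parameter c = exp (- t) the measure exp (- 2 t) dt is c dc on (0, 1), and the constant
  comes from a rational integral.\<close>

definition gauss_dens :: "'a::euclidean_space \<Rightarrow> real" where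
  "gauss_dens x = (2 * pi) powr (- real DIM('a) / 2) * exp (- (norm x)\<^sup>2 / 2)"

lemma gauss_dens_pos: "gauss_dens x > 0"
  by (simp add: gauss_dens_def)

lemma gauss_dens_nonneg [simp]: "gauss_dens x \<ge> 0"
  using gauss_dens_pos[of x] by simp

lemma gauss_dens_measurable [measurable]: "gauss_dens \<in> borel_measurable borel"
  unfolding gauss_dens_def[abs_def] by measurable

lemma continuous_gauss_dens: "continuous_on A gauss_dens"
  unfolding gauss_dens_def[abs_def] by (intro continuous_intros) auto

lemma std_gaussian_eq: "std_gaussian = density lborel (\<lambda>x. ennreal (gauss_dens x))"
  by (simp add: std_gaussian_def gauss_dens_def)

lemma space_std_gaussian [simp]: "space std_gaussian = UNIV"
  and sets_std_gaussian [simp, measurable_cong]: "sets std_gaussian = sets borel"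
  by (simp_all add: std_gaussian_eq)

text \<open>The normalisation is the n-th power of the one-dimensional one and the exponent is
  additive over coordinates. Gaussian integrals of product functions thereby reduce to
  one-dimensional ones.\<close>

lemma gauss_dens_prod:
  fixes x :: "'a::euclidean_space"
  shows "gauss_dens x = (\<Prod>b\<in>Basis. std_normal_density (x \<bullet> b))"
proof -
  have "(2 * pi) powr (- real DIM('a) / 2) = (\<Prod>b\<in>(Basis::'a set). 1 / sqrt (2 * pi))"
  proof -
    have "(1 / sqrt (2 * pi)) = (2*pi) powr (-1/2)"
      by (simp add: powr_minus powr_half_sqrt divide_simps)
    then have "(\<Prod>b\<in>(Basis::'a set). 1 / sqrt (2 * pi)) = ((2*pi) powr (-1/2)) ^ DIM('a)"
      by simp
    also have "\<dots> = (2 * pi) powr (- real DIM('a) / 2)"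
      by (subst powr_realpow[symmetric]) (auto simp: powr_powr)
    finally show ?thesis by simp
  qed
  moreover have "exp (- (norm x)\<^sup>2 / 2) = (\<Prod>b\<in>Basis. exp (- (x \<bullet> b)\<^sup>2 / 2))"
    by (subst exp_sum[symmetric])
       (auto simp: norm_eq_sqrt_inner euclidean_inner[of x x] power2_eq_square sum_negf sum_divide_distrib
             sum_nonneg)
  ultimately show ?thesis
    by (simp add: gauss_dens_def std_normal_density_def prod.distrib prod_dividef power_one_over)
qed

lemma nn_integral_std_gaussian:
  fixes h :: "'a::euclidean_space \<Rightarrow> ennreal"
  assumes "h \<in> borel_measurable borel"
  shows "(\<integral>\<^sup>+x. h x \<partial>std_gaussian) = (\<integral>\<^sup>+x. ennreal (gauss_dens x) * h x \<partial>lborel)"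
  using assms by (simp add: std_gaussian_eq nn_integral_density)

lemma integrable_std_gaussian_iff:
  fixes h :: "'a::euclidean_space \<Rightarrow> 'b::{banach, second_countable_topology}"
  assumes "h \<in> borel_measurable borel"
  shows "integrable std_gaussian h \<longleftrightarrow> integrable lborel (\<lambda>x. gauss_dens x *\<^sub>R h x)"
  using assms by (simp add: std_gaussian_eq integrable_density)

lemma integral_std_gaussian:
  fixes h :: "'a::euclidean_space \<Rightarrow> 'b::{banach, second_countable_topology}"
  assumes "h \<in> borel_measurable borel"
  shows "(\<integral>x. h x \<partial>std_gaussian) = (\<integral>x. gauss_dens x *\<^sub>R h x \<partial>lborel)"
  using assms by (simp add: std_gaussian_eq integral_density)

lemma nn_integral_gauss_prod:
  fixes g :: "'a::euclidean_space \<Rightarrow> real \<Rightarrow> real"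
  assumes [measurable]: "\<And>b. b \<in> Basis \<Longrightarrow> g b \<in> borel_measurable borel"
    and g: "\<And>b t. b \<in> Basis \<Longrightarrow> 0 \<le> g b t"
  shows "(\<integral>\<^sup>+x. ennreal (\<Prod>b\<in>Basis. g b (x \<bullet> b)) \<partial>std_gaussian)
    = (\<Prod>b\<in>Basis. \<integral>\<^sup>+t. ennreal (std_normal_density t * g b t) \<partial>lborel)"
proof -
  have "(\<integral>\<^sup>+x. ennreal (\<Prod>b\<in>Basis. g b (x \<bullet> b)) \<partial>std_gaussian)
    = (\<integral>\<^sup>+x. (\<Prod>b\<in>(Basis::'a set). ennreal (std_normal_density (x \<bullet> b) * g b (x \<bullet> b))) \<partial>lborel)"
    using g by (subst nn_integral_std_gaussian)
      (auto intro!: nn_integral_cong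
            simp: gauss_dens_prod ennreal_mult[symmetric] prod_nonneg prod.distrib[symmetric] prod_ennreal)
  also have "\<dots> = (\<Prod>b\<in>Basis. \<integral>\<^sup>+t. ennreal (std_normal_density t * g b t) \<partial>lborel)"
    by (rule nn_integral_lborel_prod[where f="\<lambda>b t. ennreal (std_normal_density t * g b t)"]) auto
  finally show ?thesis .
qed

lemma nn_integral_std_normal: "(\<integral>\<^sup>+t. ennreal (std_normal_density t) \<partial>lborel) = 1"
  using prob_space.emeasure_space_1[OF prob_space_normal_density[of 1 0]]
  by (simp add: emeasure_density)

lemma prob_space_std_gaussian: "prob_space (std_gaussian :: 'a::euclidean_space measure)"
proof
  show "emeasure std_gaussian (space (std_gaussian::'a measure)) = 1"
    using nn_integral_gauss_prod[of "\<lambda>(b::'a) t. 1"]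
    by (simp add: nn_integral_std_normal)
qed

interpretation std_gaussian: prob_space "std_gaussian :: 'a::euclidean_space measure"
  by (rule prob_space_std_gaussian)

interpretation std_gaussian_pair:
  pair_prob_space "std_gaussian :: 'a::euclidean_space measure" "std_gaussian :: 'b::euclidean_space measure" ..

lemma nn_integral_gauss_square:
  fixes i :: "'a::euclidean_space"
  assumes i: "i \<in> Basis"
  shows "(\<integral>\<^sup>+x. ennreal ((x \<bullet> i)\<^sup>2) \<partial>std_gaussian) = 1"
proof -
  \<comment> \<open>The factor is the square in coordinate i and constantly 1 elsewhere, so every
    one-dimensional integral is a total mass or a second moment, and both are 1.\<close>
  let ?g = "\<lambda>b t. if b = i then t\<^sup>2 else (1::real)"
  have "(\<Prod>b\<in>Basis. ?g b (x \<bullet> b)) = (x \<bullet> i)\<^sup>2" for x :: 'a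
    using i by (simp add: prod.delta[of Basis i "\<lambda>b. (x \<bullet> b)\<^sup>2"])
  moreover have "(\<integral>\<^sup>+t. ennreal (std_normal_density t * ?g b t) \<partial>lborel) = 1" if "b \<in> Basis" for b
  proof (cases "b = i")
    case True
    have "has_bochner_integral lborel (\<lambda>x. std_normal_density x * x ^ (2 * 1)) (fact (2 * 1) / (2 ^ 1 * fact 1))"
      by (rule std_normal_moment_even)
    then have "(\<integral>\<^sup>+t. ennreal (std_normal_density t * t^2) \<partial>lborel) = ennreal 1"
      by (subst nn_integral_eq_integral) (auto simp: has_bochner_integral_iff)
    then show ?thesis using True by simp
  next
    case False
    then show ?thesis by (simp add: nn_integral_std_normal)
  qed
  ultimately show ?thesis
    using nn_integral_gauss_prod[of ?g] by simp
qed

lemma integrable_gauss_square: "i \<in> Basis \<Longrightarrow> integrable std_gaussian (\<lambda>x::'a::euclidean_space. (x \<bullet> i)\<^sup>2)"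
  by (rule integrableI_nonneg) (auto simp: nn_integral_gauss_square)

lemma integral_gauss_square: "i \<in> Basis \<Longrightarrow> (\<integral>x. (x \<bullet> i)\<^sup>2 \<partial>(std_gaussian :: 'a::euclidean_space measure)) = 1"
  by (simp add: integral_eq_nn_integral nn_integral_gauss_square)

lemma norm_square_eq_sum: "(norm (x::'a::euclidean_space))\<^sup>2 = (\<Sum>i\<in>Basis. (x \<bullet> i)\<^sup>2)"
  unfolding power2_norm_eq_inner by (subst euclidean_inner) (simp add: power2_eq_square)

lemma integrable_gauss_norm_square: "integrable std_gaussian (\<lambda>x::'a::euclidean_space. (norm x)\<^sup>2)"
proof -
  have "(\<lambda>x::'a. (norm x)\<^sup>2) = (\<lambda>x. \<Sum>i\<in>Basis. (x \<bullet> i)\<^sup>2)"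
    by (intro ext norm_square_eq_sum)
  then show ?thesis by (auto intro: integrable_gauss_square)
qed

lemma integrable_gauss_norm: "integrable std_gaussian (\<lambda>x::'a::euclidean_space. norm x)"
proof (rule Bochner_Integration.integrable_bound)
  show "integrable std_gaussian (\<lambda>x::'a. 1 + (norm x)\<^sup>2)"
    by (intro Bochner_Integration.integrable_add integrable_gauss_norm_square) auto
  show "AE x::'a in std_gaussian. norm (norm x) \<le> norm (1 + (norm x)\<^sup>2)"
  proof (intro AE_I2)
    fix x :: 'a
    have "2 * norm x \<le> 1 + (norm x)\<^sup>2"
      using zero_le_power2[of "norm x - 1"] by (simp add: power2_diff)
    moreover have "0 \<le> norm x" "0 \<le> (norm x)\<^sup>2" by auto
    ultimately have "norm x \<le> 1 + (norm x)\<^sup>2" by linarith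
    then show "norm (norm x) \<le> norm (1 + (norm x)\<^sup>2)" by simp
  qed
qed auto

lemma integrable_gauss_inner: "integrable std_gaussian (\<lambda>x::'a::euclidean_space. x \<bullet> i)"
  by (rule Bochner_Integration.integrable_bound[OF integrable_mult_right[OF integrable_gauss_norm, of "norm i"]])
     (auto simp: Cauchy_Schwarz_ineq2 mult.commute)

lemma integrable_gauss_inner_mult:
  assumes "i \<in> Basis" "j \<in> Basis"
  shows "integrable std_gaussian (\<lambda>x::'a::euclidean_space. (x \<bullet> i) * (x \<bullet> j))"
proof (rule Bochner_Integration.integrable_bound)
  show "integrable std_gaussian (\<lambda>x::'a. (x \<bullet> i)\<^sup>2 + (x \<bullet> j)\<^sup>2)"
    using assms by (intro Bochner_Integration.integrable_add integrable_gauss_square) auto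
  show "AE x::'a in std_gaussian. norm ((x \<bullet> i) * (x \<bullet> j)) \<le> norm ((x \<bullet> i)\<^sup>2 + (x \<bullet> j)\<^sup>2)"
  proof (intro AE_I2)
    fix x :: 'a
    have "2 * (\<bar>x \<bullet> i\<bar> * \<bar>x \<bullet> j\<bar>) \<le> (x \<bullet> i)\<^sup>2 + (x \<bullet> j)\<^sup>2"
      using zero_le_power2[of "\<bar>x \<bullet> i\<bar> - \<bar>x \<bullet> j\<bar>"] by (simp add: power2_diff)
    moreover have "0 \<le> \<bar>x \<bullet> i\<bar> * \<bar>x \<bullet> j\<bar>" by simp
    ultimately have "\<bar>x \<bullet> i\<bar> * \<bar>x \<bullet> j\<bar> \<le> (x \<bullet> i)\<^sup>2 + (x \<bullet> j)\<^sup>2" by linarith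
    then show "norm ((x \<bullet> i) * (x \<bullet> j)) \<le> norm ((x \<bullet> i)\<^sup>2 + (x \<bullet> j)\<^sup>2)"
      by (simp add: abs_mult)
  qed
qed auto

text \<open>Odd moments vanish because flipping the sign of one coordinate preserves the measure.\<close>

lemma std_gaussian_flip:
  fixes i :: "'a::euclidean_space"
  assumes i: "i \<in> Basis"
  defines "T \<equiv> \<lambda>x. x - (2 * (x \<bullet> i)) *\<^sub>R i"
  shows "distr std_gaussian borel T = std_gaussian"
proof -
  have Tm[measurable]: "T \<in> borel_measurable borel" unfolding T_def by measurable
  define c where "c = (\<lambda>j. if j = i then -1 else (1::real))"
  have c0: "\<And>j. j \<in> Basis \<Longrightarrow> c j \<noteq> 0" by (simp add: c_def)
  have Tc: "T x = 0 + (\<Sum>j\<in>Basis. (c j * (x \<bullet> j)) *\<^sub>R j)" for x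
    by (rule euclidean_eqI) (use i in \<open>auto simp: T_def c_def inner_diff_left inner_Basis\<close>)
  have L: "(lborel :: 'a measure) = density (distr lborel borel T) (\<lambda>_. ennreal (\<Prod>j\<in>Basis. \<bar>c j\<bar>))"
    using lborel_affine_euclidean[where c=c and t="0::'a", OF c0] Tc by (metis (no_types, lifting) ext)
  have "(\<Prod>j\<in>(Basis::'a set). \<bar>c j\<bar>) = 1"
    by (intro prod.neutral) (auto simp: c_def)
  then have L: "(lborel :: 'a measure) = distr lborel borel T"
    using L by (simp add: density_1)
  have nT: "norm (T x) = norm x" for x
  proof -
    have "(norm (T x))\<^sup>2 = (norm x)\<^sup>2"
      using i unfolding power2_norm_eq_inner T_def
      by (simp add: inner_diff_left inner_diff_right inner_commute inner_Basis)
    then show ?thesis by simp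
  qed
  have gT: "gauss_dens (T x) = gauss_dens x" for x
    by (simp add: gauss_dens_def nT)
  have "std_gaussian = density (distr lborel borel T) (\<lambda>x. ennreal (gauss_dens x))"
    using L std_gaussian_eq by metis
  also have "\<dots> = distr (density lborel (\<lambda>x. ennreal (gauss_dens (T x)))) borel T"
    by (subst density_distr) auto
  also have "\<dots> = distr std_gaussian borel T"
    by (simp add: gT std_gaussian_eq)
  finally show ?thesis ..
qed

lemma integral_std_gaussian_flip:
  fixes i :: "'a::euclidean_space" and h :: "'a \<Rightarrow> real"
  assumes i: "i \<in> Basis" and [measurable]: "h \<in> borel_measurable borel"
    and odd: "\<And>x. h (x - (2 * (x \<bullet> i)) *\<^sub>R i) = - h x"
  shows "(\<integral>x. h x \<partial>std_gaussian) = 0"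
proof -
  have "(\<integral>x. h x \<partial>std_gaussian) = (\<integral>x. h x \<partial>distr std_gaussian borel (\<lambda>x. x - (2 * (x \<bullet> i)) *\<^sub>R i))"
    by (simp only: std_gaussian_flip[OF i])
  also have "\<dots> = (\<integral>x. - h x \<partial>std_gaussian)"
    by (subst integral_distr) (auto simp: odd)
  finally show ?thesis by simp
qed

lemma integral_gauss_inner: "i \<in> Basis \<Longrightarrow> (\<integral>x. x \<bullet> i \<partial>(std_gaussian :: 'a::euclidean_space measure)) = 0"
  by (rule integral_std_gaussian_flip[of i]) (auto simp: inner_diff_left)

text \<open>Off the diagonal the integrand is odd in coordinate i. Together with mean zero this
  makes 1 and the coordinates an orthonormal system, as Bessel's inequality requires.\<close>

lemma integral_gauss_inner_mult:
  assumes "i \<in> Basis" "j \<in> Basis"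
  shows "(\<integral>x. (x \<bullet> i) * (x \<bullet> j) \<partial>(std_gaussian :: 'a::euclidean_space measure)) = (if i = j then 1 else 0)"
proof (cases "i = j")
  case True
  then show ?thesis using integral_gauss_square[OF assms(1)] by (simp add: power2_eq_square)
next
  case False
  then show ?thesis using assms
    by (auto intro!: integral_std_gaussian_flip[of i] simp: inner_diff_left inner_Basis)
qed

section \<open>Mehler kernel and Gaussian rotations\<close>

lemma nn_integral_lborel_affine:
  fixes t :: "'a::euclidean_space" and h :: "'a \<Rightarrow> ennreal"
  assumes "r > 0" and [measurable]: "h \<in> borel_measurable borel"
  shows "(\<integral>\<^sup>+y. h y \<partial>lborel) = ennreal (r ^ DIM('a)) * (\<integral>\<^sup>+z. h (t + r *\<^sub>R z) \<partial>lborel)"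
proof -
  have "(\<integral>\<^sup>+y. h y \<partial>lborel) = (\<integral>\<^sup>+y. h y \<partial>density (distr lborel borel (\<lambda>x. t + r *\<^sub>R x)) (\<lambda>_. \<bar>r\<bar>^DIM('a)))"
    using lborel_affine[of r t] assms by simp
  also have "\<dots> = ennreal (r ^ DIM('a)) * (\<integral>\<^sup>+z. h (t + r *\<^sub>R z) \<partial>lborel)"
    using assms by (simp add: nn_integral_density nn_integral_distr nn_integral_cmult)
  finally show ?thesis .
qed

text \<open>The flow time t enters only through \<open>c = exp (- t)\<close>: below, \<open>ou c\<close> is \<open>P\<^sub>t\<close> and \<open>csn c\<close> is the
  standard deviation of its noise.\<close>

definition csn :: "real \<Rightarrow> real" where "csn c = sqrt (1 - c\<^sup>2)"

lemma csn_pos: "0 \<le> c \<Longrightarrow> c < 1 \<Longrightarrow> csn c > 0"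
  by (simp add: csn_def power_less_one_iff abs_square_less_1)

lemma csn_sq: "0 \<le> c \<Longrightarrow> c \<le> 1 \<Longrightarrow> (csn c)\<^sup>2 = 1 - c\<^sup>2"
  by (simp add: csn_def abs_square_le_1)

text \<open>Density of c x + \<open>csn c\<close> z, z standard Gaussian, with respect to the
  Gaussian measure. The factors in x alone, in x and y jointly, and in y alone are kept apart
  because the second is the exponential of a Laplace transform and the third belongs to its
  weight.\<close>

definition mehler :: "real \<Rightarrow> 'a::euclidean_space \<Rightarrow> 'a \<Rightarrow> real" where
  "mehler c x y = exp (- (c * norm x)\<^sup>2 / (2 * (csn c)\<^sup>2)) / csn c ^ DIM('a)
     * (exp (c / (csn c)\<^sup>2 * (x \<bullet> y)) * exp (- (c * norm y)\<^sup>2 / (2 * (csn c)\<^sup>2)))"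

lemma mehler_measurable [measurable]: "mehler c x \<in> borel_measurable borel"
  unfolding mehler_def[abs_def] by measurable

lemma mehler_nonneg: "0 \<le> c \<Longrightarrow> c < 1 \<Longrightarrow> mehler c x y \<ge> 0"
  using csn_pos[of c] by (simp add: mehler_def)

text \<open>Completing the square: with s = \<open>csn c\<close> one has 1/2 + c^2 / (2 s^2) = 1 /
  (2 s^2), since c^2 + s^2 = 1. The product is the Lebesgue density of a Gaussian with mean c x and
  standard deviation s; the power of s is the Jacobian.\<close>

lemma mehler_gauss_dens:
  fixes x y :: "'a::euclidean_space"
  assumes "0 \<le> c" "c < 1"
  shows "gauss_dens y * mehler c x y = gauss_dens ((1 / csn c) *\<^sub>R (y - c *\<^sub>R x)) / csn c ^ DIM('a)"
proof -
  let ?s = "csn c"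
  have s: "?s > 0" and s2: "c\<^sup>2 = 1 - ?s\<^sup>2" using csn_pos csn_sq assms by auto
  have "(norm (y - c *\<^sub>R x))\<^sup>2 = (norm y)\<^sup>2 - 2 * c * (x \<bullet> y) + c\<^sup>2 * (norm x)\<^sup>2"
    unfolding power2_norm_eq_inner
    by (simp add: inner_diff_left inner_diff_right inner_commute power2_eq_square)
  moreover have "(norm ((1 / ?s) *\<^sub>R (y - c *\<^sub>R x)))\<^sup>2 = (norm (y - c *\<^sub>R x))\<^sup>2 / ?s\<^sup>2"
    by (simp only: norm_scaleR power_mult_distrib power_divide power2_abs power_one mult_1 times_divide_eq_left)
  ultimately have n: "(norm ((1 / ?s) *\<^sub>R (y - c *\<^sub>R x)))\<^sup>2 = ((norm y)\<^sup>2 - 2 * c * (x \<bullet> y) + c\<^sup>2 * (norm x)\<^sup>2) / ?s\<^sup>2"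
    by simp
  have e: "- (norm y)\<^sup>2 / 2 + (- (c * norm x)\<^sup>2 / (2 * ?s\<^sup>2) + (c / ?s\<^sup>2 * (x \<bullet> y) + - (c * norm y)\<^sup>2 / (2 * ?s\<^sup>2)))
     = - ((norm y)\<^sup>2 - 2 * c * (x \<bullet> y) + c\<^sup>2 * (norm x)\<^sup>2) / ?s\<^sup>2 / 2"
  proof -
    have "(c * norm y)\<^sup>2 = (norm y)\<^sup>2 - ?s\<^sup>2 * (norm y)\<^sup>2"
      by (simp add: power_mult_distrib s2 algebra_simps)
    then have "- (c * norm y)\<^sup>2 / (2 * ?s\<^sup>2) = (norm y)\<^sup>2 / 2 - (norm y)\<^sup>2 / (2 * ?s\<^sup>2)"
      using s by (simp add: diff_divide_distrib)
    then show ?thesis by (simp add: add_divide_distrib diff_divide_distrib power_mult_distrib)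
  qed
  have E: "exp (- (norm y)\<^sup>2 / 2) * (exp (- (c * norm x)\<^sup>2 / (2 * ?s\<^sup>2)) * (exp (c / ?s\<^sup>2 * (x \<bullet> y)) * exp (- (c * norm y)\<^sup>2 / (2 * ?s\<^sup>2))))
     = exp (- (norm ((1 / ?s) *\<^sub>R (y - c *\<^sub>R x)))\<^sup>2 / 2)"
    unfolding exp_add[symmetric] e n by (simp only: divide_minus_left)
  have "gauss_dens y * mehler c x y = (2 * pi) powr (- real DIM('a) / 2) *
      (exp (- (norm y)\<^sup>2 / 2) * (exp (- (c * norm x)\<^sup>2 / (2 * ?s\<^sup>2)) *
        (exp (c / ?s\<^sup>2 * (x \<bullet> y)) * exp (- (c * norm y)\<^sup>2 / (2 * ?s\<^sup>2))))) / ?s ^ DIM('a)"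
    unfolding mehler_def gauss_dens_def by (simp only: mult.assoc times_divide_eq_left times_divide_eq_right)
  then show ?thesis
    unfolding E by (simp only: gauss_dens_def)
qed

lemma nn_integral_mehler:
  fixes h :: "'a::euclidean_space \<Rightarrow> ennreal"
  assumes c: "0 \<le> c" "c < 1" and [measurable]: "h \<in> borel_measurable borel"
  shows "(\<integral>\<^sup>+z. h (c *\<^sub>R x + csn c *\<^sub>R z) \<partial>std_gaussian) = (\<integral>\<^sup>+y. ennreal (mehler c x y) * h y \<partial>std_gaussian)"
proof -
  let ?s = "csn c"
  have s: "?s > 0" using csn_pos c by auto
  have "(\<integral>\<^sup>+y. ennreal (mehler c x y) * h y \<partial>std_gaussian)
     = (\<integral>\<^sup>+y. ennreal (gauss_dens ((1 / ?s) *\<^sub>R (y - c *\<^sub>R x)) / ?s ^ DIM('a)) * h y \<partial>lborel)"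
    by (subst nn_integral_std_gaussian)
      (auto simp: mult.assoc[symmetric] ennreal_mult'[symmetric] mehler_gauss_dens[OF c])
  also have "\<dots> = ennreal (?s ^ DIM('a)) * (\<integral>\<^sup>+z. ennreal (gauss_dens z / ?s ^ DIM('a)) * h (c *\<^sub>R x + ?s *\<^sub>R z) \<partial>lborel)"
    using s by (subst nn_integral_lborel_affine[OF s, where t="c *\<^sub>R x"]) auto
  also have "\<dots> = (\<integral>\<^sup>+z. ennreal (gauss_dens z) * h (c *\<^sub>R x + ?s *\<^sub>R z) \<partial>lborel)"
    using s by (subst nn_integral_cmult[symmetric])
      (auto simp: mult.assoc[symmetric] ennreal_mult'[symmetric])
  also have "\<dots> = (\<integral>\<^sup>+z. h (c *\<^sub>R x + ?s *\<^sub>R z) \<partial>std_gaussian)"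
    by (subst nn_integral_std_gaussian) auto
  finally show ?thesis ..
qed

text \<open>An identity of measures rather than of nonnegative integrals, so that integrability and
  integrals of signed functions transfer along it as well.\<close>

lemma distr_std_gaussian_mehler:
  fixes x :: "'a::euclidean_space"
  assumes c: "0 \<le> c" "c < 1"
  shows "distr std_gaussian borel (\<lambda>z. c *\<^sub>R x + csn c *\<^sub>R z) = density std_gaussian (\<lambda>y. ennreal (mehler c x y))"
proof (rule measure_eqI)
  fix A :: "'a set"
  assume "A \<in> sets (distr std_gaussian borel (\<lambda>z. c *\<^sub>R x + csn c *\<^sub>R z))"
  then have [measurable]: "A \<in> sets borel" by simp
  have "emeasure (distr std_gaussian borel (\<lambda>z. c *\<^sub>R x + csn c *\<^sub>R z)) A
      = (\<integral>\<^sup>+y. indicator A y \<partial>distr std_gaussian borel (\<lambda>z. c *\<^sub>R x + csn c *\<^sub>R z))"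
    by simp
  also have "\<dots> = (\<integral>\<^sup>+z. indicator A (c *\<^sub>R x + csn c *\<^sub>R z) \<partial>std_gaussian)"
    by (subst nn_integral_distr) auto
  also have "\<dots> = emeasure (density std_gaussian (\<lambda>y. ennreal (mehler c x y))) A"
    using nn_integral_mehler[OF c, of "indicator A" x] by (simp add: emeasure_density)
  finally show "emeasure (distr std_gaussian borel (\<lambda>z. c *\<^sub>R x + csn c *\<^sub>R z)) A
    = emeasure (density std_gaussian (\<lambda>y. ennreal (mehler c x y))) A" .
qed simp

text \<open>The matrix ((c, s), (s, -c)) with s = \<open>csn c\<close> is a reflection, chosen over
  a proper rotation because it is its own inverse. Its first component is the argument inside the
  flow.\<close>

definition rot :: "real \<Rightarrow> 'a::euclidean_space \<times> 'a \<Rightarrow> 'a \<times> 'a" where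
  "rot c p = (c *\<^sub>R fst p + csn c *\<^sub>R snd p, csn c *\<^sub>R fst p - c *\<^sub>R snd p)"

lemma rot_measurable [measurable]: "rot c \<in> borel \<Otimes>\<^sub>M borel \<rightarrow>\<^sub>M borel \<Otimes>\<^sub>M borel"
  unfolding rot_def[abs_def] by measurable

lemma rot_rot: "0 \<le> c \<Longrightarrow> c \<le> 1 \<Longrightarrow> rot c (rot c p) = p"
proof -
  assume c: "0 \<le> c" "c \<le> 1"
  have e: "(c * c) *\<^sub>R v + (csn c * csn c) *\<^sub>R v = v" for v :: 'a
    using csn_sq[OF c] by (simp only: scaleR_add_left[symmetric] power2_eq_square) simp
  obtain x z where p: "p = (x, z)" by force
  show ?thesis unfolding p rot_def by (simp add: algebra_simps e)
qed

text \<open>Two affine substitutions, one block at a time: for fixed x the variable z is replaced by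
  u = c x + s z, then for fixed u the variable x by w with x = c u + s w. The two Jacobians cancel,
  and no change of variables on the product space is involved.\<close>

lemma nn_integral_std_gaussian_pair_rot:
  fixes h :: "'a::euclidean_space \<times> 'a \<Rightarrow> ennreal"
  assumes c: "0 \<le> c" "c < 1" and [measurable]: "h \<in> borel_measurable (borel \<Otimes>\<^sub>M borel)"
  shows "(\<integral>\<^sup>+p. h (rot c p) \<partial>(std_gaussian \<Otimes>\<^sub>M std_gaussian)) = (\<integral>\<^sup>+p. h p \<partial>(std_gaussian \<Otimes>\<^sub>M std_gaussian))"
proof -
  let ?s = "csn c"
  have s: "?s > 0" and s2: "?s\<^sup>2 = 1 - c\<^sup>2" using csn_pos csn_sq c by auto
  define H :: "'a \<Rightarrow> 'a \<Rightarrow> ennreal" where "H u w = ennreal (gauss_dens u) * (ennreal (gauss_dens w) * h (u, w))" for u w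
  have Hm[measurable]: "case_prod H \<in> borel_measurable (borel \<Otimes>\<^sub>M borel)"
    unfolding H_def by measurable
  \<comment> \<open>Orthogonality preserves the sum of the squared norms, and the product density
    depends on nothing else.\<close>
  have gg: "gauss_dens x * gauss_dens z = gauss_dens (c *\<^sub>R x + ?s *\<^sub>R z) * gauss_dens (?s *\<^sub>R x - c *\<^sub>R z)" for x z :: 'a
  proof -
    have "(norm (c *\<^sub>R x + ?s *\<^sub>R z))\<^sup>2 + (norm (?s *\<^sub>R x - c *\<^sub>R z))\<^sup>2
        = (c\<^sup>2 + ?s\<^sup>2) * (x \<bullet> x) + (c\<^sup>2 + ?s\<^sup>2) * (z \<bullet> z)"
      unfolding power2_norm_eq_inner
      by (simp add: inner_diff_left inner_diff_right inner_add_left inner_add_right inner_commute power2_eq_square algebra_simps)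
    then have "(norm (c *\<^sub>R x + ?s *\<^sub>R z))\<^sup>2 + (norm (?s *\<^sub>R x - c *\<^sub>R z))\<^sup>2 = (norm x)\<^sup>2 + (norm z)\<^sup>2"
      by (simp add: s2 power2_norm_eq_inner)
    then have e: "- (norm x)\<^sup>2 / 2 + - (norm z)\<^sup>2 / 2
      = - (norm (c *\<^sub>R x + ?s *\<^sub>R z))\<^sup>2 / 2 + - (norm (?s *\<^sub>R x - c *\<^sub>R z))\<^sup>2 / 2"
      by simp
    have *: "gauss_dens u * gauss_dens w = ((2 * pi) powr (- real DIM('a) / 2))\<^sup>2 * exp (- (norm u)\<^sup>2 / 2 + - (norm w)\<^sup>2 / 2)"
      for u w :: 'a
      unfolding gauss_dens_def exp_add by (simp only: power2_eq_square mult_ac)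
    show ?thesis unfolding * e ..
  qed
  have 1: "(\<integral>\<^sup>+p. k p \<partial>(std_gaussian \<Otimes>\<^sub>M std_gaussian))
     = (\<integral>\<^sup>+x. \<integral>\<^sup>+z. ennreal (gauss_dens x * gauss_dens z) * k (x, z) \<partial>lborel \<partial>lborel)"
    if [measurable]: "k \<in> borel_measurable (borel \<Otimes>\<^sub>M borel)" for k :: "'a \<times> 'a \<Rightarrow> ennreal"
  proof -
    have "(\<integral>\<^sup>+p. k p \<partial>(std_gaussian \<Otimes>\<^sub>M std_gaussian)) = (\<integral>\<^sup>+x. \<integral>\<^sup>+z. k (x, z) \<partial>std_gaussian \<partial>std_gaussian)"
      by (subst std_gaussian.nn_integral_fst[symmetric]) auto
    also have "\<dots> = (\<integral>\<^sup>+x. ennreal (gauss_dens x) * (\<integral>\<^sup>+z. ennreal (gauss_dens z) * k (x, z) \<partial>lborel) \<partial>lborel)"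
      by (subst nn_integral_std_gaussian) (auto simp: nn_integral_std_gaussian)
    also have "\<dots> = (\<integral>\<^sup>+x. \<integral>\<^sup>+z. ennreal (gauss_dens x * gauss_dens z) * k (x, z) \<partial>lborel \<partial>lborel)"
      by (subst nn_integral_cmult[symmetric]) (auto simp: ennreal_mult mult.assoc)
    finally show ?thesis .
  qed
  have H: "ennreal (gauss_dens x * gauss_dens z) * h (rot c (x, z)) = H (c *\<^sub>R x + ?s *\<^sub>R z) (?s *\<^sub>R x - c *\<^sub>R z)" for x z
    unfolding gg[of x z] H_def rot_def by (simp add: ennreal_mult mult.assoc)
  have "(\<integral>\<^sup>+p. h (rot c p) \<partial>(std_gaussian \<Otimes>\<^sub>M std_gaussian))
     = (\<integral>\<^sup>+x. \<integral>\<^sup>+z. H (c *\<^sub>R x + ?s *\<^sub>R z) (?s *\<^sub>R x - c *\<^sub>R z) \<partial>lborel \<partial>lborel)"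
    by (subst 1) (auto simp: H)
  also have "\<dots> = (\<integral>\<^sup>+x. ennreal (inverse (?s ^ DIM('a))) * (\<integral>\<^sup>+u. H u ((1 / ?s) *\<^sub>R (x - c *\<^sub>R u)) \<partial>lborel) \<partial>lborel)"
  proof (rule nn_integral_cong)
    fix x :: 'a
    \<comment> \<open>Expresses the second component through x and u = c x + s z alone; here s^2 = 1
      - c^2 enters.\<close>
    have e: "(1 / ?s) *\<^sub>R (x - c *\<^sub>R (c *\<^sub>R x + ?s *\<^sub>R z)) = ?s *\<^sub>R x - c *\<^sub>R z" for z
    proof -
      have "x - c *\<^sub>R (c *\<^sub>R x + ?s *\<^sub>R z) = (1 - c\<^sup>2) *\<^sub>R x - (?s * c) *\<^sub>R z"
        by (simp add: algebra_simps power2_eq_square)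
      then show ?thesis using s unfolding s2[symmetric] by (simp add: scaleR_diff_right power2_eq_square)
    qed
    have "(\<integral>\<^sup>+u. H u ((1 / ?s) *\<^sub>R (x - c *\<^sub>R u)) \<partial>lborel)
       = ennreal (?s ^ DIM('a)) * (\<integral>\<^sup>+z. H (c *\<^sub>R x + ?s *\<^sub>R z) (?s *\<^sub>R x - c *\<^sub>R z) \<partial>lborel)"
      by (subst nn_integral_lborel_affine[OF s, where t="c *\<^sub>R x"]) (auto simp: e)
    then show "(\<integral>\<^sup>+z. H (c *\<^sub>R x + ?s *\<^sub>R z) (?s *\<^sub>R x - c *\<^sub>R z) \<partial>lborel)
      = ennreal (inverse (?s ^ DIM('a))) * (\<integral>\<^sup>+u. H u ((1 / ?s) *\<^sub>R (x - c *\<^sub>R u)) \<partial>lborel)"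
      using s by (simp add: mult.assoc[symmetric] ennreal_mult'[symmetric])
  qed
  also have "\<dots> = (\<integral>\<^sup>+x. \<integral>\<^sup>+u. ennreal (inverse (?s ^ DIM('a))) * H u ((1 / ?s) *\<^sub>R (x - c *\<^sub>R u)) \<partial>lborel \<partial>lborel)"
    by (subst nn_integral_cmult) auto
  also have "\<dots> = (\<integral>\<^sup>+u. \<integral>\<^sup>+x. ennreal (inverse (?s ^ DIM('a))) * H u ((1 / ?s) *\<^sub>R (x - c *\<^sub>R u)) \<partial>lborel \<partial>lborel)"
    by (rule lborel_pair.Fubini') measurable
  also have "\<dots> = (\<integral>\<^sup>+u. \<integral>\<^sup>+w. H u w \<partial>lborel \<partial>lborel)"
  proof (rule nn_integral_cong)
    fix u :: 'a
    have "(\<integral>\<^sup>+x. ennreal (inverse (?s ^ DIM('a))) * H u ((1 / ?s) *\<^sub>R (x - c *\<^sub>R u)) \<partial>lborel)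
      = ennreal (?s ^ DIM('a)) * (\<integral>\<^sup>+w. ennreal (inverse (?s ^ DIM('a))) * H u w \<partial>lborel)"
      using s by (subst nn_integral_lborel_affine[OF s, where t="c *\<^sub>R u"]) auto
    then show "(\<integral>\<^sup>+x. ennreal (inverse (?s ^ DIM('a))) * H u ((1 / ?s) *\<^sub>R (x - c *\<^sub>R u)) \<partial>lborel) = (\<integral>\<^sup>+w. H u w \<partial>lborel)"
      using s by (simp add: nn_integral_cmult mult.assoc[symmetric] ennreal_mult'[symmetric])
  qed
  also have "\<dots> = (\<integral>\<^sup>+p. h p \<partial>(std_gaussian \<Otimes>\<^sub>M std_gaussian))"
    by (subst 1) (auto simp: H_def[abs_def] ennreal_mult mult.assoc)
  finally show ?thesis .
qed

lemma distr_std_gaussian_pair_rot: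
  assumes c: "0 \<le> c" "c < 1"
  shows "distr (std_gaussian \<Otimes>\<^sub>M std_gaussian) (borel \<Otimes>\<^sub>M borel) (rot c)
    = (std_gaussian \<Otimes>\<^sub>M std_gaussian :: ('a::euclidean_space \<times> 'a) measure)"
proof (rule measure_eqI)
  fix A :: "('a \<times> 'a) set"
  assume "A \<in> sets (distr (std_gaussian \<Otimes>\<^sub>M std_gaussian) (borel \<Otimes>\<^sub>M borel) (rot c))"
  then have [measurable]: "A \<in> sets (borel \<Otimes>\<^sub>M borel)" by simp
  have *: "sets (std_gaussian \<Otimes>\<^sub>M std_gaussian :: ('a \<times> 'a) measure) = sets (borel \<Otimes>\<^sub>M borel)"
    by (rule sets_pair_measure_cong) auto
  let ?D = "distr (std_gaussian \<Otimes>\<^sub>M std_gaussian) (borel \<Otimes>\<^sub>M borel) (rot c) :: ('a \<times> 'a) measure"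
  have "emeasure ?D A = (\<integral>\<^sup>+p. indicator A p \<partial>?D)" by simp
  also have "\<dots> = (\<integral>\<^sup>+p. indicator A (rot c p) \<partial>(std_gaussian \<Otimes>\<^sub>M std_gaussian))"
    by (subst nn_integral_distr) auto
  also have "\<dots> = emeasure (std_gaussian \<Otimes>\<^sub>M std_gaussian) A"
    by (subst nn_integral_std_gaussian_pair_rot[OF c]) (auto simp: * )
  finally show "emeasure ?D A = emeasure (std_gaussian \<Otimes>\<^sub>M std_gaussian) A" .
qed (auto intro!: sets_pair_measure_cong)

section \<open>The Ornstein-Uhlenbeck operators\<close>

text \<open>Young's inequality c x.y <= |x|^2 / 2 + c^2 |y|^2 / 2 bounds the kernel in y for each
  fixed x. This makes the flow of an integrable function well defined at every point, not just
  almost everywhere.\<close>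

lemma mehler_bound:
  fixes x y :: "'a::euclidean_space"
  assumes c: "0 \<le> c" "c < 1"
  shows "mehler c x y \<le> exp ((norm x)\<^sup>2 / (2 * (csn c)\<^sup>2)) / csn c ^ DIM('a)"
proof -
  let ?s = "csn c"
  have s: "?s > 0" using csn_pos c by auto
  have "c * (x \<bullet> y) - (c * norm y)\<^sup>2 / 2 \<le> (norm x)\<^sup>2 / 2"
  proof -
    have "c * (x \<bullet> y) \<le> c * (norm x * norm y)"
      using c by (intro mult_left_mono norm_cauchy_schwarz) auto
    moreover have "0 \<le> (norm x - c * norm y)\<^sup>2" by simp
    ultimately show ?thesis by (simp add: power2_diff mult_ac)
  qed
  then have "(c * (x \<bullet> y) - (c * norm y)\<^sup>2 / 2) / ?s\<^sup>2 \<le> (norm x)\<^sup>2 / 2 / ?s\<^sup>2"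
    by (rule divide_right_mono) simp
  then have "c / ?s\<^sup>2 * (x \<bullet> y) + - (c * norm y)\<^sup>2 / (2 * ?s\<^sup>2) \<le> (norm x)\<^sup>2 / (2 * ?s\<^sup>2)"
    by (simp add: diff_divide_distrib)
  then have "exp (c / ?s\<^sup>2 * (x \<bullet> y)) * exp (- (c * norm y)\<^sup>2 / (2 * ?s\<^sup>2)) \<le> exp ((norm x)\<^sup>2 / (2 * ?s\<^sup>2))"
    by (simp only: exp_add[symmetric] exp_le_cancel_iff)
  moreover have "exp (- (c * norm x)\<^sup>2 / (2 * ?s\<^sup>2)) / ?s ^ DIM('a) \<le> 1 / ?s ^ DIM('a)"
    using s by (intro divide_right_mono) auto
  ultimately have "mehler c x y \<le> 1 / ?s ^ DIM('a) * exp ((norm x)\<^sup>2 / (2 * ?s\<^sup>2))"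
    unfolding mehler_def using s by (intro mult_mono) auto
  then show ?thesis by simp
qed

definition ou :: "real \<Rightarrow> ('a::euclidean_space \<Rightarrow> real) \<Rightarrow> 'a \<Rightarrow> real" where
  "ou c v x = (\<integral>z. v (c *\<^sub>R x + csn c *\<^sub>R z) \<partial>std_gaussian)"

lemma ou_measurable [measurable]:
  assumes [measurable]: "v \<in> borel_measurable borel"
  shows "ou c v \<in> borel_measurable borel"
  unfolding ou_def[abs_def] by measurable

lemma ou_eq_mehler:
  assumes "0 \<le> c" "c < 1" and [measurable]: "v \<in> borel_measurable borel"
  shows "ou c v x = (\<integral>y. mehler c x y * v y \<partial>std_gaussian)"
proof -
  have "ou c v x = (\<integral>y. v y \<partial>distr std_gaussian borel (\<lambda>z. c *\<^sub>R x + csn c *\<^sub>R z))"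
    unfolding ou_def by (subst integral_distr) auto
  also have "\<dots> = (\<integral>y. mehler c x y * v y \<partial>std_gaussian)"
    using assms by (simp add: distr_std_gaussian_mehler integral_density mehler_nonneg)
  finally show ?thesis .
qed

lemma integrable_mehler:
  fixes v :: "'a::euclidean_space \<Rightarrow> real"
  assumes c: "0 \<le> c" "c < 1" and v: "integrable std_gaussian v"
  shows "integrable std_gaussian (\<lambda>y. mehler c x y * v y)"
proof (rule Bochner_Integration.integrable_bound)
  define C where "C = exp ((norm x)\<^sup>2 / (2 * (csn c)\<^sup>2)) / csn c ^ DIM('a)"
  have C: "mehler c x y \<le> C" "0 \<le> C" for y
    using mehler_bound[OF c, of x] csn_pos[OF c] by (auto simp: C_def)
  show "integrable std_gaussian (\<lambda>y. C * \<bar>v y\<bar>)"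
    using v by (intro integrable_mult_right integrable_abs)
  show "AE y in std_gaussian. norm (mehler c x y * v y) \<le> norm (C * \<bar>v y\<bar>)"
    using C mehler_nonneg[OF c, of x]
    by (intro AE_I2) (auto simp: abs_mult intro!: mult_right_mono)
qed (use borel_measurable_integrable[OF v] in measurable)

lemma ou_integrable:
  fixes v :: "'a::euclidean_space \<Rightarrow> real"
  assumes c: "0 \<le> c" "c < 1" and v: "integrable std_gaussian v"
  shows "integrable std_gaussian (\<lambda>z. v (c *\<^sub>R x + csn c *\<^sub>R z))"
proof -
  have [measurable]: "v \<in> borel_measurable borel" using borel_measurable_integrable[OF v] by simp
  have "integrable (distr std_gaussian borel (\<lambda>z. c *\<^sub>R x + csn c *\<^sub>R z)) v"
    using integrable_mehler[OF c v, of x]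
    by (simp add: distr_std_gaussian_mehler c integrable_density mehler_nonneg)
  then show ?thesis
    by (subst (asm) integrable_distr_eq) auto
qed

section \<open>Pairs of independent Gaussians: invariance, symmetry, semigroup law\<close>

abbreviation gauss2 :: "('a::euclidean_space \<times> 'a) measure" where
  "gauss2 \<equiv> std_gaussian \<Otimes>\<^sub>M std_gaussian"

lemma measurable_gauss2 [simp]: "measurable gauss2 M = measurable (borel \<Otimes>\<^sub>M borel) M"
  by (intro measurable_cong_sets sets_pair_measure_cong) auto

lemma fst_rot: "fst (rot c p) = c *\<^sub>R fst p + csn c *\<^sub>R snd p"
  by (simp add: rot_def)

lemma integrable_gauss2_rot:
  fixes k :: "'a::euclidean_space \<times> 'a \<Rightarrow> 'b::{banach,second_countable_topology}"
  assumes "0 \<le> c" "c < 1" and [measurable]: "k \<in> borel_measurable (borel \<Otimes>\<^sub>M borel)"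
  shows "integrable gauss2 (\<lambda>p. k (rot c p)) \<longleftrightarrow> integrable gauss2 k"
  by (subst (2) distr_std_gaussian_pair_rot[OF assms(1,2), symmetric])
     (auto intro!: integrable_distr_eq[symmetric])

lemma integral_gauss2_rot:
  fixes k :: "'a::euclidean_space \<times> 'a \<Rightarrow> 'b::{banach,second_countable_topology}"
  assumes "0 \<le> c" "c < 1" and [measurable]: "k \<in> borel_measurable (borel \<Otimes>\<^sub>M borel)"
  shows "(\<integral>p. k (rot c p) \<partial>gauss2) = (\<integral>p. k p \<partial>gauss2)"
  by (subst (2) distr_std_gaussian_pair_rot[OF assms(1,2), symmetric])
     (auto intro!: integral_distr[symmetric])

lemma distr_gauss2_fst: "distr gauss2 borel fst = (std_gaussian :: 'a::euclidean_space measure)"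
proof -
  have "distr gauss2 borel fst = distr (gauss2 :: ('a \<times> 'a) measure) std_gaussian fst"
    by (rule distr_cong) auto
  then show ?thesis using std_gaussian.distr_pair_fst by metis
qed

lemma integrable_gauss2_fst:
  fixes v :: "'a::euclidean_space \<Rightarrow> 'b::{banach,second_countable_topology}"
  assumes [measurable]: "v \<in> borel_measurable borel"
  shows "integrable gauss2 (\<lambda>p. v (fst p)) \<longleftrightarrow> integrable std_gaussian v"
  by (subst (2) distr_gauss2_fst[symmetric]) (auto intro!: integrable_distr_eq[symmetric])

lemma integral_gauss2_fst:
  fixes v :: "'a::euclidean_space \<Rightarrow> 'b::{banach,second_countable_topology}"
  assumes [measurable]: "v \<in> borel_measurable borel"
  shows "(\<integral>p. v (fst p) \<partial>gauss2) = integral\<^sup>L std_gaussian v"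
  by (subst (2) distr_gauss2_fst[symmetric]) (auto intro!: integral_distr[symmetric])

text \<open>The argument is the first component of \<open>rot c\<close>, so invariance of the
  product measure and knowledge of its first marginal suffice.\<close>

lemma integrable_gauss2_comb:
  fixes v :: "'a::euclidean_space \<Rightarrow> real"
  assumes c: "0 \<le> c" "c < 1" and v: "integrable std_gaussian v"
  shows "integrable gauss2 (\<lambda>p. v (c *\<^sub>R fst p + csn c *\<^sub>R snd p))"
proof -
  have [measurable]: "v \<in> borel_measurable borel" using borel_measurable_integrable[OF v] by simp
  show ?thesis
    using integrable_gauss2_rot[OF c, of "\<lambda>p. v (fst p)"] v integrable_gauss2_fst[of v]
    by (simp add: fst_rot)
qed

lemma integral_gauss2_comb:
  fixes v :: "'a::euclidean_space \<Rightarrow> real"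
  assumes c: "0 \<le> c" "c < 1" and v: "integrable std_gaussian v"
  shows "(\<integral>p. v (c *\<^sub>R fst p + csn c *\<^sub>R snd p) \<partial>gauss2) = integral\<^sup>L std_gaussian v"
proof -
  have [measurable]: "v \<in> borel_measurable borel" using borel_measurable_integrable[OF v] by simp
  show ?thesis
    using integral_gauss2_rot[OF c, of "\<lambda>p. v (fst p)"] integral_gauss2_fst[of v]
    by (simp add: fst_rot)
qed

lemma integrable_ou:
  assumes c: "0 \<le> c" "c < 1" and v: "integrable std_gaussian v"
  shows "integrable std_gaussian (ou c v)"
  using std_gaussian_pair.integrable_fst'[OF integrable_gauss2_comb[OF c v]]
  by (simp add: ou_def[abs_def])

lemma integral_ou:
  assumes c: "0 \<le> c" "c < 1" and v: "integrable std_gaussian v"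
  shows "integral\<^sup>L std_gaussian (ou c v) = integral\<^sup>L std_gaussian v"
  using std_gaussian_pair.integral_fst'[OF integrable_gauss2_comb[OF c v]] integral_gauss2_comb[OF c v]
  by (simp add: ou_def[abs_def])

lemma integrable_mult_bounded:
  fixes g v :: "'a \<Rightarrow> real"
  assumes "integrable M v" "g \<in> borel_measurable M" "\<And>x. \<bar>g x\<bar> \<le> B"
  shows "integrable M (\<lambda>x. g x * v x)"
proof (rule Bochner_Integration.integrable_bound)
  show "integrable M (\<lambda>x. B * \<bar>v x\<bar>)" using assms by auto
  have "0 \<le> B" using assms(3) abs_ge_zero order_trans by blast
  then show "AE x in M. norm (g x * v x) \<le> norm (B * \<bar>v x\<bar>)"
    using assms(3) by (auto simp: abs_mult intro!: mult_right_mono)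
qed (use assms in auto)

text \<open>Since \<open>rot c\<close> is an involution preserving the product measure, the pair (x,
  c x + s z) is exchangeable. Boundedness of g supplies the integrability for Fubini's
  theorem.\<close>

lemma ou_symmetric:
  assumes c: "0 \<le> c" "c < 1" and v: "integrable std_gaussian v"
    and [measurable]: "g \<in> borel_measurable borel" and g: "\<And>x. \<bar>g x\<bar> \<le> B"
  shows "(\<integral>x. g x * ou c v x \<partial>std_gaussian) = (\<integral>x. ou c g x * v x \<partial>std_gaussian)"
proof -
  have [measurable]: "v \<in> borel_measurable borel" using borel_measurable_integrable[OF v] by simp
  have "(\<integral>x. g x * ou c v x \<partial>std_gaussian) = (\<integral>x. \<integral>z. g x * v (c *\<^sub>R x + csn c *\<^sub>R z) \<partial>std_gaussian \<partial>std_gaussian)"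
    by (simp add: ou_def)
  also have "\<dots> = (\<integral>p. g (fst p) * v (fst (rot c p)) \<partial>gauss2)"
    by (subst std_gaussian_pair.integral_fst'[symmetric])
       (auto simp: fst_rot intro!: integrable_mult_bounded[OF integrable_gauss2_comb[OF c v]] g)
  also have "\<dots> = (\<integral>p. g (fst (rot c p)) * v (fst (rot c (rot c p))) \<partial>gauss2)"
    by (subst integral_gauss2_rot[OF c, symmetric]) auto
  also have "\<dots> = (\<integral>p. g (fst (rot c p)) * v (fst p) \<partial>gauss2)"
    using c by (simp add: rot_rot)
  also have "\<dots> = (\<integral>x. \<integral>z. g (c *\<^sub>R x + csn c *\<^sub>R z) * v x \<partial>std_gaussian \<partial>std_gaussian)"
    using v by (subst std_gaussian_pair.integral_fst'[symmetric])
       (auto simp: fst_rot integrable_gauss2_fst intro!: integrable_mult_bounded g)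
  also have "\<dots> = (\<integral>x. ou c g x * v x \<partial>std_gaussian)"
    by (simp add: ou_def)
  finally show ?thesis .
qed

text \<open>The independent noises \<open>d * csn c\<close> z and \<open>csn d\<close> w add up to
  variance d^2 (1 - c^2) + 1 - d^2 = 1 - (c d)^2, which is the noise of
  \<open>ou (c * d)\<close>.\<close>

lemma ou_semigroup:
  fixes v :: "'a::euclidean_space \<Rightarrow> real"
  assumes c: "0 \<le> c" "c < 1" and d: "0 \<le> d" "d < 1" and v: "integrable std_gaussian v"
  shows "ou c (ou d v) x = ou (c * d) v x"
proof -
  have [measurable]: "v \<in> borel_measurable borel" using borel_measurable_integrable[OF v] by simp
  have cd: "0 \<le> c * d" "c * d < 1" using c d mult_left_le[of d c] by auto
  define S where "S = csn (c * d)"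
  have S: "S > 0" and S2: "S\<^sup>2 = 1 - (c * d)\<^sup>2" using csn_pos csn_sq cd by (auto simp: S_def)
  \<comment> \<open>The share of the first noise in the total one. The share of the second is then
    \<open>csn a\<close>, so the combined noise is S times the first component of
    \<open>rot a\<close>.\<close>
  define a where "a = d * csn c / S"
  have a2: "a\<^sup>2 = 1 - (csn d)\<^sup>2 / S\<^sup>2"
  proof -
    have 1: "a\<^sup>2 * S\<^sup>2 = d\<^sup>2 * (1 - c\<^sup>2)" using S csn_sq[of c] c by (simp add: a_def power_mult_distrib power_divide)
    have 2: "(csn d)\<^sup>2 = 1 - d\<^sup>2" using csn_sq[of d] d by simp
    have "a\<^sup>2 * S\<^sup>2 = S\<^sup>2 - (csn d)\<^sup>2" unfolding 1 unfolding 2 S2 by (simp add: algebra_simps power_mult_distrib)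
    also have "\<dots> = (1 - (csn d)\<^sup>2 / S\<^sup>2) * S\<^sup>2" using S by (simp add: left_diff_distrib)
    finally have "a\<^sup>2 * S\<^sup>2 = (1 - (csn d)\<^sup>2 / S\<^sup>2) * S\<^sup>2" .
    then show ?thesis using S by simp
  qed
  have "a \<ge> 0" using S d csn_pos[OF c] by (simp add: a_def)
  moreover have "a\<^sup>2 < 1" using S csn_pos[OF d] by (simp add: a2)
  ultimately have a: "0 \<le> a" "a < 1" by (auto simp: power_less_one_iff abs_square_less_1)
  have ca: "csn a = csn d / S"
    using S csn_pos[OF d] by (simp add: csn_def[of a] a2 real_sqrt_divide)
  define k where "k w = v ((c * d) *\<^sub>R x + S *\<^sub>R w)" for w
  have k: "integrable std_gaussian k"
    unfolding k_def S_def by (rule ou_integrable[OF cd v])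
  have e: "v (d *\<^sub>R (c *\<^sub>R x + csn c *\<^sub>R z) + csn d *\<^sub>R w) = k (a *\<^sub>R z + csn a *\<^sub>R w)" for z w
    using S unfolding k_def ca by (simp add: a_def scaleR_add_right mult.commute add.assoc)
  have "ou c (ou d v) x = (\<integral>z. \<integral>w. k (a *\<^sub>R z + csn a *\<^sub>R w) \<partial>std_gaussian \<partial>std_gaussian)"
    by (simp add: ou_def e)
  also have "\<dots> = integral\<^sup>L std_gaussian k"
    using std_gaussian_pair.integral_fst'[OF integrable_gauss2_comb[OF a k]] integral_gauss2_comb[OF a k] by simp
  also have "\<dots> = ou (c * d) v x"
    by (simp add: ou_def k_def[abs_def] S_def)
  finally show ?thesis .
qed

section \<open>Smooth functions\<close>

lemma partial_deriv_eqI: "(g has_derivative g') (at x) \<Longrightarrow> partial_deriv i g x = g' i"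
  unfolding partial_deriv_def using frechet_derivative_at[of g g' x] by simp

lemma partial_deriv_fun_eqI:
  "(\<And>x. (g has_derivative G x) (at x)) \<Longrightarrow> (\<And>x. G x i = d x) \<Longrightarrow> partial_deriv i g = d"
  using partial_deriv_eqI[of g] by (intro ext) metis

lemma differentiable_has_partial:
  "g differentiable_on UNIV \<Longrightarrow> (g has_derivative frechet_derivative g (at x)) (at x)"
  by (auto simp: differentiable_on_def frechet_derivative_works)

lemma Ck_continuous: "Ck k g \<Longrightarrow> continuous_on UNIV g"
  by (cases k) (auto intro: differentiable_imp_continuous_on)

lemma Ck_SucD: "Ck (Suc k) g \<Longrightarrow> Ck k g"
proof (induction k arbitrary: g)
  case 0
  then show ?case using Ck_continuous[OF 0] by simp
qed auto

text \<open>Induction on the order for all of S at once. A class of functions stable under partial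
  differentiation is thus smooth without any formula for its higher derivatives.\<close>

lemma smooth_coinduct:
  assumes "g \<in> S" "\<And>h. h \<in> S \<Longrightarrow> h differentiable_on UNIV"
    and "\<And>h i. h \<in> S \<Longrightarrow> i \<in> Basis \<Longrightarrow> partial_deriv i h \<in> S"
  shows "smooth g"
proof -
  have "\<forall>g\<in>S. Ck k g" for k
    by (induction k) (auto intro!: assms(2,3) differentiable_imp_continuous_on)
  then show ?thesis using assms(1) by (auto simp: smooth_def)
qed

lemma Ck_add: "Ck k g \<Longrightarrow> Ck k h \<Longrightarrow> Ck k (\<lambda>x. g x + h x)"
proof (induction k arbitrary: g h)
  case 0
  then show ?case by (auto intro: continuous_intros)
next
  case (Suc k)
  have "partial_deriv i (\<lambda>x. g x + h x) = (\<lambda>x. partial_deriv i g x + partial_deriv i h x)" for i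
    using Suc.prems
    by (intro partial_deriv_fun_eqI[OF has_derivative_add[OF differentiable_has_partial differentiable_has_partial]])
       (auto simp: partial_deriv_def)
  then show ?case using Suc by (auto intro: differentiable_on_add)
qed

lemma Ck_mult: "Ck k g \<Longrightarrow> Ck k h \<Longrightarrow> Ck k (\<lambda>x. g x * h x)"
proof (induction k arbitrary: g h)
  case 0
  then show ?case by (auto intro: continuous_intros)
next
  case (Suc k)
  have "partial_deriv i (\<lambda>x. g x * h x) = (\<lambda>x. g x * partial_deriv i h x + partial_deriv i g x * h x)" for i
    using Suc.prems
    by (intro partial_deriv_fun_eqI[OF has_derivative_mult[OF differentiable_has_partial differentiable_has_partial]])
       (auto simp: partial_deriv_def)
  moreover have "(\<lambda>x. g x * h x) differentiable_on UNIV"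
    using Suc.prems by (auto simp: differentiable_on_def intro: differentiable_mult)
  moreover have "Ck k g" "Ck k h" using Suc.prems Ck_SucD by blast+
  ultimately show ?case using Suc by (auto intro!: Ck_add)
qed

lemma partial_deriv_compose:
  fixes \<phi> :: "real \<Rightarrow> real"
  assumes "\<phi> differentiable_on UNIV" "h differentiable_on UNIV"
  shows "partial_deriv i (\<lambda>x. \<phi> (h x)) x = partial_deriv 1 \<phi> (h x) * partial_deriv i h x"
proof -
  note 1 = differentiable_has_partial[OF assms(1), of "h x"]
  note 2 = differentiable_has_partial[OF assms(2), of x]
  have "partial_deriv i (\<lambda>x. \<phi> (h x)) x = frechet_derivative \<phi> (at (h x)) (frechet_derivative h (at x) i)"
    using has_derivative_compose[OF 2 1] by (rule partial_deriv_eqI)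
  also have "\<dots> = frechet_derivative \<phi> (at (h x)) (frechet_derivative h (at x) i *\<^sub>R 1)"
    by simp
  also have "\<dots> = frechet_derivative h (at x) i *\<^sub>R frechet_derivative \<phi> (at (h x)) 1"
    using 1 by (intro linear_scale has_derivative_linear)
  finally show ?thesis by (simp add: partial_deriv_def)
qed

lemma differentiable_on_compose_UNIV:
  assumes "\<phi> differentiable_on UNIV" "h differentiable_on UNIV"
  shows "(\<lambda>x. \<phi> (h x)) differentiable_on UNIV"
proof -
  have "\<exists>D. ((\<lambda>x. \<phi> (h x)) has_derivative D) (at x)" for x
    using has_derivative_compose[OF differentiable_has_partial[OF assms(2), of x] differentiable_has_partial[OF assms(1), of "h x"]]
    by blast
  then show ?thesis by (auto simp: differentiable_on_def differentiable_def)
qed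

lemma Ck_compose:
  fixes \<phi> :: "real \<Rightarrow> real"
  shows "Ck k \<phi> \<Longrightarrow> Ck k h \<Longrightarrow> Ck k (\<lambda>x. \<phi> (h x))"
proof (induction k arbitrary: \<phi> h)
  case 0
  then show ?case using continuous_on_compose2[of UNIV \<phi> UNIV h] by auto
next
  case (Suc k)
  have "partial_deriv i (\<lambda>x. \<phi> (h x)) = (\<lambda>x. partial_deriv 1 \<phi> (h x) * partial_deriv i h x)" for i
    using Suc.prems by (intro ext partial_deriv_compose) auto
  moreover have "Ck k h" using Suc.prems Ck_SucD by blast
  moreover from this have "Ck k (\<lambda>x. partial_deriv 1 \<phi> (h x))"
    by (rule Suc.IH[rotated]) (use Suc.prems in auto)
  moreover have "(\<lambda>x. \<phi> (h x)) differentiable_on UNIV"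
    by (rule differentiable_on_compose_UNIV) (use Suc.prems in auto)
  ultimately show ?case using Suc.prems by (simp add: Ck_mult)
qed

lemma smooth_add: "smooth g \<Longrightarrow> smooth h \<Longrightarrow> smooth (\<lambda>x. g x + h x)"
  and smooth_mult: "smooth g \<Longrightarrow> smooth h \<Longrightarrow> smooth (\<lambda>x. g x * h x)"
  and smooth_compose: "smooth \<phi> \<Longrightarrow> smooth h \<Longrightarrow> smooth (\<lambda>x. \<phi> (h x))" for \<phi> :: "real \<Rightarrow> real"
  unfolding smooth_def using Ck_add[of _ g h] Ck_mult[of _ g h] Ck_compose[of _ \<phi> h] by blast+

lemma smooth_differentiable: "smooth g \<Longrightarrow> g differentiable_on UNIV"
  and smooth_partial_deriv: "smooth g \<Longrightarrow> i \<in> Basis \<Longrightarrow> smooth (partial_deriv i g)"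
  unfolding smooth_def using Ck.simps(2) by blast+

lemma smooth_continuous: "smooth g \<Longrightarrow> continuous_on A g"
  using differentiable_imp_continuous_on[OF smooth_differentiable] continuous_on_subset by blast

lemma smooth_has_derivative: "smooth g \<Longrightarrow> (g has_derivative frechet_derivative g (at x)) (at x)"
  by (rule differentiable_has_partial[OF smooth_differentiable])

lemma smooth_const: "smooth (\<lambda>x::'a::euclidean_space. r)"
proof (rule smooth_coinduct[where S="range (\<lambda>r x. r)"])
  fix h :: "'a \<Rightarrow> real" and i :: 'a
  assume "h \<in> range (\<lambda>r x. r)"
  then obtain r where h: "h = (\<lambda>x. r)" by auto
  have "partial_deriv i h = (\<lambda>x. 0)"
    unfolding h by (rule partial_deriv_fun_eqI[OF has_derivative_const]) simp
  then show "partial_deriv i h \<in> range (\<lambda>r x. r)" by auto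
qed (auto intro: differentiable_on_const)

lemma partial_deriv_inner: "partial_deriv i (\<lambda>x. x \<bullet> u) x = i \<bullet> u"
  by (rule partial_deriv_eqI) (auto intro!: derivative_eq_intros)

lemma smooth_inner: "smooth (\<lambda>x::'a::euclidean_space. x \<bullet> u)"
proof -
  have "Ck k (\<lambda>x::'a. x \<bullet> u)" for k
  proof (cases k)
    case 0
    then show ?thesis by (auto intro: continuous_intros)
  next
    case (Suc n)
    have "partial_deriv i (\<lambda>x::'a. x \<bullet> u) = (\<lambda>x. i \<bullet> u)" for i
      by (intro ext partial_deriv_inner)
    moreover have "(\<lambda>x::'a. x \<bullet> u) differentiable_on UNIV"
      by (auto simp: differentiable_on_def intro!: derivative_intros)
    ultimately show ?thesis using Suc smooth_const[of "i \<bullet> u" for i] by (auto simp: smooth_def)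
  qed
  then show ?thesis by (simp add: smooth_def)
qed

lemma smooth_sum:
  "finite I \<Longrightarrow> (\<And>j. j \<in> I \<Longrightarrow> smooth (g j)) \<Longrightarrow> smooth (\<lambda>x. \<Sum>j\<in>I. g j x)"
  by (induction I rule: finite_induct) (auto intro: smooth_const smooth_add)

lemma smooth_norm_square: "smooth (\<lambda>x::'a::euclidean_space. (norm x)\<^sup>2)"
  unfolding norm_square_eq_sum unfolding power2_eq_square
  by (intro smooth_sum smooth_mult smooth_inner) auto

lemma smooth_real_seq:
  fixes D :: "nat \<Rightarrow> real \<Rightarrow> real"
  assumes D: "\<And>k t. (D k has_real_derivative D (Suc k) t) (at t)"
  shows "smooth (D 0)"
proof (rule smooth_coinduct[where S="range D"])
  fix h assume "h \<in> range D"
  then obtain k where h: "h = D k" by auto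
  show "h differentiable_on UNIV"
    using D unfolding h differentiable_on_def by (meson differentiable_at_withinI field_differentiable_def field_differentiable_imp_differentiable)
  fix i :: real assume "i \<in> Basis"
  then have i: "i = 1" by simp
  have "partial_deriv i h = D (Suc k)"
    unfolding h i by (rule partial_deriv_fun_eqI[OF D[unfolded has_field_derivative_def]]) simp
  then show "partial_deriv i h \<in> range D" by auto
qed auto

lemma smooth_exp: "smooth (exp :: real \<Rightarrow> real)"
  by (rule smooth_real_seq[where D="\<lambda>_. exp"]) (auto intro!: derivative_eq_intros)

section \<open>Smooth cutoffs with controlled gradient\<close>

text \<open>The class of the functions \<open>flat p\<close> is closed under differentiation.\<close>

definition flat :: "real poly \<Rightarrow> real \<Rightarrow> real" where
  "flat p t = (if t \<le> 0 then 0 else poly p (1 / t) * exp (- (1 / t)))"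

lemma poly_times_exp_minus_tendsto: "((\<lambda>s. poly p s * exp (- s)) \<longlongrightarrow> (0::real)) at_top"
proof -
  have "((\<lambda>s. \<Sum>i\<le>degree p. coeff p i * (s ^ i / exp s)) \<longlongrightarrow> (\<Sum>i\<le>degree p. coeff p i * 0)) at_top"
    by (intro tendsto_intros tendsto_power_div_exp_0)
  then show ?thesis
    by (simp add: poly_altdef sum_distrib_right exp_minus divide_inverse mult.assoc)
qed

lemma flat_tendsto_0: "(flat p \<longlongrightarrow> 0) (at 0)"
proof (rule filterlim_split_at)
  show "(flat p \<longlongrightarrow> 0) (at_left 0)"
    by (rule tendsto_eventually) (auto simp: eventually_at_filter flat_def)
  have "((\<lambda>t. poly p (1 / t) * exp (- (1 / t))) \<longlongrightarrow> 0) (at_right 0)"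
    using filterlim_compose[OF poly_times_exp_minus_tendsto filterlim_inverse_at_top_right, of p]
    by (simp add: inverse_eq_divide)
  then show "(flat p \<longlongrightarrow> 0) (at_right 0)"
    by (rule Lim_transform_eventually) (auto simp: eventually_at_filter flat_def)
qed

text \<open>With s = 1 / t the chain rule gives ds/dt = - s^2, so p(s) exp(- s) has derivative s^2
  (p(s) - p'(s)) exp(- s); the polynomial \<open>[:0, 0, 1:]\<close> is s^2.\<close>

lemma flat_has_derivative:
  "(flat p has_real_derivative flat ([:0, 0, 1:] * (p - pderiv p)) t) (at t)"
proof -
  consider "t < 0" | "t = 0" | "t > 0" by linarith
  then show ?thesis
  proof cases
    case 1
    have "((\<lambda>_. 0) has_real_derivative flat ([:0, 0, 1:] * (p - pderiv p)) t) (at t)"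
      using 1 by (simp add: flat_def)
    then show ?thesis
      by (rule has_field_derivative_transform_within_open[where S="{..<0}"]) (use 1 in \<open>auto simp: flat_def\<close>)
  next
    case 2
    \<comment> \<open>The difference quotient at 0 is again of the form \<open>flat\<close>, with p
      multiplied by s = 1 / h; hence it tends to 0.\<close>
    have "((\<lambda>h. (flat p (0 + h) - flat p 0) / h) \<longlongrightarrow> 0) (at 0)"
    proof (rule Lim_transform_eventually[OF flat_tendsto_0[of "[:0, 1:] * p"]])
      show "\<forall>\<^sub>F h in at 0. flat ([:0, 1:] * p) h = (flat p (0 + h) - flat p 0) / h"
        by (auto simp: eventually_at_filter flat_def)
    qed
    then show ?thesis using 2 by (simp add: DERIV_def flat_def)
  next
    case 3
    have "((\<lambda>t. poly p (1 / t) * exp (- (1 / t))) has_real_derivative flat ([:0, 0, 1:] * (p - pderiv p)) t) (at t)"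
      using 3 by (auto intro!: derivative_eq_intros DERIV_chain2[OF poly_DERIV] simp: flat_def field_simps power2_eq_square)
    then show ?thesis
      by (rule has_field_derivative_transform_within_open[where S="{0<..}"]) (use 3 in \<open>auto simp: flat_def\<close>)
  qed
qed

lemma smooth_flat: "smooth (flat p)"
proof -
  define q where "q k = ((\<lambda>p. [:0, 0, 1:] * (p - pderiv p)) ^^ k) p" for k
  have "smooth (flat (q 0))"
    by (rule smooth_real_seq) (simp only: q_def funpow.simps o_apply flat_has_derivative)
  then show ?thesis by (simp add: q_def)
qed

text \<open>For t > 0 the value is s^2 exp(- s) with s = 1 / t, and exp s >= s^2 / 2.\<close>

lemma flat_one_derivative_bound: "\<bar>flat ([:0, 0, 1:] * (1 - pderiv 1)) t\<bar> \<le> 2"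
proof (cases "t > 0")
  case True
  let ?s = "1 / t"
  have s: "?s \<ge> 0" using True by simp
  have "?s\<^sup>2 / 2 \<le> exp ?s" using exp_lower_Taylor_quadratic[OF s] s by linarith
  then have "?s\<^sup>2 * exp (- ?s) \<le> (2 * exp ?s) * exp (- ?s)" by (intro mult_right_mono) auto
  then have "?s\<^sup>2 * exp (- ?s) \<le> 2" by (simp only: mult.assoc exp_minus_inverse mult_1_right)
  then show ?thesis using True by (simp add: flat_def pderiv_1 power2_eq_square abs_mult)
qed (simp add: flat_def)

text \<open>The factor \<open>exp 1\<close> makes the value at the origin 1, and using the squared
  norm keeps the argument polynomial, hence smooth at the origin as well.\<close>

definition bump :: "real \<Rightarrow> 'a::euclidean_space \<Rightarrow> real" where
  "bump r x = exp 1 * flat 1 (1 - (norm x)\<^sup>2 / r\<^sup>2)"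

lemma bump_nonneg: "bump r x \<ge> 0"
  by (simp add: bump_def flat_def)

lemma bump_le_1: "bump r x \<le> 1"
proof -
  have "exp (- (1 / t)) \<le> exp (- 1)" if "0 < t" "t \<le> 1" for t :: real
    using that by (simp add: field_simps)
  moreover have "1 - (norm x)\<^sup>2 / r\<^sup>2 \<le> 1" by simp
  ultimately have "flat 1 (1 - (norm x)\<^sup>2 / r\<^sup>2) \<le> exp (- 1)"
    unfolding flat_def by (auto simp del: exp_le_cancel_iff)
  then show ?thesis by (simp add: bump_def exp_minus field_simps)
qed

lemma bump_eq_0: "r > 0 \<Longrightarrow> norm x \<ge> r \<Longrightarrow> bump r x = 0"
  by (simp add: bump_def flat_def power_mono)

lemma smooth_bump: "smooth (bump r)"
proof -
  have "smooth (\<lambda>x::'a. exp 1 * flat 1 (1 + (- 1 / r\<^sup>2) * (norm x)\<^sup>2))"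
    by (intro smooth_mult smooth_const smooth_compose[OF smooth_flat] smooth_add smooth_norm_square)
  then show ?thesis by (simp add: bump_def[abs_def])
qed

lemma test_function_bump: "r > 0 \<Longrightarrow> test_function (bump r)"
  unfolding test_function_def
  by (intro conjI exI[of _ "cball 0 r"] smooth_bump allI impI bump_eq_0 compact_cball) auto

text \<open>The derivative of \<open>flat 1\<close> contributes at most 2 and the inner derivative
  at most 2 |x| / r^2 <= 2 / r inside the ball; outside it the former vanishes. The decay in 1 / r
  is what removes the cutoff error in integrations by parts.\<close>

lemma partial_deriv_bump_bound:
  fixes x i :: "'a::euclidean_space"
  assumes r: "r > 0" and i: "i \<in> Basis"
  shows "\<bar>partial_deriv i (bump r) x\<bar> \<le> 4 * exp 1 / r"
proof -
  let ?d = "flat ([:0, 0, 1:] * (1 - pderiv 1)) (1 - (norm x)\<^sup>2 / r\<^sup>2)"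
  have e: "partial_deriv i (bump r) x = exp 1 * (?d * (- 2 * (x \<bullet> i) / r\<^sup>2))"
  proof -
    have "((\<lambda>x::'a. 1 - (x \<bullet> x) * k) has_derivative (\<lambda>h. - 2 * (x \<bullet> h) * k)) (at x)" for k
      by (auto intro!: derivative_eq_intros simp: inner_commute)
    from this[of "1 / r\<^sup>2"] have "((\<lambda>x::'a. flat 1 (1 - (x \<bullet> x) * (1 / r\<^sup>2))) has_derivative
       (\<lambda>h. flat ([:0, 0, 1:] * (1 - pderiv 1)) (1 - (x \<bullet> x) * (1 / r\<^sup>2)) * (- 2 * (x \<bullet> h) * (1 / r\<^sup>2)))) (at x)"
      using has_derivative_compose[OF _ flat_has_derivative[unfolded has_field_derivative_def]] by blast
    then have "((\<lambda>x::'a. exp 1 * flat 1 (1 - (x \<bullet> x) * (1 / r\<^sup>2))) has_derivative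
       (\<lambda>h. exp 1 * (flat ([:0, 0, 1:] * (1 - pderiv 1)) (1 - (x \<bullet> x) * (1 / r\<^sup>2)) * (- 2 * (x \<bullet> h) * (1 / r\<^sup>2))))) (at x)"
      by (rule has_derivative_mult_right)
    then show ?thesis
      by (subst partial_deriv_eqI[of "bump r" _ x]) (auto simp: bump_def[abs_def] power2_norm_eq_inner)
  qed
  show ?thesis
  proof (cases "norm x < r")
    case True
    have "\<bar>x \<bullet> i\<bar> \<le> r" using Basis_le_norm[OF i, of x] True by simp
    then have "\<bar>- 2 * (x \<bullet> i) / r\<^sup>2\<bar> \<le> 2 * r / r\<^sup>2"
      using r by (auto simp: abs_mult intro!: divide_right_mono)
    then have b: "\<bar>- 2 * (x \<bullet> i) / r\<^sup>2\<bar> \<le> 2 / r" using r by (simp add: power2_eq_square)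
    have "\<bar>?d * (- 2 * (x \<bullet> i) / r\<^sup>2)\<bar> \<le> 2 * (2 / r)"
      unfolding abs_mult[of ?d] by (intro mult_mono flat_one_derivative_bound b) auto
    then have "exp 1 * \<bar>?d * (- 2 * (x \<bullet> i) / r\<^sup>2)\<bar> \<le> exp 1 * (2 * (2 / r))"
      by (rule mult_left_mono) simp
    then show ?thesis unfolding e abs_mult[of "exp 1"] by (simp add: mult_ac)
  next
    case False
    then have "(norm x)\<^sup>2 / r\<^sup>2 \<ge> 1" using r by (simp add: power_mono)
    then have "?d = 0" by (simp add: flat_def)
    then show ?thesis unfolding e using r by simp
  qed
qed

lemma bump_tendsto_1: "(\<lambda>n. bump (real (Suc n)) x) \<longlonglongrightarrow> 1"
proof -
  have "(\<lambda>n. (norm x / real (Suc n))\<^sup>2) \<longlonglongrightarrow> 0\<^sup>2"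
    by (intro tendsto_power LIMSEQ_Suc lim_const_over_n)
  then have "(\<lambda>n. 1 - (norm x)\<^sup>2 / (real (Suc n))\<^sup>2) \<longlonglongrightarrow> 1 - 0"
    by (intro tendsto_diff) (auto simp: power_divide)
  moreover have "isCont (flat 1) 1" using flat_has_derivative DERIV_isCont by blast
  ultimately have "(\<lambda>n. flat 1 (1 - (norm x)\<^sup>2 / (real (Suc n))\<^sup>2)) \<longlonglongrightarrow> flat 1 1"
    using isCont_tendsto_compose[of 1 "flat 1"] by auto
  then have "(\<lambda>n. bump (real (Suc n)) x) \<longlonglongrightarrow> exp 1 * flat 1 1"
    unfolding bump_def by (intro tendsto_mult tendsto_const)
  then show ?thesis by (simp add: flat_def exp_minus)
qed

section \<open>Smoothing by the flow\<close>

text \<open>Up to a Gaussian factor in x, \<open>ou c v\<close> is a Laplace transform, and differentiating a Laplace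
  transform multiplies the weight by a linear function; hence it is smooth.\<close>

definition exp_integrable :: "('a::euclidean_space \<Rightarrow> real) \<Rightarrow> bool" where
  "exp_integrable w \<longleftrightarrow> w \<in> borel_measurable borel \<and>
     (\<forall>R. integrable std_gaussian (\<lambda>y. exp (R * norm y) * \<bar>w y\<bar>))"

definition laplace :: "real \<Rightarrow> ('a::euclidean_space \<Rightarrow> real) \<Rightarrow> 'a \<Rightarrow> real" where
  "laplace b w x = (\<integral>y. exp (b * (x \<bullet> y)) * w y \<partial>std_gaussian)"

lemma exp_integrable_measurable: "exp_integrable w \<Longrightarrow> w \<in> borel_measurable borel"
  by (simp add: exp_integrable_def)

lemma exp_integrable_bound:
  fixes k w :: "'a::euclidean_space \<Rightarrow> real"
  assumes w: "exp_integrable w" and [measurable]: "k \<in> borel_measurable borel"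
    and k: "\<And>y. \<bar>k y\<bar> \<le> C * exp (R * norm y) * \<bar>w y\<bar>"
  shows "integrable std_gaussian k"
proof (rule Bochner_Integration.integrable_bound)
  show "integrable std_gaussian (\<lambda>y. C * (exp (R * norm y) * \<bar>w y\<bar>))"
    using w by (intro integrable_mult_right) (simp add: exp_integrable_def)
  show "AE y in std_gaussian. norm (k y) \<le> norm (C * (exp (R * norm y) * \<bar>w y\<bar>))"
    using order_trans[OF k abs_ge_self] by (intro AE_I2) (simp only: real_norm_def mult.assoc)
qed simp

lemma exp_inner_le: "exp (b * (x \<bullet> y)) \<le> exp (\<bar>b\<bar> * norm x * norm y)" for x y :: "'a::real_inner"
proof -
  have "b * (x \<bullet> y) \<le> \<bar>b\<bar> * \<bar>x \<bullet> y\<bar>" by (simp add: abs_mult[symmetric])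
  also have "\<dots> \<le> \<bar>b\<bar> * (norm x * norm y)"
    by (intro mult_left_mono Cauchy_Schwarz_ineq2) auto
  finally show ?thesis by (simp add: mult.assoc)
qed

lemma integrable_laplace:
  assumes w: "exp_integrable w"
  shows "integrable std_gaussian (\<lambda>y. exp (b * (x \<bullet> y)) * w y)"
proof (rule exp_integrable_bound[OF w, where C=1 and R="\<bar>b\<bar> * norm x"])
  show "\<bar>exp (b * (x \<bullet> y)) * w y\<bar> \<le> 1 * exp (\<bar>b\<bar> * norm x * norm y) * \<bar>w y\<bar>" for y
    using exp_inner_le[of b x y] by (simp add: abs_mult mult_right_mono)
qed (use exp_integrable_measurable[OF w] in measurable)

lemma le_exp_self: "t \<le> exp t" for t :: real
  using exp_ge_add_one_self[of t] by linarith

text \<open>A linear factor is at most exp |y| up to a constant and merely raises the rate R by 1,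
  which is harmless since integrability is demanded for all rates.\<close>

lemma exp_integrable_inner_mult:
  fixes w :: "'a::euclidean_space \<Rightarrow> real"
  assumes w: "exp_integrable w" and i: "i \<in> Basis"
  shows "exp_integrable (\<lambda>y. b * (y \<bullet> i) * w y)"
proof -
  note [measurable] = exp_integrable_measurable[OF w]
  have "integrable std_gaussian (\<lambda>y. exp (R * norm y) * \<bar>b * (y \<bullet> i) * w y\<bar>)" for R
  proof (rule exp_integrable_bound[OF w, where C="\<bar>b\<bar>" and R="R + 1"])
    fix y :: 'a
    have "\<bar>y \<bullet> i\<bar> \<le> exp (norm y)" using Basis_le_norm[OF i, of y] le_exp_self[of "norm y"] by linarith
    then have "exp (R * norm y) * (\<bar>b\<bar> * \<bar>y \<bullet> i\<bar> * \<bar>w y\<bar>) \<le> exp (R * norm y) * (\<bar>b\<bar> * exp (norm y) * \<bar>w y\<bar>)"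
      by (intro mult_left_mono mult_right_mono) auto
    moreover have e: "exp ((R + 1) * norm y) = exp (R * norm y) * exp (norm y)"
      by (simp add: distrib_right exp_add)
    ultimately show "\<bar>exp (R * norm y) * \<bar>b * (y \<bullet> i) * w y\<bar>\<bar> \<le> \<bar>b\<bar> * exp ((R + 1) * norm y) * \<bar>w y\<bar>"
      unfolding e by (simp add: abs_mult mult_ac)
  qed simp
  then show ?thesis by (simp add: exp_integrable_def)
qed

lemma exp_second_order: "\<bar>exp t - 1 - t\<bar> \<le> t\<^sup>2 * exp \<bar>t\<bar>" for t :: real
proof -
  obtain u where u: "\<bar>u\<bar> \<le> \<bar>t\<bar>" "exp t = (\<Sum>m<2. t ^ m / fact m) + exp u / fact 2 * t ^ 2"
    using Maclaurin_exp_le[of t 2] by blast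
  have "exp t - 1 - t = exp u / 2 * t\<^sup>2" using u(2) by (simp add: numeral_2_eq_2)
  moreover have "exp u \<le> exp \<bar>t\<bar>" using u(1) by simp
  then have "exp u / 2 \<le> exp \<bar>t\<bar>" using exp_gt_zero[of u] by linarith
  then have "exp u / 2 * t\<^sup>2 \<le> exp \<bar>t\<bar> * t\<^sup>2" by (intro mult_right_mono) auto
  moreover have "0 \<le> exp u / 2 * t\<^sup>2" by simp
  ultimately show ?thesis by (metis abs_of_nonneg mult.commute)
qed

text \<open>The second-order remainder of the exponential gives an error of order |h|^2, with one
  integrable majorant in y for all |h| <= 1. The result is a full Frechet derivative, not only a
  family of partial ones.\<close>

lemma laplace_has_derivative:
  fixes w :: "'a::euclidean_space \<Rightarrow> real"
  assumes w: "exp_integrable w"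
  shows "(laplace b w has_derivative (\<lambda>h. \<integral>y. b * (h \<bullet> y) * (exp (b * (x \<bullet> y)) * w y) \<partial>std_gaussian)) (at x)"
proof -
  note [measurable] = exp_integrable_measurable[OF w]
  define D where "D h = (\<integral>y. b * (h \<bullet> y) * (exp (b * (x \<bullet> y)) * w y) \<partial>std_gaussian)" for h
  have iD: "integrable std_gaussian (\<lambda>y. b * (h \<bullet> y) * (exp (b * (x \<bullet> y)) * w y))" for h
  proof (rule exp_integrable_bound[OF w, where C="\<bar>b\<bar> * norm h" and R="\<bar>b\<bar> * norm x + 1"])
    fix y :: 'a
    have "\<bar>h \<bullet> y\<bar> \<le> norm h * exp (norm y)"
      using Cauchy_Schwarz_ineq2[of h y] mult_left_mono[OF le_exp_self[of "norm y"], of "norm h"] by simp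
    then have "(\<bar>b\<bar> * \<bar>h \<bullet> y\<bar>) * (exp (b * (x \<bullet> y)) * \<bar>w y\<bar>)
       \<le> (\<bar>b\<bar> * (norm h * exp (norm y))) * (exp (\<bar>b\<bar> * norm x * norm y) * \<bar>w y\<bar>)"
      by (intro mult_mono mult_left_mono mult_right_mono exp_inner_le) auto
    moreover have e: "exp ((\<bar>b\<bar> * norm x + 1) * norm y) = exp (\<bar>b\<bar> * norm x * norm y) * exp (norm y)"
      by (simp add: distrib_right exp_add)
    ultimately show "\<bar>b * (h \<bullet> y) * (exp (b * (x \<bullet> y)) * w y)\<bar> \<le> \<bar>b\<bar> * norm h * exp ((\<bar>b\<bar> * norm x + 1) * norm y) * \<bar>w y\<bar>"
      unfolding e by (simp add: abs_mult mult_ac)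
  qed simp
  \<comment> \<open>The rate collects |b| |x| from the factor at x, |b| from the remainder exp |b
    h.y| with |h| <= 1, and 2 from |y|^2 <= exp (2 |y|).\<close>
  define R where "R = \<bar>b\<bar> * (norm x + 1) + 2"
  define C where "C = (\<integral>y. b\<^sup>2 * (exp (R * norm y) * \<bar>w y\<bar>) \<partial>std_gaussian)"
  have iC: "integrable std_gaussian (\<lambda>y. b\<^sup>2 * (exp (R * norm y) * \<bar>w y\<bar>))"
    using w by (intro integrable_mult_right) (simp add: exp_integrable_def)
  have main: "\<bar>laplace b w (x + h) - laplace b w x - D h\<bar> \<le> (norm h)\<^sup>2 * C" if h: "norm h \<le> 1" for h
  proof -
    have pt: "\<bar>exp (b * ((x + h) \<bullet> y)) * w y - exp (b * (x \<bullet> y)) * w y - b * (h \<bullet> y) * (exp (b * (x \<bullet> y)) * w y)\<bar>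
        \<le> (norm h)\<^sup>2 * (b\<^sup>2 * (exp (R * norm y) * \<bar>w y\<bar>))" for y
    proof -
      let ?t = "b * (h \<bullet> y)"
      have hy: "\<bar>h \<bullet> y\<bar> \<le> norm h * norm y" by (rule Cauchy_Schwarz_ineq2)
      have y2: "(norm y)\<^sup>2 \<le> exp (2 * norm y)"
        using power_mono[OF le_exp_self[of "norm y"], of 2] by (simp add: exp_double)
      have t2: "?t\<^sup>2 \<le> b\<^sup>2 * ((norm h)\<^sup>2 * exp (2 * norm y))"
      proof -
        have "(h \<bullet> y)\<^sup>2 \<le> (norm h * norm y)\<^sup>2" using power_mono[OF hy, of 2] by simp
        also have "\<dots> \<le> (norm h)\<^sup>2 * exp (2 * norm y)"
          unfolding power_mult_distrib by (intro mult_left_mono y2) auto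
        finally show ?thesis unfolding power_mult_distrib by (intro mult_left_mono) auto
      qed
      have "\<bar>?t\<bar> \<le> \<bar>b\<bar> * (1 * norm y)"
        unfolding abs_mult using hy h by (intro mult_left_mono order_trans[OF hy] mult_right_mono) auto
      then have et: "exp \<bar>?t\<bar> \<le> exp (\<bar>b\<bar> * norm y)" by simp
      have eR: "exp (R * norm y) = exp (\<bar>b\<bar> * norm x * norm y) * (exp (2 * norm y) * exp (\<bar>b\<bar> * norm y))"
        unfolding R_def by (simp add: exp_add[symmetric] algebra_simps)
      have "exp (b * ((x + h) \<bullet> y)) = exp (b * (x \<bullet> y)) * exp ?t"
        by (simp add: inner_add_left exp_add distrib_left)
      then have "\<bar>exp (b * ((x + h) \<bullet> y)) * w y - exp (b * (x \<bullet> y)) * w y - ?t * (exp (b * (x \<bullet> y)) * w y)\<bar>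
        = \<bar>exp (b * (x \<bullet> y)) * (exp ?t - 1 - ?t) * w y\<bar>"
        by (simp add: algebra_simps)
      also have "\<dots> = exp (b * (x \<bullet> y)) * \<bar>exp ?t - 1 - ?t\<bar> * \<bar>w y\<bar>" by (simp add: abs_mult)
      also have "\<dots> \<le> exp (\<bar>b\<bar> * norm x * norm y) * ((b\<^sup>2 * ((norm h)\<^sup>2 * exp (2 * norm y))) * exp (\<bar>b\<bar> * norm y)) * \<bar>w y\<bar>"
        by (intro mult_mono mult_right_mono exp_inner_le order_trans[OF exp_second_order] t2 et) auto
      also have "\<dots> = (norm h)\<^sup>2 * (b\<^sup>2 * (exp (R * norm y) * \<bar>w y\<bar>))"
        unfolding eR by (simp only: mult_ac)
      finally show ?thesis .
    qed
    have eq: "laplace b w (x + h) - laplace b w x - D h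
      = (\<integral>y. exp (b * ((x + h) \<bullet> y)) * w y - exp (b * (x \<bullet> y)) * w y - b * (h \<bullet> y) * (exp (b * (x \<bullet> y)) * w y) \<partial>std_gaussian)"
      unfolding laplace_def D_def
      by (simp add: Bochner_Integration.integral_diff Bochner_Integration.integrable_diff integrable_laplace[OF w] iD del: inner_add_left)
    have "\<bar>laplace b w (x + h) - laplace b w x - D h\<bar> \<le> (\<integral>y. (norm h)\<^sup>2 * (b\<^sup>2 * (exp (R * norm y) * \<bar>w y\<bar>)) \<partial>std_gaussian)"
      unfolding eq
      by (rule Bochner_Integration.integral_abs_bound_integral[OF _ integrable_mult_right[OF iC] pt])
         (intro Bochner_Integration.integrable_diff integrable_laplace[OF w] iD)
    also have "\<dots> = (norm h)\<^sup>2 * C" unfolding C_def by (rule integral_mult_right_zero)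
    finally show ?thesis .
  qed
  have "bounded_linear D"
    unfolding linear_conv_bounded_linear[symmetric]
  proof (rule linearI)
    show "D (h + k) = D h + D k" for h k
      unfolding D_def by (subst Bochner_Integration.integral_add[symmetric, OF iD iD]) (simp add: inner_add_left algebra_simps)
    show "D (r *\<^sub>R h) = r *\<^sub>R D h" for r h
      unfolding D_def by (subst integral_scaleR_right[symmetric]) (simp add: mult_ac)
  qed
  then have "(laplace b w has_derivative D) (at x)"
  proof (rule has_derivativeI_sandwich[of 1, rotated])
    show "((\<lambda>y. norm (y - x) * C) \<longlongrightarrow> 0) (at x)"
      by (rule tendsto_eq_rhs[OF tendsto_mult_right[OF tendsto_norm[OF LIM_zero[OF tendsto_ident_at]]]]) simp
    show "norm (laplace b w y - laplace b w x - D (y - x)) / norm (y - x) \<le> norm (y - x) * C"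
      if "y \<noteq> x" "dist y x < 1" for y
      using main[of "y - x"] that by (simp add: dist_norm divide_simps power2_eq_square mult_ac)
  qed simp
  then show ?thesis by (simp add: D_def[abs_def])
qed

lemma partial_deriv_laplace:
  assumes w: "exp_integrable w" and i: "i \<in> Basis"
  shows "partial_deriv i (laplace b w) = laplace b (\<lambda>y. b * (y \<bullet> i) * w y)"
  by (rule partial_deriv_fun_eqI[OF laplace_has_derivative[OF w]])
     (simp add: laplace_def inner_commute mult_ac)

lemma smooth_laplace:
  fixes w :: "'a::euclidean_space \<Rightarrow> real"
  assumes "exp_integrable w"
  shows "smooth (laplace b w)"
proof (rule smooth_coinduct[where S="{laplace b w | w. exp_integrable w}"])
  show "h differentiable_on UNIV" if "h \<in> {laplace b w | w. exp_integrable w}" for h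
    using that laplace_has_derivative unfolding differentiable_on_def differentiable_def by blast
  show "partial_deriv i h \<in> {laplace b w | w. exp_integrable w}"
    if "h \<in> {laplace b w | w. exp_integrable w}" "i \<in> Basis" for h i
    using that exp_integrable_inner_mult partial_deriv_laplace by fastforce
qed (use assms in blast)

context
  fixes c :: real assumes c: "0 < c" "c < 1"
begin

text \<open>A Gaussian factor exp(- a r^2) beats every exponential, because R r - a r^2 <= R^2 / (4
  a). The coefficient a is positive thanks to c > 0.\<close>

lemma exp_integrable_ou_weight:
  fixes v :: "'a::euclidean_space \<Rightarrow> real"
  assumes v: "integrable std_gaussian v"
  shows "exp_integrable (\<lambda>y. exp (- (c * norm y)\<^sup>2 / (2 * (csn c)\<^sup>2)) * v y)"
proof -
  have [measurable]: "v \<in> borel_measurable borel" using borel_measurable_integrable[OF v] by simp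
  define a where "a = c\<^sup>2 / (2 * (csn c)\<^sup>2)"
  have a: "a > 0" using c csn_pos[of c] by (simp add: a_def)
  have "integrable std_gaussian (\<lambda>y. exp (R * norm y) * \<bar>exp (- (c * norm y)\<^sup>2 / (2 * (csn c)\<^sup>2)) * v y\<bar>)" for R
  proof (rule Bochner_Integration.integrable_bound)
    show "integrable std_gaussian (\<lambda>y. exp (R\<^sup>2 / (4 * a)) * \<bar>v y\<bar>)"
      using v by (intro integrable_mult_right integrable_abs)
    show "AE y in std_gaussian. norm (exp (R * norm y) * \<bar>exp (- (c * norm y)\<^sup>2 / (2 * (csn c)\<^sup>2)) * v y\<bar>)
       \<le> norm (exp (R\<^sup>2 / (4 * a)) * \<bar>v y\<bar>)"
    proof (intro AE_I2)
      fix y :: 'a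
      have "0 \<le> (2 * a * norm y - R)\<^sup>2 / (4 * a)" using a by simp
      also have "\<dots> = a * (norm y)\<^sup>2 - R * norm y + R\<^sup>2 / (4 * a)"
        using a by (simp add: power2_diff field_simps power2_eq_square)
      finally have "R * norm y + - (c * norm y)\<^sup>2 / (2 * (csn c)\<^sup>2) \<le> R\<^sup>2 / (4 * a)"
        by (simp add: a_def power_mult_distrib)
      then have "exp (R * norm y) * exp (- (c * norm y)\<^sup>2 / (2 * (csn c)\<^sup>2)) \<le> exp (R\<^sup>2 / (4 * a))"
        by (simp only: exp_add[symmetric] exp_le_cancel_iff)
      then show "norm (exp (R * norm y) * \<bar>exp (- (c * norm y)\<^sup>2 / (2 * (csn c)\<^sup>2)) * v y\<bar>)
       \<le> norm (exp (R\<^sup>2 / (4 * a)) * \<bar>v y\<bar>)"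
        by (simp add: abs_mult mult.assoc[symmetric] mult_right_mono)
    qed
  qed simp
  then show ?thesis by (simp add: exp_integrable_def)
qed

lemma ou_eq_laplace:
  fixes v :: "'a::euclidean_space \<Rightarrow> real"
  assumes v: "integrable std_gaussian v"
  shows "ou c v x = exp (- (c * norm x)\<^sup>2 / (2 * (csn c)\<^sup>2)) / csn c ^ DIM('a)
     * laplace (c / (csn c)\<^sup>2) (\<lambda>y. exp (- (c * norm y)\<^sup>2 / (2 * (csn c)\<^sup>2)) * v y) x"
proof -
  have [measurable]: "v \<in> borel_measurable borel" using borel_measurable_integrable[OF v] by simp
  show ?thesis
    unfolding laplace_def using c
    by (subst ou_eq_mehler, simp, simp, simp, subst integral_mult_right_zero[symmetric])
       (simp add: mehler_def mult_ac)
qed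

lemma smooth_ou:
  fixes v :: "'a::euclidean_space \<Rightarrow> real"
  assumes v: "integrable std_gaussian v"
  shows "smooth (ou c v)"
proof -
  have "smooth (\<lambda>x. ((1 / csn c ^ DIM('a)) * exp ((- c\<^sup>2 / (2 * (csn c)\<^sup>2)) * (norm x)\<^sup>2))
     * laplace (c / (csn c)\<^sup>2) (\<lambda>y. exp (- (c * norm y)\<^sup>2 / (2 * (csn c)\<^sup>2)) * v y) x)"
    by (intro smooth_mult smooth_const smooth_compose[OF smooth_exp] smooth_norm_square
          smooth_laplace exp_integrable_ou_weight v)
  moreover have "(\<lambda>x. ((1 / csn c ^ DIM('a)) * exp ((- c\<^sup>2 / (2 * (csn c)\<^sup>2)) * (norm x)\<^sup>2))
     * laplace (c / (csn c)\<^sup>2) (\<lambda>y. exp (- (c * norm y)\<^sup>2 / (2 * (csn c)\<^sup>2)) * v y) x) = ou c v"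
    by (intro ext) (simp add: ou_eq_laplace[OF v] power_mult_distrib)
  ultimately show ?thesis by simp
qed

text \<open>The derivative falls on the kernel, whose logarithmic derivative in x is (c / s^2) (y -
  c x) with s = \<open>csn c\<close>; so v only has to be integrable.\<close>

lemma partial_deriv_ou_mehler:
  fixes v :: "'a::euclidean_space \<Rightarrow> real"
  assumes v: "integrable std_gaussian v" and i: "i \<in> Basis"
  shows "integrable std_gaussian (\<lambda>y. mehler c x y * ((((y - c *\<^sub>R x) \<bullet> i) / csn c) * v y))"
    and "partial_deriv i (ou c v) x
      = c / csn c * (\<integral>y. mehler c x y * ((((y - c *\<^sub>R x) \<bullet> i) / csn c) * v y) \<partial>std_gaussian)"
proof -
  let ?s = "csn c"
  have s: "?s > 0" using csn_pos c by auto
  have [measurable]: "v \<in> borel_measurable borel" using borel_measurable_integrable[OF v] by simp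
  define b where "b = c / ?s\<^sup>2"
  define K where "K = exp (- (c * norm x)\<^sup>2 / (2 * ?s\<^sup>2)) / ?s ^ DIM('a)"
  define w where "w y = exp (- (c * norm y)\<^sup>2 / (2 * ?s\<^sup>2)) * v y" for y
  have w: "exp_integrable w" unfolding w_def by (rule exp_integrable_ou_weight[OF v])
  note wi = exp_integrable_inner_mult[OF w i, of b]
  have m: "mehler c x y * v y = K * (exp (b * (x \<bullet> y)) * w y)" for y
    by (simp add: mehler_def K_def w_def b_def)
  \<comment> \<open>The first term is the derivative of the Laplace transform, the second that of
    the Gaussian prefactor in x.\<close>
  have pt: "c / ?s * (mehler c x y * ((((y - c *\<^sub>R x) \<bullet> i) / ?s) * v y))
     = K * (exp (b * (x \<bullet> y)) * (b * (y \<bullet> i) * w y)) - (b * c * (x \<bullet> i)) * (K * (exp (b * (x \<bullet> y)) * w y))" for y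
  proof -
    have "c / ?s * (mehler c x y * ((((y - c *\<^sub>R x) \<bullet> i) / ?s) * v y))
      = (b * (y \<bullet> i) - b * c * (x \<bullet> i)) * (mehler c x y * v y)"
      using s by (simp add: b_def inner_diff_left field_simps power2_eq_square)
    then show ?thesis unfolding m by (simp add: algebra_simps)
  qed
  have int: "integrable std_gaussian (\<lambda>y. c / ?s * (mehler c x y * ((((y - c *\<^sub>R x) \<bullet> i) / ?s) * v y)))"
    unfolding pt by (intro Bochner_Integration.integrable_diff integrable_mult_right integrable_laplace w wi)
  have "integrable std_gaussian (\<lambda>y. ?s / c * (c / ?s * (mehler c x y * ((((y - c *\<^sub>R x) \<bullet> i) / ?s) * v y))))"
    by (intro integrable_mult_right int)
  then show "integrable std_gaussian (\<lambda>y. mehler c x y * ((((y - c *\<^sub>R x) \<bullet> i) / ?s) * v y))"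
    using s c by simp
  have "((\<lambda>x::'a. exp (- (c\<^sup>2 / (2 * ?s\<^sup>2) * (x \<bullet> x))) / ?s ^ DIM('a)) has_derivative
      (\<lambda>h. (- (b * c * (x \<bullet> h))) * K)) (at x)"
  proof -
    have e: "K = exp (- (c\<^sup>2 / (2 * ?s\<^sup>2) * (x \<bullet> x))) / ?s ^ DIM('a)"
      by (simp add: K_def power_mult_distrib power2_norm_eq_inner)
    have bc: "b * c = 2 * (c\<^sup>2 / (2 * ?s\<^sup>2))" by (simp add: b_def power2_eq_square)
    have "((\<lambda>x::'a. exp (- (a * (x \<bullet> x))) * M) has_derivative (\<lambda>h. (- (2 * a * (x \<bullet> h))) * (exp (- (a * (x \<bullet> x))) * M))) (at x)"
      for a M by (auto intro!: derivative_eq_intros ext simp: inner_commute)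
    from this[of "c\<^sup>2 / (2 * ?s\<^sup>2)" "1 / ?s ^ DIM('a)"]
    show ?thesis unfolding e bc by (simp only: times_divide_eq_right mult_1_right)
  qed
  from has_derivative_mult[OF this laplace_has_derivative[OF w, of b x]]
  have "(ou c v has_derivative (\<lambda>h. K * (\<integral>y. b * (h \<bullet> y) * (exp (b * (x \<bullet> y)) * w y) \<partial>std_gaussian)
     + ((- (b * c * (x \<bullet> h))) * K) * laplace b w x)) (at x)"
    by (subst ou_eq_laplace[OF v, abs_def])
      (simp add: K_def power_mult_distrib power2_norm_eq_inner b_def w_def[abs_def])
  then have "partial_deriv i (ou c v) x = K * laplace b (\<lambda>y. b * (y \<bullet> i) * w y) x - (b * c * (x \<bullet> i)) * (K * laplace b w x)"
    by (subst partial_deriv_eqI) (auto simp: laplace_def inner_commute mult_ac)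
  also have "\<dots> = (\<integral>y. c / ?s * (mehler c x y * ((((y - c *\<^sub>R x) \<bullet> i) / ?s) * v y)) \<partial>std_gaussian)"
    unfolding pt laplace_def
    by (subst Bochner_Integration.integral_diff)
       (auto intro!: integrable_mult_right integrable_laplace w wi)
  finally show "partial_deriv i (ou c v) x
      = c / csn c * (\<integral>y. mehler c x y * ((((y - c *\<^sub>R x) \<bullet> i) / csn c) * v y) \<partial>std_gaussian)"
    by simp
qed

text \<open>The kernel formula after the substitution y = c x + s z. Combined with the commutation
  of flow and gradient it becomes Gaussian integration by parts.\<close>

lemma partial_deriv_ou:
  fixes v :: "'a::euclidean_space \<Rightarrow> real"
  assumes v: "integrable std_gaussian v" and i: "i \<in> Basis"
  shows "integrable std_gaussian (\<lambda>z. (z \<bullet> i) * v (c *\<^sub>R x + csn c *\<^sub>R z))"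
    and "partial_deriv i (ou c v) x = c / csn c * (\<integral>z. (z \<bullet> i) * v (c *\<^sub>R x + csn c *\<^sub>R z) \<partial>std_gaussian)"
proof -
  have s: "csn c > 0" using csn_pos c by auto
  have [measurable]: "v \<in> borel_measurable borel" using borel_measurable_integrable[OF v] by simp
  define k where "k y = ((((y - c *\<^sub>R x) \<bullet> i) / csn c) * v y)" for y
  have [measurable]: "k \<in> borel_measurable borel" unfolding k_def by measurable
  have k: "k (c *\<^sub>R x + csn c *\<^sub>R z) = (z \<bullet> i) * v (c *\<^sub>R x + csn c *\<^sub>R z)" for z
    using s by (simp add: k_def)
  let ?D = "distr std_gaussian borel (\<lambda>z. c *\<^sub>R x + csn c *\<^sub>R z)"
  have D: "?D = density std_gaussian (\<lambda>y. ennreal (mehler c x y))"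
    using c by (intro distr_std_gaussian_mehler) auto
  have "integrable ?D k"
    using partial_deriv_ou_mehler(1)[OF v i, of x] c
    unfolding D by (simp add: integrable_density mehler_nonneg k_def)
  then show "integrable std_gaussian (\<lambda>z. (z \<bullet> i) * v (c *\<^sub>R x + csn c *\<^sub>R z))"
    by (subst (asm) integrable_distr_eq) (auto simp: k)
  have "(\<integral>z. (z \<bullet> i) * v (c *\<^sub>R x + csn c *\<^sub>R z) \<partial>std_gaussian) = integral\<^sup>L ?D k"
    by (subst integral_distr) (auto simp: k)
  also have "\<dots> = (\<integral>y. mehler c x y * k y \<partial>std_gaussian)"
    using c unfolding D by (subst integral_density) (auto simp: mehler_nonneg)
  finally show "partial_deriv i (ou c v) x = c / csn c * (\<integral>z. (z \<bullet> i) * v (c *\<^sub>R x + csn c *\<^sub>R z) \<partial>std_gaussian)"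
    using partial_deriv_ou_mehler(2)[OF v i, of x] by (simp add: k_def)
qed

end

section \<open>Variance bound and contraction of the Fisher information\<close>

lemma measure_std_gaussian_UNIV [simp]: "measure std_gaussian (UNIV :: 'a::euclidean_space set) = 1"
  using std_gaussian.prob_space by simp

text \<open>Expand the square of G minus its projection onto the span of 1 and the coordinates;
  \<open>m\<close> is the constant part of the projection and \<open>S\<close> the linear
  one.\<close>

lemma gauss_bessel:
  fixes G :: "'a::euclidean_space \<Rightarrow> real"
  assumes [measurable]: "G \<in> borel_measurable borel" and B: "\<And>z. \<bar>G z\<bar> \<le> B"
  shows "(\<Sum>i\<in>Basis. (\<integral>z. (z \<bullet> i) * G z \<partial>std_gaussian)\<^sup>2)
    \<le> (\<integral>z. (G z)\<^sup>2 \<partial>std_gaussian) - (\<integral>z. G z \<partial>std_gaussian)\<^sup>2"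
proof -
  define m where "m = (\<integral>z. G z \<partial>std_gaussian)"
  define a where "a i = (\<integral>z. (z \<bullet> i) * G z \<partial>std_gaussian)" for i
  define S :: "'a \<Rightarrow> real" where "S z = (\<Sum>i\<in>Basis. a i * (z \<bullet> i))" for z
  have [measurable]: "S \<in> borel_measurable borel" unfolding S_def by measurable
  have B0: "B \<ge> 0" using B[of 0] by linarith
  have iG: "integrable std_gaussian G"
    by (rule std_gaussian.integrable_const_bound[where B=B]) (use B in auto)
  have iG2: "integrable std_gaussian (\<lambda>z. (G z)\<^sup>2)"
    by (rule std_gaussian.integrable_const_bound[where B="B\<^sup>2"])
       (use B B0 in \<open>auto simp: abs_le_square_iff[symmetric]\<close>)
  have izG: "integrable std_gaussian (\<lambda>z. (z \<bullet> i) * G z)" for i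
    using integrable_mult_bounded[OF integrable_gauss_inner[of i], of G B] B by (simp add: mult.commute)
  have iS: "integrable std_gaussian S" and S0: "(\<integral>z. S z \<partial>std_gaussian) = 0"
    unfolding S_def by (auto intro!: Bochner_Integration.integrable_sum integrable_mult_right integrable_gauss_inner
       simp: Bochner_Integration.integral_sum integrable_gauss_inner integral_gauss_inner)
  have GSe: "G z * S z = (\<Sum>i\<in>Basis. a i * ((z \<bullet> i) * G z))" for z
    by (simp add: S_def sum_distrib_left mult_ac)
  have iGS: "integrable std_gaussian (\<lambda>z. G z * S z)" and GS: "(\<integral>z. G z * S z \<partial>std_gaussian) = (\<Sum>i\<in>Basis. (a i)\<^sup>2)"
    unfolding GSe by (auto intro!: Bochner_Integration.integrable_sum integrable_mult_right izG
       simp: Bochner_Integration.integral_sum izG a_def[symmetric] power2_eq_square)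
  have S2e: "(S z)\<^sup>2 = (\<Sum>i\<in>Basis. \<Sum>j\<in>Basis. a i * a j * ((z \<bullet> i) * (z \<bullet> j)))" for z
    by (simp add: S_def power2_eq_square sum_product mult_ac)
  have iS2: "integrable std_gaussian (\<lambda>z. (S z)\<^sup>2)"
    unfolding S2e by (intro Bochner_Integration.integrable_sum integrable_mult_right integrable_gauss_inner_mult)
  have "(\<integral>z. (S z)\<^sup>2 \<partial>std_gaussian) = (\<Sum>i\<in>(Basis::'a set). \<Sum>j\<in>Basis. a i * a j * (if i = j then 1 else 0))"
    unfolding S2e
    by (simp add: Bochner_Integration.integral_sum Bochner_Integration.integrable_sum integrable_gauss_inner_mult
          integral_gauss_inner_mult cong: sum.cong)
  also have "\<dots> = (\<Sum>i\<in>(Basis::'a set). (a i)\<^sup>2)"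
    by (simp add: power2_eq_square if_distrib sum.delta cong: if_cong)
  finally have S2: "(\<integral>z. (S z)\<^sup>2 \<partial>std_gaussian) = (\<Sum>i\<in>(Basis::'a set). (a i)\<^sup>2)" .
  have "0 \<le> (\<integral>z. (G z - m - S z)\<^sup>2 \<partial>std_gaussian)" by simp
  also have "(\<lambda>z. (G z - m - S z)\<^sup>2) = (\<lambda>z. (G z)\<^sup>2 + m\<^sup>2 + (S z)\<^sup>2 - 2 * m * G z - 2 * (G z * S z) + 2 * m * S z)"
    by (intro ext) (simp add: power2_eq_square algebra_simps)
  also have "(\<integral>z. (G z)\<^sup>2 + m\<^sup>2 + (S z)\<^sup>2 - 2 * m * G z - 2 * (G z * S z) + 2 * m * S z \<partial>std_gaussian)
    = (\<integral>z. (G z)\<^sup>2 \<partial>std_gaussian) + m\<^sup>2 + (\<Sum>i\<in>(Basis::'a set). (a i)\<^sup>2) - 2 * m * m - 2 * (\<Sum>i\<in>(Basis::'a set). (a i)\<^sup>2) + 2 * m * 0"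
    using iG iG2 iS iGS iS2 S0 GS S2 by (simp add: m_def[symmetric] std_gaussian.prob_space)
  finally show ?thesis by (simp add: m_def[symmetric] a_def[symmetric] power2_eq_square)
qed

lemma grad_inner: "i \<in> Basis \<Longrightarrow> grad g x \<bullet> i = partial_deriv i g x"
  by (simp add: grad_def inner_sum_left inner_Basis if_distrib sum.delta cong: if_cong)

lemma norm_grad_square: "(norm (grad g x))\<^sup>2 = (\<Sum>i\<in>Basis. (partial_deriv i g x)\<^sup>2)"
  by (simp add: norm_square_eq_sum grad_inner cong: sum.cong)

lemma abs_ou_le: 
  assumes [measurable]: "g \<in> borel_measurable borel" and B: "\<And>x. \<bar>g x\<bar> \<le> B"
  shows "\<bar>ou c g x\<bar> \<le> B"
proof -
  have "\<bar>ou c g x\<bar> \<le> (\<integral>z. B \<partial>(std_gaussian::'a measure))"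
    unfolding ou_def
    by (rule Bochner_Integration.integral_abs_bound_integral)
       (use B in \<open>auto intro!: std_gaussian.integrable_const_bound[where B=B]\<close>)
  then show ?thesis by (simp add: std_gaussian.prob_space)
qed

lemma integrable_bounded:
  fixes g :: "'a::euclidean_space \<Rightarrow> real"
  assumes "g \<in> borel_measurable borel" "\<And>x. \<bar>g x\<bar> \<le> B"
  shows "integrable std_gaussian g"
  by (rule std_gaussian.integrable_const_bound[where B=B]) (use assms in auto)

text \<open>The reverse local Poincare inequality: the gradient of the smoothed function consists of the
  first Hermite coefficients of a dilate of g, so this is Bessel's inequality.\<close>

lemma ou_gradient_bound:
  fixes g :: "'a::euclidean_space \<Rightarrow> real"
  assumes c: "0 < c" "c < 1" and [measurable]: "g \<in> borel_measurable borel" and B: "\<And>x. \<bar>g x\<bar> \<le> B"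
  shows "(norm (grad (ou c g) x))\<^sup>2 \<le> (c / csn c)\<^sup>2 * (ou c (\<lambda>y. (g y)\<^sup>2) x - (ou c g x)\<^sup>2)"
proof -
  have "(norm (grad (ou c g) x))\<^sup>2
    = (c / csn c)\<^sup>2 * (\<Sum>i\<in>Basis. (\<integral>z. (z \<bullet> i) * g (c *\<^sub>R x + csn c *\<^sub>R z) \<partial>std_gaussian)\<^sup>2)"
    using integrable_bounded[of g B] B
    by (simp add: norm_grad_square partial_deriv_ou(2)[OF c] power_mult_distrib power_divide sum_distrib_left cong: sum.cong)
  also have "\<dots> \<le> (c / csn c)\<^sup>2 * (ou c (\<lambda>y. (g y)\<^sup>2) x - (ou c g x)\<^sup>2)"
    unfolding ou_def by (intro mult_left_mono gauss_bessel[where B=B] B) auto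
  finally show ?thesis .
qed

text \<open>With c = exp (- t) this is 1 / (1 + lam (exp (2 t) - 1)), rearranged so that numerator
  and denominator are quadratic in c.\<close>

definition kappa :: "real \<Rightarrow> real \<Rightarrow> real" where
  "kappa lam c = c\<^sup>2 / (c\<^sup>2 + lam * (csn c)\<^sup>2)"

lemma kappa_pos: "0 < c \<Longrightarrow> c < 1 \<Longrightarrow> lam > 0 \<Longrightarrow> kappa lam c > 0"
  by (simp add: kappa_def add_pos_nonneg)

lemma grad_minus_const: "grad (\<lambda>x. g x - m) x = grad g x" if "g differentiable (at x)"
proof -
  have "partial_deriv i (\<lambda>x. g x - m) x = partial_deriv i g x" for i
    using that unfolding frechet_derivative_works
    by (intro partial_deriv_eqI[THEN trans, OF has_derivative_diff[OF _ has_derivative_const]])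
       (auto simp: partial_deriv_def)
  then show ?thesis by (simp add: grad_def)
qed

text \<open>The Poincare inequality for the centred \<open>ou c g\<close> and the integrated
  gradient bound give lam V <= (c / s)^2 (E - V - m^2), with s = \<open>csn c\<close>, V the
  variance, m the mean and E the integral of \<open>k\<close>. Dropping m^2 and solving for V yields
  the factor.\<close>

lemma ou_variance_bound:
  fixes g f :: "'a::euclidean_space \<Rightarrow> real"
  assumes c: "0 < c" "c < 1" and lam: "lam > 0"
    and f[measurable]: "f \<in> borel_measurable borel" and f0: "\<And>x. f x \<ge> 0"
    and nu: "\<nu> = density std_gaussian (\<lambda>x. ennreal (f x))" "prob_space \<nu>" "\<nu> \<in> poincare_class lam"
    and [measurable]: "g \<in> borel_measurable borel" and B: "\<And>x. \<bar>g x\<bar> \<le> B"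
  shows "(\<integral>x. (ou c g x - (\<integral>x. ou c g x \<partial>\<nu>))\<^sup>2 \<partial>\<nu>) \<le> kappa lam c * (\<integral>x. ou c (\<lambda>y. (g y)\<^sup>2) x \<partial>\<nu>)"
proof -
  interpret nu: prob_space \<nu> by (rule nu)
  have s: "csn c > 0" using csn_pos c by auto
  have [simp, measurable_cong]: "sets \<nu> = sets borel" by (simp add: nu(1))
  have B0: "B \<ge> 0" using B[of 0] by linarith
  have B2: "\<bar>(g x)\<^sup>2\<bar> \<le> B\<^sup>2" for x using B[of x] B0 by (simp add: abs_le_square_iff[symmetric])
  define m where "m = (\<integral>x. ou c g x \<partial>\<nu>)"
  define h where "h x = ou c g x - m" for x
  define k where "k x = ou c (\<lambda>y. (g y)\<^sup>2) x" for x
  have [measurable]: "h \<in> borel_measurable borel" "k \<in> borel_measurable borel"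
    unfolding h_def[abs_def] k_def[abs_def] by auto
  have bo: "\<bar>ou c g x\<bar> \<le> B" "\<bar>k x\<bar> \<le> B\<^sup>2" for x
    unfolding k_def by (intro abs_ou_le B B2; simp)+
  have gb: "(norm (grad (ou c g) x))\<^sup>2 \<le> (c / csn c)\<^sup>2 * (k x - (ou c g x)\<^sup>2)" for x
    unfolding k_def by (rule ou_gradient_bound[OF c _ B]) simp
  have gb0: "0 \<le> (c / csn c)\<^sup>2 * (k x - (ou c g x)\<^sup>2)" for x
    using gb[of x] order_trans[OF zero_le_power2] by blast
  have io: "integrable \<nu> (ou c g)" "integrable \<nu> k"
    by (rule nu.integrable_const_bound[where B=B] nu.integrable_const_bound[where B="B\<^sup>2"]; use bo in auto)+
  have io2: "integrable \<nu> (\<lambda>x. (ou c g x)\<^sup>2)"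
  proof (rule nu.integrable_const_bound[where B="B\<^sup>2"])
    show "AE x in \<nu>. norm ((ou c g x)\<^sup>2) \<le> B\<^sup>2"
      using bo(1) B0 by (auto simp: abs_le_square_iff[symmetric])
  qed simp
  have ih: "integrable \<nu> h" unfolding h_def using io by auto
  have h0: "(\<integral>x. h x \<partial>\<nu>) = 0" unfolding h_def using io by (simp add: m_def nu.prob_space)
  have h2e: "(h x)\<^sup>2 = (ou c g x)\<^sup>2 - 2 * m * ou c g x + m\<^sup>2" for x
    by (simp add: h_def power2_eq_square algebra_simps)
  have ih2: "integrable \<nu> (\<lambda>x. (h x)\<^sup>2)" unfolding h2e using io io2 by auto
  define V where "V = (\<integral>x. (h x)\<^sup>2 \<partial>\<nu>)"
  have V: "V = (\<integral>x. (ou c g x)\<^sup>2 \<partial>\<nu>) - m\<^sup>2"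
    unfolding V_def h2e using io io2 by (simp add: m_def[symmetric] nu.prob_space power2_eq_square)
  have smo: "smooth (ou c g)" by (rule smooth_ou[OF c integrable_bounded]) (use B in auto)
  have sm: "smooth h"
    using smooth_add[OF smo smooth_const[of "- m"]] by (simp add: h_def[abs_def])
  have gh: "grad h x = grad (ou c g) x" for x
    unfolding h_def using smooth_differentiable[OF smo]
    by (intro grad_minus_const) (simp add: differentiable_on_def)
  have "ennreal lam * (\<integral>\<^sup>+x. ennreal ((h x)\<^sup>2) \<partial>\<nu>) \<le> (\<integral>\<^sup>+x. ennreal ((norm (grad h x))\<^sup>2) \<partial>\<nu>)"
    using nu(3) sm ih h0 by (auto simp: poincare_class_def)
  also have "\<dots> \<le> (\<integral>\<^sup>+x. ennreal ((c / csn c)\<^sup>2 * (k x - (ou c g x)\<^sup>2)) \<partial>\<nu>)"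
    unfolding gh by (intro nn_integral_mono ennreal_leI gb)
  also have "\<dots> = ennreal (\<integral>x. (c / csn c)\<^sup>2 * (k x - (ou c g x)\<^sup>2) \<partial>\<nu>)"
  proof (rule nn_integral_eq_integral)
    show "integrable \<nu> (\<lambda>x. (c / csn c)\<^sup>2 * (k x - (ou c g x)\<^sup>2))" using io io2 by auto
    show "AE x in \<nu>. 0 \<le> (c / csn c)\<^sup>2 * (k x - (ou c g x)\<^sup>2)"
      by (intro AE_I2 gb0)
  qed
  also have "(\<integral>x. (c / csn c)\<^sup>2 * (k x - (ou c g x)\<^sup>2) \<partial>\<nu>) = (c / csn c)\<^sup>2 * ((\<integral>x. k x \<partial>\<nu>) - (V + m\<^sup>2))"
    using io io2 by (simp add: V)
  also have "(\<integral>\<^sup>+x. ennreal ((h x)\<^sup>2) \<partial>\<nu>) = ennreal V"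
    unfolding V_def by (rule nn_integral_eq_integral[OF ih2]) auto
  finally have e: "ennreal (lam * V) \<le> ennreal ((c / csn c)\<^sup>2 * ((\<integral>x. k x \<partial>\<nu>) - (V + m\<^sup>2)))"
    using lam by (simp add: ennreal_mult')
  have V0: "V \<ge> 0" by (simp add: V_def)
  \<comment> \<open>Returning from \<open>ennreal\<close> to the reals needs care because negative
    reals are sent to 0. A positive left-hand side settles it; for V = 0 the right-hand side is
    nonnegative by itself.\<close>
  have "lam * V \<le> (c / csn c)\<^sup>2 * ((\<integral>x. k x \<partial>\<nu>) - (V + m\<^sup>2))"
  proof (cases "V = 0")
    case True
    have "0 \<le> (\<integral>x. (c / csn c)\<^sup>2 * (k x - (ou c g x)\<^sup>2) \<partial>\<nu>)"
      by (intro Bochner_Integration.integral_nonneg gb0)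
    also have "\<dots> = (c / csn c)\<^sup>2 * ((\<integral>x. k x \<partial>\<nu>) - (V + m\<^sup>2))" using io io2 by (simp add: V)
    finally show ?thesis using True by simp
  next
    case False
    then have "0 < lam * V" using lam V0 by simp
    then show ?thesis using e by (smt (verit) ennreal_le_iff2)
  qed
  also have "\<dots> \<le> (c / csn c)\<^sup>2 * ((\<integral>x. k x \<partial>\<nu>) - V)"
    by (intro mult_left_mono) auto
  finally have "lam * V * (csn c)\<^sup>2 \<le> c\<^sup>2 * ((\<integral>x. k x \<partial>\<nu>) - V)"
    using s by (simp add: power_divide field_simps)
  then have "V * (c\<^sup>2 + lam * (csn c)\<^sup>2) \<le> c\<^sup>2 * (\<integral>x. k x \<partial>\<nu>)" by (simp add: algebra_simps)
  moreover have "c\<^sup>2 + lam * (csn c)\<^sup>2 > 0" using c lam by (simp add: add_pos_nonneg)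
  ultimately have "V \<le> c\<^sup>2 * (\<integral>x. k x \<partial>\<nu>) / (c\<^sup>2 + lam * (csn c)\<^sup>2)" by (simp add: pos_le_divide_eq)
  then show ?thesis by (simp add: V_def h_def m_def k_def[abs_def] kappa_def)
qed

text \<open>The kernel is strictly positive, so \<open>ou c f\<close> can vanish at a point only if
  f vanishes almost everywhere. Quotients by \<open>ou c f\<close> thus never involve division by
  0.\<close>

lemma ou_pos:
  fixes f :: "'a::euclidean_space \<Rightarrow> real"
  assumes c: "0 \<le> c" "c < 1" and f: "integrable std_gaussian f" "\<And>x. f x \<ge> 0" "integral\<^sup>L std_gaussian f > 0"
  shows "ou c f x > 0"
proof -
  have [measurable]: "f \<in> borel_measurable borel" using borel_measurable_integrable[OF f(1)] by simp
  have mp: "mehler c x y > 0" for y using csn_pos[OF c] by (simp add: mehler_def)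
  have "ou c f x \<ge> 0" using f(2) by (simp add: ou_def)
  moreover have "ou c f x \<noteq> 0"
  proof
    assume "ou c f x = 0"
    then have "(\<integral>y. mehler c x y * f y \<partial>std_gaussian) = 0" using c by (simp add: ou_eq_mehler)
    moreover have "AE y in std_gaussian. 0 \<le> mehler c x y * f y"
      by (intro AE_I2 mult_nonneg_nonneg f(2) mehler_nonneg c)
    ultimately have "AE y in std_gaussian. mehler c x y * f y = 0"
      using integral_nonneg_eq_0_iff_AE[OF integrable_mehler[OF c f(1), of x]] by simp
    then have "AE y in std_gaussian. f y = 0"
      by eventually_elim (use mp less_imp_neq in \<open>metis mult_eq_0_iff\<close>)
    then have "integral\<^sup>L std_gaussian f = (\<integral>y. 0 \<partial>(std_gaussian::'a measure))"
      by (intro integral_cong_AE) auto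
    then show False using f(3) by simp
  qed
  ultimately show ?thesis by simp
qed

text \<open>Integrate 2 t v <= t^2 f + v^2 / f with the optimal t. That v vanishes with f makes this
  pointwise inequality hold also where the quotient is 0 by the convention for division by
  0.\<close>

lemma cauchy_schwarz_weighted:
  fixes v f :: "'a \<Rightarrow> real"
  assumes v: "integrable M v" and f: "integrable M f" and w: "integrable M (\<lambda>x. (v x)\<^sup>2 / f x)"
    and f0: "\<And>x. f x \<ge> 0" and vf: "\<And>x. f x = 0 \<Longrightarrow> v x = 0" and pos: "integral\<^sup>L M f > 0"
  shows "(integral\<^sup>L M v)\<^sup>2 / integral\<^sup>L M f \<le> (\<integral>x. (v x)\<^sup>2 / f x \<partial>M)"
proof -
  define t where "t = integral\<^sup>L M v / integral\<^sup>L M f"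
  have "2 * t * v x \<le> t\<^sup>2 * f x + (v x)\<^sup>2 / f x" for x
  proof (cases "f x = 0")
    case False
    then have "f x > 0" using f0[of x] by simp
    moreover have "0 \<le> (t * f x - v x)\<^sup>2 / f x" using f0 by simp
    ultimately show ?thesis by (simp add: power2_diff field_simps power2_eq_square)
  qed (use vf in simp)
  then have "(\<integral>x. 2 * t * v x \<partial>M) \<le> (\<integral>x. t\<^sup>2 * f x + (v x)\<^sup>2 / f x \<partial>M)"
    using v f w by (intro integral_mono) auto
  then have "2 * t * integral\<^sup>L M v \<le> t\<^sup>2 * integral\<^sup>L M f + (\<integral>x. (v x)\<^sup>2 / f x \<partial>M)"
    using v f w by simp
  moreover have "t * integral\<^sup>L M v = (integral\<^sup>L M v)\<^sup>2 / integral\<^sup>L M f"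
    "t\<^sup>2 * integral\<^sup>L M f = (integral\<^sup>L M v)\<^sup>2 / integral\<^sup>L M f"
    using pos by (simp_all add: t_def power2_eq_square)
  ultimately show ?thesis by (simp add: mult.assoc)
qed

text \<open>Joint convexity of (v, f) -> v^2 / f, in the form of the weighted Cauchy-Schwarz
  inequality under the law of c x + s z.\<close>

lemma ou_fisher_convex:
  fixes v f :: "'a::euclidean_space \<Rightarrow> real"
  assumes c: "0 \<le> c" "c < 1"
    and v: "integrable std_gaussian v" and f: "integrable std_gaussian f" and w: "integrable std_gaussian (\<lambda>x. (v x)\<^sup>2 / f x)"
    and f0: "\<And>x. f x \<ge> 0" and vf: "\<And>x. f x = 0 \<Longrightarrow> v x = 0" and pos: "integral\<^sup>L std_gaussian f > 0"
  shows "(ou c v x)\<^sup>2 / ou c f x \<le> ou c (\<lambda>x. (v x)\<^sup>2 / f x) x"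
  unfolding ou_def
  by (rule cauchy_schwarz_weighted)
     (use ou_integrable[OF c] v f w f0 vf ou_pos[OF c f f0 pos] in \<open>auto simp: ou_def\<close>)

lemma integrable_ou_fisher:
  fixes v f :: "'a::euclidean_space \<Rightarrow> real"
  assumes c: "0 \<le> c" "c < 1"
    and v: "integrable std_gaussian v" and f: "integrable std_gaussian f" and w: "integrable std_gaussian (\<lambda>x. (v x)\<^sup>2 / f x)"
    and f0: "\<And>x. f x \<ge> 0" and vf: "\<And>x. f x = 0 \<Longrightarrow> v x = 0" and pos: "integral\<^sup>L std_gaussian f > 0"
  shows "integrable std_gaussian (\<lambda>x. (ou c v x)\<^sup>2 / ou c f x)"
proof (rule Bochner_Integration.integrable_bound)
  show "integrable std_gaussian (ou c (\<lambda>x. (v x)\<^sup>2 / f x))" by (rule integrable_ou[OF c w])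
  have "norm ((ou c v x)\<^sup>2 / ou c f x) = (ou c v x)\<^sup>2 / ou c f x" for x using ou_pos[OF c f f0 pos, of x] by simp
  then show "AE x in std_gaussian. norm ((ou c v x)\<^sup>2 / ou c f x) \<le> norm (ou c (\<lambda>x. (v x)\<^sup>2 / f x) x)"
    using order_trans[OF ou_fisher_convex[OF assms] abs_ge_self] by (intro AE_I2) (simp only: real_norm_def)
  have [measurable]: "v \<in> borel_measurable borel" "f \<in> borel_measurable borel" using v f by auto
  show "(\<lambda>x. (ou c v x)\<^sup>2 / ou c f x) \<in> borel_measurable std_gaussian" by measurable
qed

text \<open>Duality with the variance bound: test against truncations of \<open>ou c v / ou c f\<close>.\<close>

lemma ou_fisher_contraction:
  fixes v f :: "'a::euclidean_space \<Rightarrow> real"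
  assumes c: "0 < c" "c < 1" and lam: "lam > 0"
    and f0: "\<And>x. f x \<ge> 0" and f: "integrable std_gaussian f" and pos: "integral\<^sup>L std_gaussian f > 0"
    and nu: "\<nu> = density std_gaussian (\<lambda>x. ennreal (f x))" "prob_space \<nu>" "\<nu> \<in> poincare_class lam"
    and v: "integrable std_gaussian v" and w: "integrable std_gaussian (\<lambda>x. (v x)\<^sup>2 / f x)"
    and vf: "\<And>x. f x = 0 \<Longrightarrow> v x = 0" and v0: "integral\<^sup>L std_gaussian v = 0"
  shows "(\<integral>x. (ou c v x)\<^sup>2 / ou c f x \<partial>std_gaussian) \<le> kappa lam c * (\<integral>x. (v x)\<^sup>2 / f x \<partial>std_gaussian)"
proof -
  have c': "0 \<le> c" "c < 1" using c by auto
  interpret nu: prob_space \<nu> by (rule nu)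
  have fm[measurable]: "f \<in> borel_measurable borel" and [measurable]: "v \<in> borel_measurable borel" using f v by auto
  define I where "I = (\<integral>x. (v x)\<^sup>2 / f x \<partial>std_gaussian)"
  define K where "K = kappa lam c"
  have K: "K > 0" using kappa_pos[OF c lam] by (simp add: K_def)
  define q where "q = ou c f"
  define A where "A = ou c v"
  have q: "q x > 0" for x unfolding q_def by (rule ou_pos[OF c' f f0 pos])
  have [measurable]: "q \<in> borel_measurable borel" "A \<in> borel_measurable borel" unfolding q_def A_def by auto
  \<comment> \<open>A / q is the optimal test function but may be unbounded; the symmetry of the
    flow and the variance bound both ask for a bounded one.\<close>
  define g where "g n x = max (- real n) (min (real n) (A x / q x))" for n x
  have [measurable]: "g n \<in> borel_measurable borel" for n unfolding g_def[abs_def] by measurable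
  have gb: "\<bar>g n x\<bar> \<le> real n" for n x by (auto simp: g_def)
  have clip: "\<bar>max (- real n) (min (real n) t)\<bar> \<le> \<bar>t\<bar>" for n t by linarith
  have gle: "\<bar>g n x\<bar> \<le> \<bar>A x / q x\<bar>" for n x unfolding g_def by (rule clip)
  have clip3: "max (- real n) (min (real n) t) = t" if "\<bar>t\<bar> \<le> real n" for n t using that by auto
  have clip2: "0 \<le> (t - max (- real n) (min (real n) t)) * max (- real n) (min (real n) t)" for n t
    by (auto simp: zero_le_mult_iff max_def min_def)
  \<comment> \<open>The truncated value lies between 0 and A / q, so its square is at most its
    product with A / q.\<close>
  have ggA: "(g n x)\<^sup>2 * q x \<le> g n x * A x" for n x
  proof -
    have "(g n x)\<^sup>2 \<le> g n x * (A x / q x)"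
      using clip2[of "A x / q x" n] unfolding g_def[symmetric] by (simp add: power2_eq_square algebra_simps)
    then have "(g n x)\<^sup>2 * q x \<le> g n x * (A x / q x) * q x"
      using q[of x] by (intro mult_right_mono) auto
    then show ?thesis using q[of x] by simp
  qed
  have gA0: "0 \<le> g n x * A x" for n x
    using order_trans[OF _ ggA[of n x]] q[of x] by simp
  have iA: "integrable std_gaussian A" unfolding A_def by (rule integrable_ou[OF c' v])
  have iq: "integrable std_gaussian q" unfolding q_def by (rule integrable_ou[OF c' f])
  have igA: "integrable std_gaussian (\<lambda>x. g n x * A x)" for n
    by (rule integrable_mult_bounded[OF iA _ gb]) simp
  \<comment> \<open>The estimate is self-improving: the quantity is bounded by K I / 2 plus half of
    itself.\<close>
  have J: "(\<integral>x. g n x * A x \<partial>std_gaussian) \<le> K * I" for n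
  proof -
    define G where "G = ou c (g n)"
    have [measurable]: "G \<in> borel_measurable borel" unfolding G_def by simp
    have Gb: "\<bar>G x\<bar> \<le> real n" for x unfolding G_def by (rule abs_ou_le[OF _ gb]) simp
    define m where "m = (\<integral>x. G x \<partial>\<nu>)"
    have dens: "integral\<^sup>L \<nu> h = (\<integral>x. f x * h x \<partial>std_gaussian)" if "h \<in> borel_measurable borel" for h :: "'a \<Rightarrow> real"
      using that f0 unfolding nu(1) by (subst integral_density) auto
    have V: "(\<integral>x. f x * (G x - m)\<^sup>2 \<partial>std_gaussian) \<le> K * (\<integral>x. g n x * A x \<partial>std_gaussian)"
    proof -
      have "(\<integral>x. f x * (G x - m)\<^sup>2 \<partial>std_gaussian) = (\<integral>x. (G x - m)\<^sup>2 \<partial>\<nu>)" by (subst dens) auto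
      also have "\<dots> \<le> K * (\<integral>x. ou c (\<lambda>y. (g n y)\<^sup>2) x \<partial>\<nu>)"
        unfolding G_def m_def K_def by (rule ou_variance_bound[OF c lam fm f0 nu _ gb]) simp
      also have "(\<integral>x. ou c (\<lambda>y. (g n y)\<^sup>2) x \<partial>\<nu>) = (\<integral>x. ou c (\<lambda>y. (g n y)\<^sup>2) x * f x \<partial>std_gaussian)"
        by (subst dens) (auto simp: mult.commute)
      \<comment> \<open>Symmetry moves the flow from the square of the test function onto f, which
        makes the variance bound comparable with the tested quantity.\<close>
      also have "\<dots> = (\<integral>x. (g n x)\<^sup>2 * q x \<partial>std_gaussian)"
        unfolding q_def
        by (rule ou_symmetric[OF c' f, symmetric, where B="(real n)\<^sup>2"]) (use gb in \<open>auto simp: abs_le_square_iff[symmetric]\<close>)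
      also have "\<dots> \<le> (\<integral>x. g n x * A x \<partial>std_gaussian)"
        by (rule integral_mono[OF integrable_mult_bounded[OF iq, where B="(real n)\<^sup>2"] igA ggA])
           (use gb in \<open>auto simp: abs_le_square_iff[symmetric]\<close>)
      finally show ?thesis using K by (simp add: mult_left_mono)
    qed
    have iGv: "integrable std_gaussian (\<lambda>x. G x * v x)" by (rule integrable_mult_bounded[OF v _ Gb]) simp
    have iGf: "integrable std_gaussian (\<lambda>x. f x * (G x - m)\<^sup>2)"
    proof -
      have "\<bar>(G x - m)\<^sup>2\<bar> \<le> (real n + \<bar>m\<bar>)\<^sup>2" for x
        using Gb[of x] by (auto simp: abs_le_square_iff[symmetric])
      from integrable_mult_bounded[OF f _ this] show ?thesis by (simp add: mult.commute)
    qed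
    have "(\<integral>x. g n x * A x \<partial>std_gaussian) = (\<integral>x. G x * v x \<partial>std_gaussian)"
      unfolding A_def G_def by (rule ou_symmetric[OF c' v _ gb]) simp
    \<comment> \<open>Mean zero of v allows the mean of G to be subtracted, so that a variance can
      appear.\<close>
    also have "\<dots> = (\<integral>x. (G x - m) * v x \<partial>std_gaussian)"
      using iGv v v0 by (simp add: left_diff_distrib)
    \<comment> \<open>Young's inequality with weight K, chosen so that the variance bound turns the
      second term into exactly half of the tested quantity.\<close>
    also have "\<dots> \<le> (\<integral>x. K / 2 * ((v x)\<^sup>2 / f x) + 1 / (2 * K) * (f x * (G x - m)\<^sup>2) \<partial>std_gaussian)"
    proof (rule integral_mono)
      show "integrable std_gaussian (\<lambda>x. (G x - m) * v x)" using iGv v by (simp add: left_diff_distrib)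
      show "integrable std_gaussian (\<lambda>x. K / 2 * ((v x)\<^sup>2 / f x) + 1 / (2 * K) * (f x * (G x - m)\<^sup>2))"
        by (intro Bochner_Integration.integrable_add integrable_mult_right w iGf)
      fix x
      show "(G x - m) * v x \<le> K / 2 * ((v x)\<^sup>2 / f x) + 1 / (2 * K) * (f x * (G x - m)\<^sup>2)"
      proof (cases "f x = 0")
        case False
        then have fx: "f x > 0" using f0[of x] by simp
        have "0 \<le> (K * v x - f x * (G x - m))\<^sup>2 / (2 * K * f x)" using fx K by simp
        also have "\<dots> = K / 2 * ((v x)\<^sup>2 / f x) + 1 / (2 * K) * (f x * (G x - m)\<^sup>2) - (G x - m) * v x"
          using fx K by (simp add: power2_diff power_mult_distrib add_divide_distrib diff_divide_distrib power2_eq_square[of K] power2_eq_square[of "f x"])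
        finally show ?thesis by simp
      qed (use vf in simp)
    qed
    also have "\<dots> = K / 2 * I + 1 / (2 * K) * (\<integral>x. f x * (G x - m)\<^sup>2 \<partial>std_gaussian)"
      unfolding I_def by (subst Bochner_Integration.integral_add[OF integrable_mult_right[OF w] integrable_mult_right[OF iGf]])
        (simp only: integral_mult_right_zero)
    also have "\<dots> \<le> K / 2 * I + 1 / (2 * K) * (K * (\<integral>x. g n x * A x \<partial>std_gaussian))"
      using V K by (intro add_left_mono mult_left_mono) auto
    also have "\<dots> = K / 2 * I + (\<integral>x. g n x * A x \<partial>std_gaussian) / 2" using K by simp
    finally show ?thesis by simp
  qed
  have iJ: "integrable std_gaussian (\<lambda>x. (A x)\<^sup>2 / q x)"
    unfolding A_def q_def by (rule integrable_ou_fisher[OF c' v f w f0 vf pos])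
  have "(\<lambda>n. \<integral>x. g n x * A x \<partial>std_gaussian) \<longlonglongrightarrow> (\<integral>x. (A x)\<^sup>2 / q x \<partial>std_gaussian)"
  proof (rule integral_dominated_convergence[where w="\<lambda>x. (A x)\<^sup>2 / q x"])
    show "AE x in std_gaussian. (\<lambda>n. g n x * A x) \<longlonglongrightarrow> (A x)\<^sup>2 / q x"
    proof (intro AE_I2)
      fix x
      obtain N where N: "\<bar>A x / q x\<bar> \<le> real N" using real_arch_simple by blast
      have "\<forall>\<^sub>F n in sequentially. (A x)\<^sup>2 / q x = g n x * A x"
      proof (rule eventually_sequentiallyI[of N])
        fix n assume "N \<le> n"
        then have "\<bar>A x / q x\<bar> \<le> real n" using N by simp
        then have "g n x = A x / q x" unfolding g_def by (rule clip3)
        then show "(A x)\<^sup>2 / q x = g n x * A x" by (simp add: power2_eq_square)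
      qed
      then show "(\<lambda>n. g n x * A x) \<longlonglongrightarrow> (A x)\<^sup>2 / q x"
        by (rule Lim_transform_eventually[OF tendsto_const])
    qed
    show "AE x in std_gaussian. norm (g n x * A x) \<le> (A x)\<^sup>2 / q x" for n
    proof (intro AE_I2)
      fix x
      have "\<bar>g n x * A x\<bar> \<le> \<bar>A x / q x\<bar> * \<bar>A x\<bar>" unfolding abs_mult by (intro mult_right_mono gle) auto
      also have "\<dots> = (A x)\<^sup>2 / q x" using q[of x] by (simp add: power2_eq_square abs_mult)
      finally show "norm (g n x * A x) \<le> (A x)\<^sup>2 / q x" by simp
    qed
  qed (use iJ in auto)
  from LIMSEQ_le_const2[OF this] J show ?thesis
    unfolding A_def q_def K_def I_def by blast
qed

section \<open>Differentiation under the integral and approximation in the mean\<close>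

text \<open>The domination hypothesis bounds difference quotients based at a, so the derivative is
  asked for at a only. Dominated convergence is sequential; the limit is therefore tested along
  arbitrary null sequences.\<close>

lemma has_real_derivative_integral:
  fixes F :: "real \<Rightarrow> 'a \<Rightarrow> real"
  assumes "\<delta> > 0"
    and int: "\<And>t. \<bar>t - a\<bar> < \<delta> \<Longrightarrow> integrable M (F t)"
    and deriv: "\<And>x. x \<in> space M \<Longrightarrow> ((\<lambda>t. F t x) has_real_derivative F' x) (at a)"
    and bound: "\<And>t x. \<bar>t - a\<bar> < \<delta> \<Longrightarrow> x \<in> space M \<Longrightarrow> \<bar>F t x - F a x\<bar> \<le> w x * \<bar>t - a\<bar>"
    and w: "integrable M w" and F'm: "F' \<in> borel_measurable M"
  shows "((\<lambda>t. integral\<^sup>L M (F t)) has_real_derivative integral\<^sup>L M F') (at a)"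
    and "integrable M F'"
proof -
  have key: "(\<lambda>n. ((integral\<^sup>L M (F (a + X n)) - integral\<^sup>L M (F a)) / X n)) \<longlonglongrightarrow> integral\<^sup>L M F' \<and> integrable M F'"
    if X: "X \<longlonglongrightarrow> 0" "\<And>n. X n \<noteq> 0" "\<And>n. \<bar>X n\<bar> < \<delta>" for X :: "nat \<Rightarrow> real"
  proof -
    have ia: "integrable M (F a)" "integrable M (F (a + X n))" for n
      using int[of a] int[of "a + X n"] \<open>\<delta> > 0\<close> X(3)[of n] by auto
    have lim: "AE x in M. (\<lambda>n. (F (a + X n) x - F a x) / X n) \<longlonglongrightarrow> F' x"
    proof (intro AE_I2)
      fix x assume "x \<in> space M"
      from deriv[OF this] have "((\<lambda>h. (F (a + h) x - F a x) / h) \<longlongrightarrow> F' x) (at 0)" by (simp add: DERIV_def)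
      then show "(\<lambda>n. (F (a + X n) x - F a x) / X n) \<longlonglongrightarrow> F' x"
        using X(1,2) unfolding tendsto_at_iff_sequentially comp_def by auto
    qed
    have bd: "AE x in M. norm ((F (a + X n) x - F a x) / X n) \<le> w x" for n
    proof (intro AE_I2)
      fix x assume "x \<in> space M"
      from bound[of "a + X n", OF _ this] X(3)[of n]
      have "\<bar>F (a + X n) x - F a x\<bar> \<le> w x * \<bar>X n\<bar>" by simp
      then show "norm ((F (a + X n) x - F a x) / X n) \<le> w x" using X(2)[of n] by (simp add: pos_divide_le_eq)
    qed
    have m: "(\<lambda>x. (F (a + X n) x - F a x) / X n) \<in> borel_measurable M" for n using ia(1) ia(2)[of n] by auto
    have "(\<lambda>n. \<integral>x. (F (a + X n) x - F a x) / X n \<partial>M) \<longlonglongrightarrow> integral\<^sup>L M F'"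
      by (rule integral_dominated_convergence[OF F'm m w lim bd])
    moreover have "integrable M F'"
      by (rule integrable_dominated_convergence[OF F'm m w lim bd])
    ultimately show ?thesis using ia by (simp add: Bochner_Integration.integral_diff)
  qed
  \<comment> \<open>One concrete null sequence inside the window, which serves to extract the
    integrability of the limit.\<close>
  define X where "X n = \<delta> / 2 * inverse (real (Suc n))" for n
  have "X \<longlonglongrightarrow> \<delta> / 2 * 0"
    unfolding X_def[abs_def] by (intro tendsto_intros LIMSEQ_inverse_real_of_nat)
  moreover have X: "0 < X n" "X n \<le> \<delta> / 2 * 1" for n
    unfolding X_def using \<open>\<delta> > 0\<close> by (simp, intro mult_left_mono) (auto simp: inverse_le_1_iff)
  moreover have "X n \<noteq> 0" "\<bar>X n\<bar> < \<delta>" for n using X[of n] \<open>\<delta> > 0\<close> by linarith+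
  ultimately show "integrable M F'" using key[of X] by simp
  have "((\<lambda>h. (integral\<^sup>L M (F (a + h)) - integral\<^sup>L M (F a)) / h) \<longlongrightarrow> integral\<^sup>L M F') (at 0)"
    unfolding tendsto_at_iff_sequentially comp_def
  proof (intro allI impI)
    fix X :: "nat \<Rightarrow> real" assume X: "\<forall>i. X i \<in> UNIV - {0}" "X \<longlonglongrightarrow> 0"
    obtain N where N: "\<And>n. n \<ge> N \<Longrightarrow> \<bar>X n\<bar> < \<delta>"
      using LIMSEQ_D[OF X(2) \<open>\<delta> > 0\<close>] by auto
    \<comment> \<open>Shifting by N brings the whole sequence into the window where the domination
      holds.\<close>
    have "(\<lambda>n. (integral\<^sup>L M (F (a + X (n + N))) - integral\<^sup>L M (F a)) / X (n + N)) \<longlonglongrightarrow> integral\<^sup>L M F'"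
      using key[of "\<lambda>n. X (n + N)"] N X by (auto intro: LIMSEQ_ignore_initial_segment)
    then show "(\<lambda>n. (integral\<^sup>L M (F (a + X n)) - integral\<^sup>L M (F a)) / X n) \<longlonglongrightarrow> integral\<^sup>L M F'"
      by (rule LIMSEQ_offset)
  qed
  then show "((\<lambda>t. integral\<^sup>L M (F t)) has_real_derivative integral\<^sup>L M F') (at a)" by (simp add: DERIV_def)
qed

section \<open>Integration by parts for compactly supported functions\<close>

lemma integral_lborel_translate:
  fixes G :: "'a::euclidean_space \<Rightarrow> real"
  assumes [measurable]: "G \<in> borel_measurable borel"
  shows "(\<integral>x. G (c + x) \<partial>lborel) = integral\<^sup>L lborel G"
  using integral_distr[of "(+) c" lborel borel G] lborel_distr_plus[of c] by simp

lemma integrable_lborel_translate: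
  fixes G :: "'a::euclidean_space \<Rightarrow> real"
  assumes [measurable]: "G \<in> borel_measurable borel"
  shows "integrable lborel (\<lambda>x. G (c + x)) \<longleftrightarrow> integrable lborel G"
  using integrable_distr_eq[of "(+) c" lborel borel G] lborel_distr_plus[of c] by simp

lemma integrable_lborel_compact_support:
  fixes G :: "'a::euclidean_space \<Rightarrow> real"
  assumes "continuous_on UNIV G" "\<And>x. norm x > R \<Longrightarrow> G x = 0"
  shows "integrable lborel G"
proof -
  have "(\<lambda>x. indicator (cball 0 R) x *\<^sub>R G x) = G"
    using assms(2) by (auto simp: indicator_def fun_eq_iff not_le)
  then show ?thesis
    using borel_integrable_compact[of "cball 0 R" G] assms(1) continuous_on_subset by fastforce
qed

lemma has_derivative_along:
  assumes "(G has_derivative G') (at (p + s *\<^sub>R i))"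
  shows "((\<lambda>s. G (p + s *\<^sub>R i)) has_real_derivative G' i) (at s)"
proof -
  have "((\<lambda>s. p + s *\<^sub>R i) has_derivative (\<lambda>h. h *\<^sub>R i)) (at s)"
    by (auto intro!: derivative_eq_intros)
  from has_derivative_compose[OF this assms]
  have "((\<lambda>s. G (p + s *\<^sub>R i)) has_derivative (\<lambda>h. G' (h *\<^sub>R i))) (at s)" .
  moreover have "(\<lambda>h. G' (h *\<^sub>R i)) = (*) (G' i)"
    using linear_scale[OF has_derivative_linear[OF assms]] by (auto simp: mult.commute)
  ultimately show ?thesis by (simp add: has_field_derivative_def)
qed

text \<open>The integral of a translate does not depend on the translation, so its derivative vanishes.\<close>

lemma integral_derivative_compact_support:
  fixes G :: "'a::euclidean_space \<Rightarrow> real"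
  assumes G': "\<And>x. (G has_derivative G' x) (at x)" and cont: "continuous_on UNIV (\<lambda>x. G' x i)"
    and supp: "\<And>x. norm x > R \<Longrightarrow> G x = 0" and i: "i \<in> Basis"
  shows "(\<integral>x. G' x i \<partial>lborel) = 0"
proof -
  have cG: "continuous_on UNIV G" using G' by (meson continuous_at_imp_continuous_on has_derivative_continuous)
  then have [measurable]: "G \<in> borel_measurable borel" by (rule borel_measurable_continuous_onI)
  have iG: "integrable lborel G" by (rule integrable_lborel_compact_support[OF cG supp])
  \<comment> \<open>Points within R + 1, moved by at most 1 along i, stay within R + 2; for points
    farther out than R + 1 both values of G vanish.\<close>
  have "bounded ((\<lambda>x. G' x i) ` cball 0 (R + 2))"
    by (intro compact_imp_bounded compact_continuous_image continuous_on_subset[OF cont]) auto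
  then obtain M where "\<forall>x\<in>cball 0 (R + 2). \<bar>G' x i\<bar> \<le> M"
    unfolding bounded_iff by auto
  then have M: "\<And>x. norm x \<le> R + 2 \<Longrightarrow> \<bar>G' x i\<bar> \<le> M" by simp
  have ni: "norm i = 1" using i by simp
  have "((\<lambda>t. \<integral>x. G (t *\<^sub>R i + x) \<partial>lborel) has_real_derivative (\<integral>x. G' x i \<partial>lborel)) (at 0)"
  proof (rule has_real_derivative_integral(1)[where \<delta>=1 and w="\<lambda>x. \<bar>M\<bar> * indicator (cball 0 (R + 1)) x"])
    show "integrable lborel (\<lambda>x. G (t *\<^sub>R i + x))" for t
      using iG by (simp add: integrable_lborel_translate)
    show "((\<lambda>t. G (t *\<^sub>R i + x)) has_real_derivative G' x i) (at 0)" for x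
      using has_derivative_along[of G "G' x" x 0 i] G' by (simp add: add.commute)
    show "\<bar>G (t *\<^sub>R i + x) - G (0 *\<^sub>R i + x)\<bar> \<le> \<bar>M\<bar> * indicator (cball 0 (R + 1)) x * \<bar>t - 0\<bar>"
      if t: "\<bar>t - 0\<bar> < 1" for t x
    proof (cases "norm x \<le> R + 1")
      case False
      have "norm x \<le> norm (t *\<^sub>R i + x) + norm (t *\<^sub>R i)"
        using norm_triangle_ineq4[of "t *\<^sub>R i + x" "t *\<^sub>R i"] by simp
      then have "norm (t *\<^sub>R i + x) > R" using t False ni by simp
      then show ?thesis using False supp[of "t *\<^sub>R i + x"] supp[of x] by simp
    next
      case True
      have "norm (G (x + t *\<^sub>R i) - G (x + 0 *\<^sub>R i)) \<le> \<bar>M\<bar> * norm (t - 0)"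
      proof (rule field_differentiable_bound[where S="{-1<..<1}" and f'="\<lambda>s. G' (x + s *\<^sub>R i) i"])
        fix s :: real assume s: "s \<in> {-1<..<1}"
        show "((\<lambda>s. G (x + s *\<^sub>R i)) has_field_derivative G' (x + s *\<^sub>R i) i) (at s within {-1<..<1})"
          by (rule has_field_derivative_at_within[OF has_derivative_along[OF G']])
        have "norm (x + s *\<^sub>R i) \<le> R + 2"
          using norm_triangle_ineq[of x "s *\<^sub>R i"] True s ni by auto
        from M[OF this] show "norm (G' (x + s *\<^sub>R i) i) \<le> \<bar>M\<bar>" by simp
      qed (use t in auto)
      then show ?thesis using True by (simp add: add.commute)
    qed
    have "emeasure lborel (cball (0::'a) (R + 1)) < \<infinity>"
      using emeasure_lborel_cball_finite by blast
    then show "integrable lborel (\<lambda>x::'a. \<bar>M\<bar> * indicator (cball 0 (R + 1)) x)" by auto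
    show "(\<lambda>x. G' x i) \<in> borel_measurable lborel" using borel_measurable_continuous_onI[OF cont] by simp
  qed simp
  moreover have "(\<lambda>t. \<integral>x. G (t *\<^sub>R i + x) \<partial>lborel) = (\<lambda>t. integral\<^sup>L lborel G)"
    by (simp add: integral_lborel_translate)
  ultimately show ?thesis using DERIV_unique[OF _ DERIV_const] by metis
qed

section \<open>Continuity of the flow in the mean\<close>

lemma AE_std_gaussian_lborel: "AE x in lborel. P x \<Longrightarrow> AE x in std_gaussian. P x"
proof -
  assume "AE x in lborel. P x"
  then have "AE x in lborel. 0 < ennreal (gauss_dens x) \<longrightarrow> P x" by eventually_elim simp
  then show ?thesis unfolding std_gaussian_eq by (subst AE_density) auto
qed

text \<open>Truncation reduces to a bounded function; a measurable function is an almost everywhere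
  limit of continuous ones, and truncating these at the same level restores a constant dominating
  function.\<close>

lemma dense_bounded_continuous:
  fixes v :: "'a::euclidean_space \<Rightarrow> real"
  assumes v: "integrable std_gaussian v" and e: "e > 0"
  obtains g B where "continuous_on UNIV g" "\<And>x. \<bar>g x\<bar> \<le> B" "(\<integral>x. \<bar>v x - g x\<bar> \<partial>std_gaussian) < e"
proof -
  have [measurable]: "v \<in> borel_measurable borel" using v by auto
  define cl where "cl m t = max (- m) (min m t)" for m t :: real
  have clb: "\<bar>cl m t\<bar> \<le> m" if "m \<ge> 0" for m t using that by (auto simp: cl_def)
  have cla: "\<bar>t - cl m t\<bar> \<le> \<bar>t\<bar>" if "m \<ge> 0" for m t using that by (auto simp: cl_def)
  have clc: "continuous_on UNIV (cl m)" for m unfolding cl_def[abs_def] by (intro continuous_intros)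
  have clm[measurable]: "cl m \<in> borel_measurable borel" for m by (rule borel_measurable_continuous_onI[OF clc])
  have clid: "cl m t = t" if "\<bar>t\<bar> \<le> m" for m t using that by (auto simp: cl_def)
  have "(\<lambda>n. \<integral>x. \<bar>v x - cl (real n) (v x)\<bar> \<partial>std_gaussian) \<longlonglongrightarrow> (\<integral>x. 0 \<partial>(std_gaussian::'a measure))"
  proof (rule integral_dominated_convergence[where w="\<lambda>x. \<bar>v x\<bar>"])
    show "AE x in std_gaussian. (\<lambda>n. \<bar>v x - cl (real n) (v x)\<bar>) \<longlonglongrightarrow> 0"
    proof (intro AE_I2)
      fix x
      obtain N where N: "\<bar>v x\<bar> \<le> real N" using real_arch_simple by blast
      show "(\<lambda>n. \<bar>v x - cl (real n) (v x)\<bar>) \<longlonglongrightarrow> 0"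
        by (rule tendsto_eventually, rule eventually_sequentiallyI[of N]) (use N clid in force)
    qed
  qed (use v cla in auto)
  then have "(\<lambda>n. \<integral>x. \<bar>v x - cl (real n) (v x)\<bar> \<partial>std_gaussian) \<longlonglongrightarrow> 0" by simp
  from LIMSEQ_D[OF this, of "e / 2"] e obtain n where
    n: "(\<integral>x. \<bar>v x - cl (real n) (v x)\<bar> \<partial>std_gaussian) < e / 2"
    by (force simp: abs_of_nonneg)
  define m where "m = real n"
  define u where "u x = cl m (v x)" for x
  have [measurable]: "u \<in> borel_measurable borel" unfolding u_def[abs_def] by measurable
  have ub: "\<bar>u x\<bar> \<le> m" for x unfolding u_def m_def by (rule clb) simp
  have "u \<in> borel_measurable (lebesgue_on UNIV)"
    by (simp add: lebesgue_on_UNIV_eq measurable_completion)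
  then have "u measurable_on UNIV"
    using lebesgue_measurable_imp_measurable_on[of u UNIV] by (simp add: lebesgue_on_UNIV_eq)
  then obtain N G where N: "negligible N" and G: "\<And>k. continuous_on UNIV (G k)"
    and lim: "\<And>x. x \<notin> N \<Longrightarrow> (\<lambda>k. G k x) \<longlonglongrightarrow> u x"
    unfolding measurable_on_def by force
  define g where "g k x = cl m (G k x)" for k :: nat and x
  have gc: "continuous_on UNIV (g k)" for k
    unfolding g_def by (rule continuous_on_compose2[OF clc G]) auto
  have [measurable]: "g k \<in> borel_measurable borel" for k by (rule borel_measurable_continuous_onI[OF gc])
  have gb: "\<bar>g k x\<bar> \<le> m" for k x unfolding g_def m_def by (rule clb) simp
  have "AE x in lebesgue. x \<notin> N" using N by (simp add: negligible_iff_null_sets AE_not_in)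
  then have "AE x in lborel. x \<notin> N" by (simp add: AE_completion_iff)
  then have AEN: "AE x in std_gaussian. x \<notin> N" by (rule AE_std_gaussian_lborel)
  have "(\<lambda>k. \<integral>x. \<bar>u x - g k x\<bar> \<partial>std_gaussian) \<longlonglongrightarrow> (\<integral>x. 0 \<partial>(std_gaussian::'a measure))"
  proof (rule integral_dominated_convergence[where w="\<lambda>x. 2 * m"])
    show "AE x in std_gaussian. (\<lambda>k. \<bar>u x - g k x\<bar>) \<longlonglongrightarrow> 0"
      using AEN
    proof eventually_elim
      case (elim x)
      have "(\<lambda>k. g k x) \<longlonglongrightarrow> cl m (u x)"
        unfolding g_def using clc by (intro isCont_tendsto_compose[OF _ lim[OF elim]]) (simp add: continuous_on_eq_continuous_at)
      then have "(\<lambda>k. g k x) \<longlonglongrightarrow> u x" using clid[OF ub] by simp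
      then have "(\<lambda>k. \<bar>u x - g k x\<bar>) \<longlonglongrightarrow> \<bar>u x - u x\<bar>" by (intro tendsto_intros)
      then show ?case by simp
    qed
    show "AE x in std_gaussian. norm \<bar>u x - g k x\<bar> \<le> 2 * m" for k
    proof (intro AE_I2)
      show "norm \<bar>u x - g k x\<bar> \<le> 2 * m" for x using ub[of x] gb[of k x] by simp
    qed
  qed auto
  then have "(\<lambda>k. \<integral>x. \<bar>u x - g k x\<bar> \<partial>std_gaussian) \<longlonglongrightarrow> 0" by simp
  from LIMSEQ_D[OF this, of "e / 2"] e obtain k where
    k: "(\<integral>x. \<bar>u x - g k x\<bar> \<partial>std_gaussian) < e / 2"
    by (force simp: abs_of_nonneg)
  have iu: "integrable std_gaussian u" "integrable std_gaussian (g k)"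
    by (rule integrable_bounded[OF _ ub] integrable_bounded[OF _ gb], simp)+
  have "(\<integral>x. \<bar>v x - g k x\<bar> \<partial>std_gaussian) \<le> (\<integral>x. \<bar>v x - u x\<bar> + \<bar>u x - g k x\<bar> \<partial>std_gaussian)"
    using v iu by (intro integral_mono) auto
  also have "\<dots> = (\<integral>x. \<bar>v x - u x\<bar> \<partial>std_gaussian) + (\<integral>x. \<bar>u x - g k x\<bar> \<partial>std_gaussian)"
    using v iu by simp
  also have "\<dots> < e" using n k by (simp add: u_def[symmetric] m_def[symmetric])
  finally show ?thesis using that[OF gc gb] by blast
qed

lemma csn_tendsto: "C \<longlonglongrightarrow> c \<Longrightarrow> (\<lambda>n. csn (C n)) \<longlonglongrightarrow> csn c"
  unfolding csn_def by (intro tendsto_intros)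

lemma ou_diff:
  assumes "0 \<le> c" "c < 1" "integrable std_gaussian u" "integrable std_gaussian v"
  shows "ou c (\<lambda>x. u x - v x) x = ou c u x - ou c v x"
  unfolding ou_def using ou_integrable[OF assms(1,2)] assms(3,4)
  by (intro Bochner_Integration.integral_diff) auto

text \<open>The triangle inequality for the inner integral and invariance of the Gaussian measure.
  This makes approximation errors uniform in c.\<close>

lemma integral_abs_ou_le:
  fixes v :: "'a::euclidean_space \<Rightarrow> real"
  assumes c: "0 \<le> c" "c < 1" and v: "integrable std_gaussian v"
  shows "(\<integral>x. \<bar>ou c v x\<bar> \<partial>std_gaussian) \<le> (\<integral>x. \<bar>v x\<bar> \<partial>std_gaussian)"
proof -
  have "(\<integral>x. \<bar>ou c v x\<bar> \<partial>std_gaussian) \<le> integral\<^sup>L std_gaussian (ou c (\<lambda>x. \<bar>v x\<bar>))"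
    using v by (intro integral_mono integrable_abs integrable_ou c) (auto simp: ou_def)
  then show ?thesis using v by (simp add: integral_ou[OF c])
qed

lemma ou_tendsto_bounded_continuous:
  fixes g :: "'a::euclidean_space \<Rightarrow> real"
  assumes g: "continuous_on UNIV g" and B: "\<And>x. \<bar>g x\<bar> \<le> B" and C: "C \<longlonglongrightarrow> c"
  shows "(\<lambda>n. ou (C n) g x) \<longlonglongrightarrow> ou c g x"
  unfolding ou_def
proof (rule integral_dominated_convergence[where w="\<lambda>_. B"])
  have [measurable]: "g \<in> borel_measurable borel" by (rule borel_measurable_continuous_onI[OF g])
  show "(\<lambda>z. g (c *\<^sub>R x + csn c *\<^sub>R z)) \<in> borel_measurable std_gaussian"
    "\<And>n. (\<lambda>z. g (C n *\<^sub>R x + csn (C n) *\<^sub>R z)) \<in> borel_measurable std_gaussian" by measurable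
  show "AE z in std_gaussian. (\<lambda>n. g (C n *\<^sub>R x + csn (C n) *\<^sub>R z)) \<longlonglongrightarrow> g (c *\<^sub>R x + csn c *\<^sub>R z)"
    using g by (intro AE_I2 isCont_tendsto_compose[of _ g] tendsto_intros C csn_tendsto)
      (simp add: continuous_on_eq_continuous_at)
qed (use B in auto)

lemma ou_one [simp]: "ou 1 g x = g x"
  by (simp add: ou_def csn_def)

text \<open>Convergence is pointwise for bounded continuous functions, and the contraction in the
  mean controls the error of replacing v by one of these.\<close>

lemma ou_tendsto_L1:
  fixes v :: "'a::euclidean_space \<Rightarrow> real"
  assumes v: "integrable std_gaussian v" and C: "C \<longlonglongrightarrow> 1" "\<And>n. 0 \<le> C n" "\<And>n. C n < 1"
  shows "(\<lambda>n. \<integral>x. \<bar>ou (C n) v x - v x\<bar> \<partial>std_gaussian) \<longlonglongrightarrow> 0"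
proof (rule LIMSEQ_I)
  fix e :: real assume "e > 0"
  then obtain g B where g: "continuous_on UNIV g" and B: "\<And>x. \<bar>g x\<bar> \<le> B"
    and gv: "(\<integral>x. \<bar>v x - g x\<bar> \<partial>std_gaussian) < e / 3"
    using dense_bounded_continuous[OF v, of "e / 3"] by (metis zero_less_divide_iff zero_less_numeral)
  have gm[measurable]: "g \<in> borel_measurable borel" by (rule borel_measurable_continuous_onI[OF g])
  have ig: "integrable std_gaussian g" by (rule integrable_bounded[OF gm B])
  have "(\<lambda>n. \<integral>x. \<bar>ou (C n) g x - g x\<bar> \<partial>std_gaussian) \<longlonglongrightarrow> (\<integral>x. 0 \<partial>(std_gaussian::'a measure))"
  proof (rule integral_dominated_convergence[where w="\<lambda>x. 2 * B"])
    show "AE x in std_gaussian. (\<lambda>n. \<bar>ou (C n) g x - g x\<bar>) \<longlonglongrightarrow> 0"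
    proof (intro AE_I2)
      fix x
      have "(\<lambda>n. \<bar>ou (C n) g x - g x\<bar>) \<longlonglongrightarrow> \<bar>ou 1 g x - g x\<bar>"
        by (intro tendsto_intros ou_tendsto_bounded_continuous[OF g B C(1)])
      then show "(\<lambda>n. \<bar>ou (C n) g x - g x\<bar>) \<longlonglongrightarrow> 0" by simp
    qed
    show "AE x in std_gaussian. norm \<bar>ou (C n) g x - g x\<bar> \<le> 2 * B" for n
    proof (intro AE_I2)
      show "norm \<bar>ou (C n) g x - g x\<bar> \<le> 2 * B" for x
        using abs_ou_le[OF gm B, of "C n" x] B[of x] by simp
    qed
  qed auto
  then have "(\<lambda>n. \<integral>x. \<bar>ou (C n) g x - g x\<bar> \<partial>std_gaussian) \<longlonglongrightarrow> 0" by simp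
  from LIMSEQ_D[OF this, of "e / 3"] \<open>e > 0\<close> obtain N where
    N: "\<And>n. n \<ge> N \<Longrightarrow> (\<integral>x. \<bar>ou (C n) g x - g x\<bar> \<partial>std_gaussian) < e / 3"
    by (force simp: abs_of_nonneg)
  show "\<exists>no. \<forall>n\<ge>no. norm ((\<integral>x. \<bar>ou (C n) v x - v x\<bar> \<partial>std_gaussian) - 0) < e"
  proof (intro exI allI impI)
    fix n assume "n \<ge> N"
    note c = C(2)[of n] C(3)[of n]
    have iv: "integrable std_gaussian (ou (C n) v)" "integrable std_gaussian (ou (C n) g)"
      "integrable std_gaussian (ou (C n) (\<lambda>x. v x - g x))"
      using v ig by (auto intro!: integrable_ou c)
    have "(\<integral>x. \<bar>ou (C n) v x - v x\<bar> \<partial>std_gaussian)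
       \<le> (\<integral>x. \<bar>ou (C n) (\<lambda>x. v x - g x) x\<bar> + \<bar>ou (C n) g x - g x\<bar> + \<bar>v x - g x\<bar> \<partial>std_gaussian)"
      using v ig iv by (intro integral_mono) (auto simp: ou_diff[OF c v ig])
    also have "\<dots> = (\<integral>x. \<bar>ou (C n) (\<lambda>x. v x - g x) x\<bar> \<partial>std_gaussian) + (\<integral>x. \<bar>ou (C n) g x - g x\<bar> \<partial>std_gaussian)
        + (\<integral>x. \<bar>v x - g x\<bar> \<partial>std_gaussian)"
      using v ig iv by simp
    also have "\<dots> < e / 3 + e / 3 + e / 3"
      using integral_abs_ou_le[OF c, of "\<lambda>x. v x - g x"] v ig N[OF \<open>n \<ge> N\<close>] gv by simp
    finally show "norm ((\<integral>x. \<bar>ou (C n) v x - v x\<bar> \<partial>std_gaussian) - 0) < e" by (simp add: abs_of_nonneg)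
  qed
qed

section \<open>Weak gradients\<close>

lemma partial_deriv_mult:
  assumes "g differentiable_on UNIV" "h differentiable_on UNIV"
  shows "partial_deriv i (\<lambda>x. g x * h x) x = g x * partial_deriv i h x + partial_deriv i g x * h x"
  using partial_deriv_eqI[OF has_derivative_mult[OF differentiable_has_partial[OF assms(1), of x] differentiable_has_partial[OF assms(2), of x]], of i]
  by (simp add: partial_deriv_def)

lemma continuous_compact_support_bounded:
  fixes k :: "'a::euclidean_space \<Rightarrow> real"
  assumes "continuous_on UNIV k" "\<And>x. norm x > R \<Longrightarrow> k x = 0"
  obtains B where "B > 0" "\<And>x. \<bar>k x\<bar> \<le> B"
proof -
  have "bounded (k ` cball 0 R)"
    by (intro compact_imp_bounded compact_continuous_image continuous_on_subset[OF assms(1)]) auto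
  then obtain b where b: "\<forall>x\<in>cball 0 R. \<bar>k x\<bar> \<le> b" unfolding bounded_iff by auto
  have "\<bar>k x\<bar> \<le> \<bar>b\<bar> + 1" for x
  proof (cases "norm x \<le> R")
    case True
    then have "\<bar>k x\<bar> \<le> b" using b by simp
    then show ?thesis by linarith
  qed (use assms(2)[of x] in simp)
  then show ?thesis using that[of "\<bar>b\<bar> + 1"] by auto
qed

lemma locally_integrable_measurable:
  fixes f :: "'a::euclidean_space \<Rightarrow> 'b::euclidean_space"
  assumes "locally_integrable f"
  shows "f \<in> borel_measurable borel"
proof (rule borel_measurable_LIMSEQ_metric)
  show "(\<lambda>x. indicator (cball 0 (real n)) x *\<^sub>R f x) \<in> borel_measurable borel" for n
    using assms unfolding locally_integrable_def set_integrable_def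
    by (metis borel_measurable_integrable compact_cball measurable_lborel2)
  show "(\<lambda>n. indicator (cball 0 (real n)) x *\<^sub>R f x) \<longlonglongrightarrow> f x" for x
  proof -
    obtain N where N: "norm x \<le> real N" using real_arch_simple by blast
    show ?thesis
      by (rule tendsto_eventually, rule eventually_sequentiallyI[of N]) (use N in \<open>auto simp: indicator_def\<close>)
  qed
qed

lemma locally_integrable_dominated:
  fixes f :: "'a::euclidean_space \<Rightarrow> 'b::euclidean_space" and g :: "'a \<Rightarrow> 'c::euclidean_space"
  assumes f: "locally_integrable f" and [measurable]: "g \<in> borel_measurable borel" and le: "\<And>x. norm (g x) \<le> norm (f x)"
  shows "locally_integrable g"
  unfolding locally_integrable_def set_integrable_def
proof (intro allI impI)
  fix K :: "'a set" assume K: "compact K"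
  then have [measurable]: "K \<in> sets borel" by (simp add: compact_imp_closed)
  show "integrable lborel (\<lambda>x. indicator K x *\<^sub>R g x)"
  proof (rule Bochner_Integration.integrable_bound)
    show "integrable lborel (\<lambda>x. indicator K x *\<^sub>R f x)"
      using f K by (simp add: locally_integrable_def set_integrable_def)
  qed (use le in \<open>auto simp: indicator_def\<close>)
qed

lemma locally_integrable_mult:
  fixes f k :: "'a::euclidean_space \<Rightarrow> real"
  assumes f: "locally_integrable f" and k: "continuous_on UNIV k" and supp: "\<And>x. norm x > R \<Longrightarrow> k x = 0"
  shows "integrable lborel (\<lambda>x. f x * k x)"
proof -
  obtain B where "\<And>x. \<bar>k x\<bar> \<le> B" using continuous_compact_support_bounded[OF k supp] by blast
  moreover have "k \<in> borel_measurable borel" by (rule borel_measurable_continuous_onI[OF k])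
  moreover have "integrable lborel (\<lambda>x. indicator (cball 0 R) x *\<^sub>R f x)"
    using f by (auto simp: locally_integrable_def set_integrable_def)
  ultimately have "integrable lborel (\<lambda>x. k x * (indicator (cball 0 R) x *\<^sub>R f x))"
    by (intro integrable_mult_bounded) auto
  also have "(\<lambda>x. k x * (indicator (cball 0 R) x *\<^sub>R f x)) = (\<lambda>x. f x * k x)"
    using supp by (auto simp: indicator_def fun_eq_iff not_le)
  finally show ?thesis .
qed

lemma locally_integrable_inner:
  fixes Df :: "'a::euclidean_space \<Rightarrow> 'a"
  assumes "locally_integrable Df" "i \<in> Basis"
  shows "locally_integrable (\<lambda>x. Df x \<bullet> i)"
proof (rule locally_integrable_dominated[OF assms(1)])
  show "norm (Df x \<bullet> i) \<le> norm (Df x)" for x using Basis_le_norm[OF assms(2)] by simp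
qed (use locally_integrable_measurable[OF assms(1)] in measurable)

lemma test_function_support:
  assumes "test_function \<phi>"
  obtains R where "\<And>x. norm x > R \<Longrightarrow> \<phi> x = 0" "\<And>x i. norm x > R \<Longrightarrow> partial_deriv i \<phi> x = 0"
proof -
  obtain K where "compact K" "\<And>x. x \<notin> K \<Longrightarrow> \<phi> x = 0" using assms by (auto simp: test_function_def)
  moreover obtain R where "\<And>x. x \<in> K \<Longrightarrow> norm x \<le> R"
    using compact_imp_bounded[OF \<open>compact K\<close>] by (auto simp: bounded_iff)
  ultimately have R: "\<phi> x = 0" if "norm x > R" for x using that by (meson not_le)
  have "partial_deriv i \<phi> x = 0" if x: "norm x > R" for x i
  proof -
    have "(\<phi> has_derivative (\<lambda>_. 0)) (at x)"
    proof (rule has_derivative_transform_within_open[OF has_derivative_const[of 0]])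
      have "{x. norm x > R} = - cball (0::'a) R" by auto
      then show "open {x::'a. norm x > R}" by (simp add: open_Compl)
    qed (use R x in auto)
    then show ?thesis by (rule partial_deriv_eqI[THEN trans]) simp
  qed
  then show ?thesis using that R by blast
qed

lemma smooth_partial_continuous: "smooth g \<Longrightarrow> i \<in> Basis \<Longrightarrow> continuous_on A (partial_deriv i g)"
  by (rule smooth_continuous[OF smooth_partial_deriv])

lemma weak_gradient_cutoff:
  fixes f :: "'a::euclidean_space \<Rightarrow> real"
  assumes f: "has_weak_gradient f Df" and r: "r > 0" and eta: "smooth \<eta>" and i: "i \<in> Basis"
  shows "(\<integral>x. f x * (bump r x * partial_deriv i \<eta> x + partial_deriv i (bump r) x * \<eta> x) \<partial>lborel)
    = - (\<integral>x. (Df x \<bullet> i) * (bump r x * \<eta> x) \<partial>lborel)"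
proof -
  have "test_function (\<lambda>x. bump r x * \<eta> x)"
    unfolding test_function_def using r
    by (intro conjI smooth_mult smooth_bump eta exI[of _ "cball 0 r"]) (auto simp: bump_eq_0)
  then have "(\<integral>x. f x * partial_deriv i (\<lambda>x. bump r x * \<eta> x) x \<partial>lborel) = - (\<integral>x. (Df x \<bullet> i) * (bump r x * \<eta> x) \<partial>lborel)"
    using f i by (simp add: has_weak_gradient_def)
  moreover have "partial_deriv i (\<lambda>x. bump r x * \<eta> x) x = bump r x * partial_deriv i \<eta> x + partial_deriv i (bump r) x * \<eta> x" for x
    by (intro partial_deriv_mult smooth_differentiable smooth_bump eta)
  ultimately show ?thesis by simp
qed

lemma partial_deriv_bump_tendsto:
  assumes i: "i \<in> Basis"
  shows "(\<lambda>n. partial_deriv i (bump (real (Suc n))) x) \<longlonglongrightarrow> 0"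
proof (rule Lim_null_comparison)
  show "\<forall>\<^sub>F n in sequentially. norm (partial_deriv i (bump (real (Suc n))) x) \<le> 4 * exp 1 * inverse (real (Suc n))"
    using partial_deriv_bump_bound[OF _ i] by (intro always_eventually allI) (simp add: divide_inverse)
  have "(\<lambda>n. 4 * exp 1 * inverse (real (Suc n))) \<longlonglongrightarrow> 4 * exp 1 * 0"
    by (intro tendsto_intros LIMSEQ_inverse_real_of_nat)
  then show "(\<lambda>n. 4 * exp 1 * inverse (real (Suc n))) \<longlonglongrightarrow> 0" by simp
qed

lemma partial_deriv_bump_bound_Suc:
  assumes i: "i \<in> Basis"
  shows "\<bar>partial_deriv i (bump (real (Suc n))) x\<bar> \<le> 4 * exp 1"
proof -
  have "4 * exp 1 / real (Suc n) \<le> 4 * exp 1" by (simp add: divide_le_eq)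
  then show ?thesis using partial_deriv_bump_bound[OF _ i, of "real (Suc n)" x] by simp
qed

text \<open>Extends the weak formulation to functions without compact support, in particular
  Gaussian kernels. As the cutoff radius grows, the extra term disappears because the gradient of
  the cutoff tends to 0 while staying bounded by \<open>4 * exp 1\<close>.\<close>

lemma weak_gradient_by_parts:
  fixes f :: "'a::euclidean_space \<Rightarrow> real"
  assumes f: "has_weak_gradient f Df" and eta: "smooth \<eta>" and i: "i \<in> Basis"
    and int: "integrable lborel (\<lambda>x. f x * partial_deriv i \<eta> x)" "integrable lborel (\<lambda>x. f x * \<eta> x)"
      "integrable lborel (\<lambda>x. (Df x \<bullet> i) * \<eta> x)"
  shows "(\<integral>x. f x * partial_deriv i \<eta> x \<partial>lborel) = - (\<integral>x. (Df x \<bullet> i) * \<eta> x \<partial>lborel)"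
proof -
  let ?b = "\<lambda>n. bump (real (Suc n)) :: 'a \<Rightarrow> real"
  have bm[measurable]: "?b n \<in> borel_measurable borel" "partial_deriv i (?b n) \<in> borel_measurable borel" for n
    using smooth_continuous[OF smooth_bump] smooth_partial_continuous[OF smooth_bump i] borel_measurable_continuous_onI by blast+
  have im[measurable]: "(\<lambda>x. f x * partial_deriv i \<eta> x) \<in> borel_measurable borel" "(\<lambda>x. f x * \<eta> x) \<in> borel_measurable borel"
    "(\<lambda>x. (Df x \<bullet> i) * \<eta> x) \<in> borel_measurable borel" using int by auto
  have b: "\<bar>?b n x\<bar> \<le> 1" for n x using bump_nonneg[of "real (Suc n)" x] bump_le_1[of "real (Suc n)" x] by simp
  have L1: "(\<lambda>n. \<integral>x. ?b n x * (f x * partial_deriv i \<eta> x) + partial_deriv i (?b n) x * (f x * \<eta> x) \<partial>lborel)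
    \<longlonglongrightarrow> (\<integral>x. f x * partial_deriv i \<eta> x \<partial>lborel)"
  proof (rule integral_dominated_convergence[where w="\<lambda>x. \<bar>f x * partial_deriv i \<eta> x\<bar> + 4 * exp 1 * \<bar>f x * \<eta> x\<bar>"])
    show "integrable lborel (\<lambda>x. \<bar>f x * partial_deriv i \<eta> x\<bar> + 4 * exp 1 * \<bar>f x * \<eta> x\<bar>)"
      using int by auto
    show "AE x in lborel. (\<lambda>n. ?b n x * (f x * partial_deriv i \<eta> x) + partial_deriv i (?b n) x * (f x * \<eta> x))
      \<longlonglongrightarrow> f x * partial_deriv i \<eta> x"
    proof (intro AE_I2)
      fix x
      have "(\<lambda>n. ?b n x * (f x * partial_deriv i \<eta> x) + partial_deriv i (?b n) x * (f x * \<eta> x))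
        \<longlonglongrightarrow> 1 * (f x * partial_deriv i \<eta> x) + 0 * (f x * \<eta> x)"
        by (intro tendsto_intros bump_tendsto_1 partial_deriv_bump_tendsto i)
      then show "(\<lambda>n. ?b n x * (f x * partial_deriv i \<eta> x) + partial_deriv i (?b n) x * (f x * \<eta> x))
        \<longlonglongrightarrow> f x * partial_deriv i \<eta> x" by simp
    qed
    show "AE x in lborel. norm (?b n x * (f x * partial_deriv i \<eta> x) + partial_deriv i (?b n) x * (f x * \<eta> x))
      \<le> \<bar>f x * partial_deriv i \<eta> x\<bar> + 4 * exp 1 * \<bar>f x * \<eta> x\<bar>" for n
    proof (intro AE_I2)
      fix x
      have "\<bar>?b n x * (f x * partial_deriv i \<eta> x)\<bar> \<le> 1 * \<bar>f x * partial_deriv i \<eta> x\<bar>"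
        "\<bar>partial_deriv i (?b n) x * (f x * \<eta> x)\<bar> \<le> 4 * exp 1 * \<bar>f x * \<eta> x\<bar>"
        unfolding abs_mult[of "?b n x"] abs_mult[of "partial_deriv i (?b n) x"]
        using b partial_deriv_bump_bound_Suc[OF i] by (intro mult_right_mono; simp)+
      then show "norm (?b n x * (f x * partial_deriv i \<eta> x) + partial_deriv i (?b n) x * (f x * \<eta> x))
        \<le> \<bar>f x * partial_deriv i \<eta> x\<bar> + 4 * exp 1 * \<bar>f x * \<eta> x\<bar>"
        unfolding real_norm_def by linarith
    qed
    show "(\<lambda>x. f x * partial_deriv i \<eta> x) \<in> borel_measurable lborel"
      "(\<lambda>x. ?b n x * (f x * partial_deriv i \<eta> x) + partial_deriv i (?b n) x * (f x * \<eta> x)) \<in> borel_measurable lborel" for n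
      by measurable
  qed
  have L2: "(\<lambda>n. \<integral>x. ?b n x * ((Df x \<bullet> i) * \<eta> x) \<partial>lborel) \<longlonglongrightarrow> (\<integral>x. (Df x \<bullet> i) * \<eta> x \<partial>lborel)"
  proof (rule integral_dominated_convergence[where w="\<lambda>x. \<bar>(Df x \<bullet> i) * \<eta> x\<bar>"])
    show "AE x in lborel. (\<lambda>n. ?b n x * ((Df x \<bullet> i) * \<eta> x)) \<longlonglongrightarrow> (Df x \<bullet> i) * \<eta> x"
    proof (intro AE_I2)
      show "(\<lambda>n. ?b n x * ((Df x \<bullet> i) * \<eta> x)) \<longlonglongrightarrow> (Df x \<bullet> i) * \<eta> x" for x
        using tendsto_mult_right[OF bump_tendsto_1[of x], of "(Df x \<bullet> i) * \<eta> x"] by simp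
    qed
    show "AE x in lborel. norm (?b n x * ((Df x \<bullet> i) * \<eta> x)) \<le> \<bar>(Df x \<bullet> i) * \<eta> x\<bar>" for n
    proof (intro AE_I2)
      show "norm (?b n x * ((Df x \<bullet> i) * \<eta> x)) \<le> \<bar>(Df x \<bullet> i) * \<eta> x\<bar>" for x
        using mult_right_mono[OF b[of n x], of "\<bar>(Df x \<bullet> i) * \<eta> x\<bar>"] by (simp add: abs_mult)
    qed
    show "(\<lambda>x. (Df x \<bullet> i) * \<eta> x) \<in> borel_measurable lborel"
      "(\<lambda>x. ?b n x * ((Df x \<bullet> i) * \<eta> x)) \<in> borel_measurable lborel" for n by measurable
    show "integrable lborel (\<lambda>x. \<bar>(Df x \<bullet> i) * \<eta> x\<bar>)" using int(3) by auto
  qed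
  have eq: "(\<integral>x. ?b n x * (f x * partial_deriv i \<eta> x) + partial_deriv i (?b n) x * (f x * \<eta> x) \<partial>lborel)
    = - (\<integral>x. ?b n x * ((Df x \<bullet> i) * \<eta> x) \<partial>lborel)" for n
    using weak_gradient_cutoff[OF f _ eta i, of "real (Suc n)"] by (simp add: distrib_left mult_ac)
  show ?thesis by (rule LIMSEQ_unique[OF L1[unfolded eq] tendsto_minus[OF L2]])
qed

text \<open>The law of c x + \<open>csn c\<close> z as a density for Lebesgue measure, against which
  weak gradients are tested; \<open>mehler\<close> is its density for the Gaussian measure.\<close>

definition gauss_kernel :: "real \<Rightarrow> 'a::euclidean_space \<Rightarrow> 'a \<Rightarrow> real" where
  "gauss_kernel c x y = gauss_dens y * mehler c x y"

lemma gauss_kernel_exp: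
  fixes x :: "'a::euclidean_space"
  assumes "0 \<le> c" "c < 1"
  obtains K where "gauss_kernel c x = (\<lambda>y. K * exp (c / (csn c)\<^sup>2 * (y \<bullet> x) + (- 1 / (2 * (csn c)\<^sup>2)) * (norm y)\<^sup>2))"
proof -
  let ?s = "csn c"
  have s: "?s > 0" and s2: "?s\<^sup>2 = 1 - c\<^sup>2" using csn_pos csn_sq assms by auto
  define K where "K = (2 * pi) powr (- real DIM('a) / 2) * (exp (- (c * norm x)\<^sup>2 / (2 * ?s\<^sup>2)) / ?s ^ DIM('a))"
  have "gauss_kernel c x y = K * exp (c / ?s\<^sup>2 * (y \<bullet> x) + (- 1 / (2 * ?s\<^sup>2)) * (norm y)\<^sup>2)" for y
  proof -
    have "(?s\<^sup>2 + c\<^sup>2) / (2 * ?s\<^sup>2) = 1 / (2 * ?s\<^sup>2)" by (simp add: s2)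
    then have "1 / 2 + c\<^sup>2 / (2 * ?s\<^sup>2) = 1 / (2 * ?s\<^sup>2)" using s by (simp add: add_divide_distrib)
    then have "(1 / 2 + c\<^sup>2 / (2 * ?s\<^sup>2)) * (norm y)\<^sup>2 = 1 / (2 * ?s\<^sup>2) * (norm y)\<^sup>2" by simp
    then have e: "c / ?s\<^sup>2 * (y \<bullet> x) + (- 1 / (2 * ?s\<^sup>2)) * (norm y)\<^sup>2
      = - (norm y)\<^sup>2 / 2 + (c / ?s\<^sup>2 * (x \<bullet> y) + - (c * norm y)\<^sup>2 / (2 * ?s\<^sup>2))"
      by (simp add: distrib_right power_mult_distrib inner_commute)
    show ?thesis unfolding gauss_kernel_def mehler_def gauss_dens_def K_def e exp_add by (simp only: mult_ac)
  qed
  then show ?thesis using that[of K] by blast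
qed

lemma smooth_gauss_kernel:
  assumes "0 \<le> c" "c < 1"
  shows "smooth (gauss_kernel c (x::'a::euclidean_space))"
proof -
  obtain K where K: "gauss_kernel c x = (\<lambda>y. K * exp (c / (csn c)\<^sup>2 * (y \<bullet> x) + (- 1 / (2 * (csn c)\<^sup>2)) * (norm y)\<^sup>2))"
    using gauss_kernel_exp[OF assms] by blast
  show ?thesis unfolding K
    by (intro smooth_mult smooth_const smooth_compose[OF smooth_exp] smooth_add smooth_inner smooth_norm_square)
qed

text \<open>The kernel depends on y - c x only, so its derivative in x is - c times the derivative
  in y computed here.\<close>

lemma partial_deriv_gauss_kernel:
  fixes x :: "'a::euclidean_space"
  assumes c: "0 \<le> c" "c < 1"
  shows "partial_deriv i (gauss_kernel c x) y = - ((y - c *\<^sub>R x) \<bullet> i / (csn c)\<^sup>2) * gauss_kernel c x y"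
proof -
  obtain K where K: "gauss_kernel c x = (\<lambda>y. K * exp (c / (csn c)\<^sup>2 * (y \<bullet> x) + (- 1 / (2 * (csn c)\<^sup>2)) * (norm y)\<^sup>2))"
    using gauss_kernel_exp[OF c] by blast
  have d: "((\<lambda>y. K * exp (b * (y \<bullet> x) + a * (y \<bullet> y))) has_derivative
     (\<lambda>h. (b * (h \<bullet> x) + 2 * a * (y \<bullet> h)) * (K * exp (b * (y \<bullet> x) + a * (y \<bullet> y))))) (at y)" for a b
    by (auto intro!: derivative_eq_intros ext simp: inner_commute algebra_simps)
  have "partial_deriv i (gauss_kernel c x) y = (c / (csn c)\<^sup>2 * (i \<bullet> x) + 2 * (- 1 / (2 * (csn c)\<^sup>2)) * (y \<bullet> i)) * gauss_kernel c x y"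
    unfolding K power2_norm_eq_inner by (rule partial_deriv_eqI[OF d])
  then show ?thesis by (simp add: inner_diff_left inner_diff_right inner_commute diff_divide_distrib left_diff_distrib)
qed

text \<open>Turning the derivative in x into one in y costs the factor - c, and the weak identity
  then moves it from the kernel onto w: this is the origin of the damping of gradients. The identity
  is assumed for the kernel at x because the kernel is not compactly supported and hence not a test
  function.\<close>

lemma partial_deriv_ou_weak:
  fixes w d :: "'a::euclidean_space \<Rightarrow> real"
  assumes c: "0 < c" "c < 1" and w: "integrable std_gaussian w" and d: "integrable std_gaussian d" and i: "i \<in> Basis"
    and weak: "(\<integral>y. w y * partial_deriv i (gauss_kernel c x) y \<partial>lborel) = - (\<integral>y. d y * gauss_kernel c x y \<partial>lborel)"
  shows "partial_deriv i (ou c w) x = c * ou c d x"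
proof -
  have s: "csn c > 0" using csn_pos c by auto
  have c': "0 \<le> c" "c < 1" using c by auto
  have [measurable]: "w \<in> borel_measurable borel" "d \<in> borel_measurable borel" using w d by auto
  have "partial_deriv i (ou c w) x
    = c / csn c * (\<integral>y. gauss_dens y * (mehler c x y * ((((y - c *\<^sub>R x) \<bullet> i) / csn c) * w y)) \<partial>lborel)"
    by (simp add: partial_deriv_ou_mehler(2)[OF c w i] integral_std_gaussian)
  also have "\<dots> = (\<integral>y. - c * (w y * partial_deriv i (gauss_kernel c x) y) \<partial>lborel)"
    by (subst integral_mult_right_zero[symmetric])
       (intro Bochner_Integration.integral_cong refl,
        simp add: partial_deriv_gauss_kernel[OF c'] gauss_kernel_def power2_eq_square)
  also have "\<dots> = c * (\<integral>y. d y * gauss_kernel c x y \<partial>lborel)"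
    by (subst integral_mult_right_zero) (simp add: weak)
  also have "(\<integral>y. d y * gauss_kernel c x y \<partial>lborel) = (\<integral>y. mehler c x y * d y \<partial>std_gaussian)"
    by (subst integral_std_gaussian) (auto simp: gauss_kernel_def mult_ac)
  also have "\<dots> = ou c d x" using c' by (simp add: ou_eq_mehler)
  finally show ?thesis .
qed

section \<open>Chain rule for saturated weak derivatives\<close>

text \<open>Saturation makes f bounded without increasing the Fisher information;
  \<open>dsatur a\<close> is the derivative of \<open>satur a\<close>.\<close>

definition satur :: "real \<Rightarrow> real \<Rightarrow> real" where "satur a r = a * r / (a + r)"
definition dsatur :: "real \<Rightarrow> real \<Rightarrow> real" where "dsatur a r = (a / (a + r))\<^sup>2"

lemma satur_measurable [measurable]: "satur a \<in> borel_measurable borel" "dsatur a \<in> borel_measurable borel"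
  unfolding satur_def[abs_def] dsatur_def[abs_def] by measurable

lemma satur_nonneg: "a > 0 \<Longrightarrow> r \<ge> 0 \<Longrightarrow> satur a r \<ge> 0"
  and satur_le: "a > 0 \<Longrightarrow> r \<ge> 0 \<Longrightarrow> satur a r \<le> r"
  and satur_le_bound: "a > 0 \<Longrightarrow> r \<ge> 0 \<Longrightarrow> satur a r \<le> a"
  by (auto simp: satur_def divide_le_eq add_pos_nonneg distrib_left distrib_right)

lemma dsatur_nonneg: "dsatur a r \<ge> 0"
  by (simp add: dsatur_def)

lemma dsatur_le_1: "a > 0 \<Longrightarrow> r \<ge> 0 \<Longrightarrow> dsatur a r \<le> 1"
  by (auto simp: dsatur_def power_le_one_iff divide_le_eq)

lemma satur_has_derivative:
  "a + r \<noteq> 0 \<Longrightarrow> (satur a has_real_derivative dsatur a r) (at r)"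
  unfolding satur_def[abs_def] dsatur_def
  by (auto intro!: derivative_eq_intros simp: power2_eq_square field_simps)

lemma isCont_satur: "a + r \<noteq> 0 \<Longrightarrow> isCont (satur a) r" "a + r \<noteq> 0 \<Longrightarrow> isCont (dsatur a) r"
  unfolding satur_def[abs_def] dsatur_def[abs_def] by (auto intro!: continuous_intros)

lemma continuous_satur:
  assumes "a > 0" "continuous_on UNIV u" "\<And>x. u x \<ge> 0"
  shows "continuous_on UNIV (\<lambda>x. satur a (u x))" "continuous_on UNIV (\<lambda>x. dsatur a (u x))"
proof -
  have "a + u x \<noteq> 0" for x using assms(1) assms(3)[of x] by linarith
  then show "continuous_on UNIV (\<lambda>x. satur a (u x))" "continuous_on UNIV (\<lambda>x. dsatur a (u x))"
    unfolding satur_def dsatur_def using assms(2) by (auto intro!: continuous_intros)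
qed

lemma lborel_to_gaussian:
  fixes F k :: "'a::euclidean_space \<Rightarrow> real"
  assumes [measurable]: "F \<in> borel_measurable borel" "k \<in> borel_measurable borel"
  shows "(\<integral>x. F x * k x \<partial>lborel) = (\<integral>x. F x * (k x / gauss_dens x) \<partial>std_gaussian)"
proof -
  have "gauss_dens x \<noteq> 0" for x :: 'a using gauss_dens_pos[of x] by simp
  then show ?thesis by (subst integral_std_gaussian) (auto intro!: Bochner_Integration.integral_cong)
qed

text \<open>Convergence along the flow is in the mean for the Gaussian measure, while weak gradients
  are tested against Lebesgue measure. Compact support of k keeps the conversion factor
  bounded.\<close>

lemma divide_gauss_dens_bounded:
  fixes k :: "'a::euclidean_space \<Rightarrow> real"
  assumes k: "continuous_on UNIV k" and supp: "\<And>x. norm x > R \<Longrightarrow> k x = 0"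
  obtains B where "B > 0" "\<And>x. \<bar>k x / gauss_dens x\<bar> \<le> B"
proof -
  have nz: "gauss_dens x \<noteq> 0" for x :: 'a using gauss_dens_pos[of x] by simp
  have "continuous_on UNIV (\<lambda>x. k x / gauss_dens x)"
    using nz by (auto intro!: continuous_intros k continuous_gauss_dens)
  then show ?thesis using continuous_compact_support_bounded[of "\<lambda>x. k x / gauss_dens x" R] supp that by auto
qed

text \<open>Proved by mollifying w with the flow and letting c tend to 1.\<close>

lemma chain_rule_mollified:
  fixes w d :: "'a::euclidean_space \<Rightarrow> real"
  assumes a: "a > 0" and w: "integrable std_gaussian w" and w0: "\<And>x. w x \<ge> 0" and d: "integrable std_gaussian d"
    and i: "i \<in> Basis"
    and weak: "\<And>\<eta>. smooth \<eta> \<Longrightarrow> (\<integral>y. w y * partial_deriv i \<eta> y \<partial>lborel) = - (\<integral>y. d y * \<eta> y \<partial>lborel)"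
    and phi: "test_function \<phi>"
  shows "(\<integral>x. satur a (w x) * partial_deriv i \<phi> x \<partial>lborel) = - (\<integral>x. dsatur a (w x) * d x * \<phi> x \<partial>lborel)"
proof -
  have [measurable]: "w \<in> borel_measurable borel" "d \<in> borel_measurable borel" using w d by auto
  have sphi: "smooth \<phi>" using phi by (simp add: test_function_def)
  obtain R where R: "\<And>x. norm x > R \<Longrightarrow> \<phi> x = 0" "\<And>x. norm x > R \<Longrightarrow> partial_deriv i \<phi> x = 0"
    using test_function_support[OF phi] by metis
  have cphi: "continuous_on UNIV \<phi>" "continuous_on UNIV (partial_deriv i \<phi>)"
    by (rule smooth_continuous[OF sphi] smooth_partial_continuous[OF sphi i])+
  have [measurable]: "\<phi> \<in> borel_measurable borel" "partial_deriv i \<phi> \<in> borel_measurable borel"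
    using cphi by (auto intro: borel_measurable_continuous_onI)
  define k1 where "k1 x = partial_deriv i \<phi> x / gauss_dens x" for x
  define k2 where "k2 x = \<phi> x / gauss_dens x" for x
  obtain B1 where B1: "B1 > 0" "\<And>x. \<bar>k1 x\<bar> \<le> B1"
    unfolding k1_def using divide_gauss_dens_bounded[OF cphi(2) R(2)] by metis
  obtain B2 where B2: "B2 > 0" "\<And>x. \<bar>k2 x\<bar> \<le> B2"
    unfolding k2_def using divide_gauss_dens_bounded[OF cphi(1) R(1)] by metis
  have [measurable]: "k1 \<in> borel_measurable borel" "k2 \<in> borel_measurable borel"
    unfolding k1_def[abs_def] k2_def[abs_def] by measurable
  \<comment> \<open>The shift by two keeps all parameters strictly between 0 and 1, also for n =
    0.\<close>
  define C where "C n = 1 - inverse (real (Suc (Suc n)))" for n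
  have C: "0 < C n" "C n < 1" for n unfolding C_def by (auto simp: field_simps)
  then have C': "0 \<le> C n" "C n < 1" for n using less_imp_le by blast+
  have "(\<lambda>n. 1 - inverse (real (Suc (Suc n)))) \<longlonglongrightarrow> 1 - 0"
    by (intro tendsto_intros LIMSEQ_Suc[OF LIMSEQ_inverse_real_of_nat])
  then have Clim: "C \<longlonglongrightarrow> 1" unfolding C_def[abs_def] by simp
  define u where "u n = ou (C n) w" for n
  define e where "e n = ou (C n) d" for n
  have [measurable]: "u n \<in> borel_measurable borel" "e n \<in> borel_measurable borel" for n
    unfolding u_def e_def by auto
  have u0: "u n x \<ge> 0" for n x unfolding u_def ou_def using w0 by simp
  have su: "smooth (u n)" for n unfolding u_def by (rule smooth_ou[OF C w])
  have du: "partial_deriv i (u n) x = C n * e n x" for n x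
    unfolding u_def e_def using C[of n] C'[of n]
    by (intro partial_deriv_ou_weak w d i weak smooth_gauss_kernel) auto
  have iu: "integrable std_gaussian (u n)" "integrable std_gaussian (e n)" for n
    unfolding u_def e_def by (auto intro: integrable_ou C' w d)
  \<comment> \<open>For the smooth mollification this is the classical chain rule with integration
    by parts; the factor \<open>C n\<close> stems from commuting flow and gradient.\<close>
  have parts: "(\<integral>x. satur a (u n x) * k1 x \<partial>std_gaussian) = - C n * (\<integral>x. dsatur a (u n x) * e n x * k2 x \<partial>std_gaussian)" for n
  proof -
    have nz: "a + u n x \<noteq> 0" for x using a u0[of n x] by linarith
    define G' where "G' x h = satur a (u n x) * frechet_derivative \<phi> (at x) h
       + (dsatur a (u n x) * frechet_derivative (u n) (at x) h) * \<phi> x" for x h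
    have D: "((\<lambda>x. satur a (u n x) * \<phi> x) has_derivative G' x) (at x)" for x
      unfolding G'_def
      by (rule has_derivative_mult[OF has_derivative_compose[OF smooth_has_derivative[OF su]
            satur_has_derivative[OF nz, unfolded has_field_derivative_def]] smooth_has_derivative[OF sphi]])
    have G'i: "G' x i = satur a (u n x) * partial_deriv i \<phi> x + dsatur a (u n x) * partial_deriv i (u n) x * \<phi> x" for x
      by (simp add: G'_def partial_deriv_def)
    note cu = continuous_satur[OF a smooth_continuous[OF su[of n]] u0[of n]] smooth_partial_continuous[OF su[of n] i]
    have c1: "continuous_on UNIV (\<lambda>x. satur a (u n x) * partial_deriv i \<phi> x)"
      "continuous_on UNIV (\<lambda>x. dsatur a (u n x) * partial_deriv i (u n) x * \<phi> x)"
      by (intro continuous_intros cu cphi)+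
    have "(\<integral>x. G' x i \<partial>lborel) = 0"
      by (rule integral_derivative_compact_support[OF D _ _ i, of R])
         (use R c1 in \<open>auto simp: G'i intro: continuous_on_add\<close>)
    moreover have "integrable lborel (\<lambda>x. satur a (u n x) * partial_deriv i \<phi> x)"
      "integrable lborel (\<lambda>x. dsatur a (u n x) * partial_deriv i (u n) x * \<phi> x)"
      by (rule integrable_lborel_compact_support[OF c1(1), of R] integrable_lborel_compact_support[OF c1(2), of R]; simp add: R)+
    ultimately have "(\<integral>x. satur a (u n x) * partial_deriv i \<phi> x \<partial>lborel)
       = - (\<integral>x. dsatur a (u n x) * partial_deriv i (u n) x * \<phi> x \<partial>lborel)"
      by (simp add: G'i)
    moreover have "(\<integral>x. satur a (u n x) * partial_deriv i \<phi> x \<partial>lborel) = (\<integral>x. satur a (u n x) * k1 x \<partial>std_gaussian)"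
      unfolding k1_def by (rule lborel_to_gaussian) auto
    moreover have "(\<integral>x. dsatur a (u n x) * partial_deriv i (u n) x * \<phi> x \<partial>lborel)
       = (\<integral>x. C n * (dsatur a (u n x) * e n x * k2 x) \<partial>std_gaussian)"
      unfolding du k2_def by (subst lborel_to_gaussian) (auto simp: mult_ac)
    ultimately show ?thesis by simp
  qed
  have uL1: "(\<lambda>n. \<integral>x. \<bar>u n x - w x\<bar> \<partial>std_gaussian) \<longlonglongrightarrow> 0"
    unfolding u_def by (rule ou_tendsto_L1[OF w Clim C'])
  have eL1: "(\<lambda>n. \<integral>x. \<bar>e n x - d x\<bar> \<partial>std_gaussian) \<longlonglongrightarrow> 0"
    unfolding e_def by (rule ou_tendsto_L1[OF d Clim C'])
  \<comment> \<open>The saturation is nonlinear, so convergence almost everywhere is wanted; a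
    subsequence provides it, and boundedness of \<open>satur\<close> and \<open>dsatur\<close> gives
    the domination.\<close>
  obtain r where r: "strict_mono r" and AEu: "AE x in std_gaussian. (\<lambda>n. u (r n) x - w x) \<longlonglongrightarrow> 0"
    using tendsto_L1_AE_subseq[of std_gaussian "\<lambda>n x. u n x - w x"] uL1 iu w by auto
  have AEu: "AE x in std_gaussian. (\<lambda>n. u (r n) x) \<longlonglongrightarrow> w x"
    using AEu by eventually_elim (rule LIM_zero_cancel)
  have s1: "satur a (w x) \<le> a" "0 \<le> satur a (w x)" "satur a (u n x) \<le> a" "0 \<le> satur a (u n x)"
     "\<bar>dsatur a (u n x)\<bar> \<le> 1" "\<bar>dsatur a (w x)\<bar> \<le> 1" for n x
    using a w0[of x] u0[of n x] satur_le_bound satur_nonneg dsatur_le_1 dsatur_nonneg by auto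
  have L: "(\<lambda>n. \<integral>x. satur a (u (r n) x) * k1 x \<partial>std_gaussian) \<longlonglongrightarrow> (\<integral>x. satur a (w x) * k1 x \<partial>std_gaussian)"
  proof (rule integral_dominated_convergence[where w="\<lambda>x. a * B1"])
    show "AE x in std_gaussian. (\<lambda>n. satur a (u (r n) x) * k1 x) \<longlonglongrightarrow> satur a (w x) * k1 x"
      using AEu
    proof eventually_elim
      case (elim x)
      have "a + w x \<noteq> 0" using a w0[of x] by linarith
      then show ?case by (intro tendsto_intros isCont_tendsto_compose[OF isCont_satur(1)] elim)
    qed
    show "AE x in std_gaussian. norm (satur a (u (r n) x) * k1 x) \<le> a * B1" for n
      using s1 B1 a by (intro AE_I2) (auto simp: abs_mult intro!: mult_mono)
  qed auto
  have Rl: "(\<lambda>n. \<integral>x. dsatur a (u (r n) x) * e (r n) x * k2 x \<partial>std_gaussian) \<longlonglongrightarrow> (\<integral>x. dsatur a (w x) * d x * k2 x \<partial>std_gaussian)"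
  proof -
    have 1: "(\<lambda>n. \<integral>x. dsatur a (u (r n) x) * k2 x * d x \<partial>std_gaussian) \<longlonglongrightarrow> (\<integral>x. dsatur a (w x) * k2 x * d x \<partial>std_gaussian)"
    proof (rule integral_dominated_convergence[where w="\<lambda>x. 1 * B2 * \<bar>d x\<bar>"])
      show "AE x in std_gaussian. (\<lambda>n. dsatur a (u (r n) x) * k2 x * d x) \<longlonglongrightarrow> dsatur a (w x) * k2 x * d x"
        using AEu
      proof eventually_elim
        case (elim x)
        have "a + w x \<noteq> 0" using a w0[of x] by linarith
        then show ?case by (intro tendsto_intros isCont_tendsto_compose[OF isCont_satur(2)] elim)
      qed
      show "AE x in std_gaussian. norm (dsatur a (u (r n) x) * k2 x * d x) \<le> 1 * B2 * \<bar>d x\<bar>" for n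
        unfolding real_norm_def abs_mult by (intro AE_I2 mult_mono s1 B2(2)) (use B2(1) in auto)
      show "integrable std_gaussian (\<lambda>x. 1 * B2 * \<bar>d x\<bar>)" using d by auto
    qed auto
    have kb: "\<bar>dsatur a (u n x) * k2 x\<bar> \<le> 1 * B2" for n x
      unfolding abs_mult by (intro mult_mono s1 B2(2)) auto
    \<comment> \<open>Both factors of the product vary with n. The difference e - d is small in the
      mean against a bounded factor; with d held fixed, dominated convergence applies.\<close>
    have 2: "(\<lambda>n. \<integral>x. dsatur a (u (r n) x) * k2 x * (e (r n) x - d x) \<partial>std_gaussian) \<longlonglongrightarrow> 0"
    proof (rule Lim_null_comparison)
      show "(\<lambda>n. B2 * (\<integral>x. \<bar>e (r n) x - d x\<bar> \<partial>std_gaussian)) \<longlonglongrightarrow> 0"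
        using tendsto_mult_right[OF LIMSEQ_subseq_LIMSEQ[OF eL1 r], of B2] by (simp add: comp_def mult.commute)
      show "\<forall>\<^sub>F n in sequentially. norm (\<integral>x. dsatur a (u (r n) x) * k2 x * (e (r n) x - d x) \<partial>std_gaussian)
         \<le> B2 * (\<integral>x. \<bar>e (r n) x - d x\<bar> \<partial>std_gaussian)"
      proof (intro always_eventually allI)
        fix n
        have ied: "integrable std_gaussian (\<lambda>x. e (r n) x - d x)" using iu d by auto
        have "\<bar>\<integral>x. dsatur a (u (r n) x) * k2 x * (e (r n) x - d x) \<partial>std_gaussian\<bar> \<le> (\<integral>x. B2 * \<bar>e (r n) x - d x\<bar> \<partial>std_gaussian)"
        proof (rule Bochner_Integration.integral_abs_bound_integral)
          show "integrable std_gaussian (\<lambda>x. dsatur a (u (r n) x) * k2 x * (e (r n) x - d x))"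
            by (rule integrable_mult_bounded[OF ied _ kb]) simp
          show "integrable std_gaussian (\<lambda>x. B2 * \<bar>e (r n) x - d x\<bar>)" using ied by auto
          show "\<bar>dsatur a (u (r n) x) * k2 x * (e (r n) x - d x)\<bar> \<le> B2 * \<bar>e (r n) x - d x\<bar>" for x
            unfolding abs_mult[of "dsatur a (u (r n) x) * k2 x"] using kb by (intro mult_right_mono) auto
        qed
        then show "norm (\<integral>x. dsatur a (u (r n) x) * k2 x * (e (r n) x - d x) \<partial>std_gaussian)
         \<le> B2 * (\<integral>x. \<bar>e (r n) x - d x\<bar> \<partial>std_gaussian)" by simp
      qed
    qed
    have "(\<integral>x. dsatur a (u n x) * e n x * k2 x \<partial>std_gaussian)
      = (\<integral>x. dsatur a (u n x) * k2 x * (e n x - d x) \<partial>std_gaussian) + (\<integral>x. dsatur a (u n x) * k2 x * d x \<partial>std_gaussian)" for n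
    proof -
      have ed: "integrable std_gaussian (\<lambda>x. e n x - d x)" using iu d by auto
      have "integrable std_gaussian (\<lambda>x. dsatur a (u n x) * k2 x * (e n x - d x))"
        "integrable std_gaussian (\<lambda>x. dsatur a (u n x) * k2 x * d x)"
        by (rule integrable_mult_bounded[OF ed _ kb] integrable_mult_bounded[OF d _ kb], simp)+
      from Bochner_Integration.integral_add[OF this] show ?thesis by (simp add: algebra_simps)
    qed
    then show ?thesis using tendsto_add[OF 2 1] by (simp add: mult_ac)
  qed
  have "(\<lambda>n. - C (r n) * (\<integral>x. dsatur a (u (r n) x) * e (r n) x * k2 x \<partial>std_gaussian))
     \<longlonglongrightarrow> - 1 * (\<integral>x. dsatur a (w x) * d x * k2 x \<partial>std_gaussian)"
    using LIMSEQ_subseq_LIMSEQ[OF Clim r] by (intro tendsto_intros Rl) (simp add: comp_def)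
  then have "(\<integral>x. satur a (w x) * k1 x \<partial>std_gaussian) = - 1 * (\<integral>x. dsatur a (w x) * d x * k2 x \<partial>std_gaussian)"
    using L unfolding parts by (rule LIMSEQ_unique[rotated])
  then show ?thesis
    unfolding k1_def k2_def by (subst (1 2) lborel_to_gaussian) auto
qed

lemma integrable_std_gaussian_cutoff:
  fixes f k :: "'a::euclidean_space \<Rightarrow> real"
  assumes f: "locally_integrable f" and k: "continuous_on UNIV k" and supp: "\<And>x. norm x > R \<Longrightarrow> k x = 0"
  shows "integrable std_gaussian (\<lambda>x. k x * f x)"
proof -
  have [measurable]: "f \<in> borel_measurable borel" "k \<in> borel_measurable borel"
    using locally_integrable_measurable[OF f] borel_measurable_continuous_onI[OF k] by auto
  have "integrable lborel (\<lambda>x. f x * (gauss_dens x * k x))"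
    by (rule locally_integrable_mult[OF f, of _ R]) (use supp in \<open>auto intro!: continuous_intros k continuous_gauss_dens\<close>)
  then show ?thesis by (subst integrable_std_gaussian_iff) (auto simp: mult_ac)
qed

text \<open>f is only locally integrable, so it is cut off to become integrable for the Gaussian
  measure together with its weak derivative. Removing the cutoff is dominated because
  \<open>satur\<close> lies below its argument and \<open>dsatur\<close> below 1.\<close>

lemma weak_gradient_satur:
  fixes f :: "'a::euclidean_space \<Rightarrow> real"
  assumes a: "a > 0" and wg: "has_weak_gradient f Df" and f0: "\<And>x. f x \<ge> 0"
  shows "has_weak_gradient (\<lambda>x. satur a (f x)) (\<lambda>x. dsatur a (f x) *\<^sub>R Df x)"
proof -
  have lf: "locally_integrable f" and lD: "locally_integrable Df" using wg by (auto simp: has_weak_gradient_def)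
  have [measurable]: "f \<in> borel_measurable borel" "Df \<in> borel_measurable borel"
    by (rule locally_integrable_measurable lf lD)+
  have l1: "locally_integrable (\<lambda>x. satur a (f x))"
    by (rule locally_integrable_dominated[OF lf])
      (use a f0 satur_nonneg satur_le in \<open>auto intro: order_trans\<close>)
  have l2: "locally_integrable (\<lambda>x. dsatur a (f x) *\<^sub>R Df x)"
    by (rule locally_integrable_dominated[OF lD])
      (use a f0 dsatur_le_1 dsatur_nonneg in \<open>auto simp: mult_left_le_one_le\<close>)
  have "(\<integral>x. satur a (f x) * partial_deriv i \<phi> x \<partial>lborel) = - (\<integral>x. (dsatur a (f x) *\<^sub>R Df x \<bullet> i) * \<phi> x \<partial>lborel)"
    if phi: "test_function \<phi>" and i: "i \<in> Basis" for \<phi> i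
  proof -
    have sphi: "smooth \<phi>" using phi by (simp add: test_function_def)
    obtain R where R: "\<And>x. norm x > R \<Longrightarrow> \<phi> x = 0" "\<And>x. norm x > R \<Longrightarrow> partial_deriv i \<phi> x = 0"
      using test_function_support[OF phi] by metis
    have cphi: "continuous_on UNIV \<phi>" "continuous_on UNIV (partial_deriv i \<phi>)"
      by (rule smooth_continuous[OF sphi] smooth_partial_continuous[OF sphi i])+
    have [measurable]: "\<phi> \<in> borel_measurable borel" "partial_deriv i \<phi> \<in> borel_measurable borel"
      using cphi by (auto intro: borel_measurable_continuous_onI)
    note lDi = locally_integrable_inner[OF lD i]
    let ?b = "\<lambda>n. bump (real (Suc n)) :: 'a \<Rightarrow> real"
    let ?db = "\<lambda>n. partial_deriv i (?b n)"
    have cb: "continuous_on UNIV (?b n)" "continuous_on UNIV (?db n)" for n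
      by (rule smooth_continuous[OF smooth_bump] smooth_partial_continuous[OF smooth_bump i])+
    have bm[measurable]: "?b n \<in> borel_measurable borel" "?db n \<in> borel_measurable borel" for n
      by (rule borel_measurable_continuous_onI[OF cb(1)] borel_measurable_continuous_onI[OF cb(2)])+
    have b01: "0 \<le> ?b n x" "?b n x \<le> 1" for n x using bump_nonneg bump_le_1 by auto
    define w where "w n x = ?b n x * f x" for n x
    \<comment> \<open>Product rule: the weak derivative of the cut-off function includes the
      derivative of the cutoff.\<close>
    define d where "d n x = ?b n x * (Df x \<bullet> i) + ?db n x * f x" for n x
    have [measurable]: "w n \<in> borel_measurable borel" "d n \<in> borel_measurable borel" for n
      unfolding w_def[abs_def] d_def[abs_def] by measurable
    have w0: "w n x \<ge> 0" for n x using b01 f0 by (simp add: w_def)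
    have supb: "\<exists>R. \<forall>x. norm x > R \<longrightarrow> ?b n x = 0 \<and> ?db n x = 0" for n
      using test_function_support[OF test_function_bump[of "real (Suc n)"]] by (metis of_nat_0_less_iff zero_less_Suc)
    have chain: "(\<integral>x. satur a (w n x) * partial_deriv i \<phi> x \<partial>lborel) = - (\<integral>x. dsatur a (w n x) * d n x * \<phi> x \<partial>lborel)" for n
    proof (rule chain_rule_mollified[OF a _ w0 _ i _ phi])
      obtain Q where Q: "\<And>x. norm x > Q \<Longrightarrow> ?b n x = 0" "\<And>x. norm x > Q \<Longrightarrow> ?db n x = 0" using supb[of n] by blast
      show "integrable std_gaussian (w n)"
        unfolding w_def by (rule integrable_std_gaussian_cutoff[OF lf cb(1) Q(1)])
      show "integrable std_gaussian (d n)"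
        unfolding d_def by (intro Bochner_Integration.integrable_add integrable_std_gaussian_cutoff[OF lf cb(2) Q(2)]
            integrable_std_gaussian_cutoff[OF lDi cb(1) Q(1)])
      fix \<eta> :: "'a \<Rightarrow> real" assume eta: "smooth \<eta>"
      note ce = smooth_continuous[OF eta, of UNIV] smooth_partial_continuous[OF eta i, of UNIV]
      have ints: "integrable lborel (\<lambda>x. f x * (?b n x * partial_deriv i \<eta> x))" "integrable lborel (\<lambda>x. f x * (?db n x * \<eta> x))"
        "integrable lborel (\<lambda>x. (Df x \<bullet> i) * (?b n x * \<eta> x))"
      proof -
        show "integrable lborel (\<lambda>x. f x * (?b n x * partial_deriv i \<eta> x))"
          by (rule locally_integrable_mult[where R=Q, OF lf continuous_on_mult[OF cb(1) ce(2)]]) (simp only: Q mult_zero_left)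
        show "integrable lborel (\<lambda>x. f x * (?db n x * \<eta> x))"
          by (rule locally_integrable_mult[where R=Q, OF lf continuous_on_mult[OF cb(2) ce(1)]]) (simp only: Q mult_zero_left)
        show "integrable lborel (\<lambda>x. (Df x \<bullet> i) * (?b n x * \<eta> x))"
          by (rule locally_integrable_mult[where R=Q, OF lDi continuous_on_mult[OF cb(1) ce(1)]]) (simp only: Q mult_zero_left)
      qed
      have "(\<integral>x. f x * (?b n x * partial_deriv i \<eta> x) \<partial>lborel) + (\<integral>x. f x * (?db n x * \<eta> x) \<partial>lborel)
         = - (\<integral>x. (Df x \<bullet> i) * (?b n x * \<eta> x) \<partial>lborel)"
        using weak_gradient_cutoff[OF wg _ eta i, of "real (Suc n)"]
        unfolding distrib_left Bochner_Integration.integral_add[OF ints(1,2)] by simp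
      moreover have "(\<integral>x. d n x * \<eta> x \<partial>lborel) = (\<integral>x. (Df x \<bullet> i) * (?b n x * \<eta> x) \<partial>lborel) + (\<integral>x. f x * (?db n x * \<eta> x) \<partial>lborel)"
        unfolding Bochner_Integration.integral_add[OF ints(3,2), symmetric]
        by (intro Bochner_Integration.integral_cong) (simp_all add: d_def algebra_simps)
      ultimately show "(\<integral>y. w n y * partial_deriv i \<eta> y \<partial>lborel) = - (\<integral>y. d n y * \<eta> y \<partial>lborel)"
        by (simp add: w_def mult_ac)
    qed
    have nz: "a + f x \<noteq> 0" for x using a f0[of x] by linarith
    have wlim: "(\<lambda>n. w n x) \<longlonglongrightarrow> f x" for x
      using tendsto_mult_right[OF bump_tendsto_1[of x], of "f x"] by (simp add: w_def mult.commute)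
    have dlim: "(\<lambda>n. d n x) \<longlonglongrightarrow> Df x \<bullet> i" for x
    proof -
      have "(\<lambda>n. d n x) \<longlonglongrightarrow> 1 * (Df x \<bullet> i) + 0 * f x"
        unfolding d_def by (intro tendsto_intros bump_tendsto_1 partial_deriv_bump_tendsto i)
      then show ?thesis by simp
    qed
    have wf: "w n x \<le> f x" for n x using b01[of n x] f0[of x] by (simp add: w_def mult_left_le_one_le)
    have dle: "\<bar>d n x\<bar> \<le> \<bar>Df x \<bullet> i\<bar> + 4 * exp 1 * f x" for n x
    proof -
      have "\<bar>?b n x * (Df x \<bullet> i)\<bar> \<le> 1 * \<bar>Df x \<bullet> i\<bar>" "\<bar>?db n x * f x\<bar> \<le> 4 * exp 1 * \<bar>f x\<bar>"
        unfolding abs_mult using b01[of n x] partial_deriv_bump_bound_Suc[OF i]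
        by (intro mult_right_mono; simp)+
      then show ?thesis using f0[of x] unfolding d_def by simp
    qed
    have i1: "integrable lborel (\<lambda>x. f x * partial_deriv i \<phi> x)" by (rule locally_integrable_mult[OF lf cphi(2) R(2)])
    have i2: "integrable lborel (\<lambda>x. f x * \<phi> x)" by (rule locally_integrable_mult[OF lf cphi(1) R(1)])
    have i3: "integrable lborel (\<lambda>x. (Df x \<bullet> i) * \<phi> x)" by (rule locally_integrable_mult[OF lDi cphi(1) R(1)])
    have L: "(\<lambda>n. \<integral>x. satur a (w n x) * partial_deriv i \<phi> x \<partial>lborel) \<longlonglongrightarrow> (\<integral>x. satur a (f x) * partial_deriv i \<phi> x \<partial>lborel)"
    proof (rule integral_dominated_convergence[where w="\<lambda>x. \<bar>f x * partial_deriv i \<phi> x\<bar>"])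
      show "AE x in lborel. (\<lambda>n. satur a (w n x) * partial_deriv i \<phi> x) \<longlonglongrightarrow> satur a (f x) * partial_deriv i \<phi> x"
        by (intro AE_I2 tendsto_intros isCont_tendsto_compose[OF isCont_satur(1)] nz wlim)
      show "AE x in lborel. norm (satur a (w n x) * partial_deriv i \<phi> x) \<le> \<bar>f x * partial_deriv i \<phi> x\<bar>" for n
      proof (intro AE_I2)
        fix x
        have "\<bar>satur a (w n x)\<bar> \<le> \<bar>f x\<bar>"
          using satur_nonneg[OF a w0[of n x]] satur_le[OF a w0[of n x]] wf[of n x] by simp
        then show "norm (satur a (w n x) * partial_deriv i \<phi> x) \<le> \<bar>f x * partial_deriv i \<phi> x\<bar>"
          by (simp add: abs_mult mult_right_mono)
      qed
      show "integrable lborel (\<lambda>x. \<bar>f x * partial_deriv i \<phi> x\<bar>)" using i1 by auto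
    qed auto
    have Rr: "(\<lambda>n. \<integral>x. dsatur a (w n x) * d n x * \<phi> x \<partial>lborel) \<longlonglongrightarrow> (\<integral>x. dsatur a (f x) * (Df x \<bullet> i) * \<phi> x \<partial>lborel)"
    proof (rule integral_dominated_convergence[where w="\<lambda>x. \<bar>(Df x \<bullet> i) * \<phi> x\<bar> + 4 * exp 1 * \<bar>f x * \<phi> x\<bar>"])
      show "AE x in lborel. (\<lambda>n. dsatur a (w n x) * d n x * \<phi> x) \<longlonglongrightarrow> dsatur a (f x) * (Df x \<bullet> i) * \<phi> x"
        by (intro AE_I2 tendsto_intros isCont_tendsto_compose[OF isCont_satur(2)] nz wlim dlim)
      show "AE x in lborel. norm (dsatur a (w n x) * d n x * \<phi> x) \<le> \<bar>(Df x \<bullet> i) * \<phi> x\<bar> + 4 * exp 1 * \<bar>f x * \<phi> x\<bar>" for n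
      proof (intro AE_I2)
        fix x
        have "\<bar>dsatur a (w n x)\<bar> \<le> 1" using dsatur_le_1[OF a w0[of n x]] dsatur_nonneg by simp
        then have "\<bar>dsatur a (w n x)\<bar> * \<bar>d n x\<bar> * \<bar>\<phi> x\<bar> \<le> 1 * (\<bar>Df x \<bullet> i\<bar> + 4 * exp 1 * f x) * \<bar>\<phi> x\<bar>"
          by (intro mult_right_mono mult_mono dle) auto
        then show "norm (dsatur a (w n x) * d n x * \<phi> x) \<le> \<bar>(Df x \<bullet> i) * \<phi> x\<bar> + 4 * exp 1 * \<bar>f x * \<phi> x\<bar>"
          using f0[of x] by (simp add: abs_mult algebra_simps)
      qed
      show "integrable lborel (\<lambda>x. \<bar>(Df x \<bullet> i) * \<phi> x\<bar> + 4 * exp 1 * \<bar>f x * \<phi> x\<bar>)" using i2 i3 by auto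
    qed auto
    have "(\<integral>x. satur a (f x) * partial_deriv i \<phi> x \<partial>lborel) = - (\<integral>x. dsatur a (f x) * (Df x \<bullet> i) * \<phi> x \<partial>lborel)"
      by (rule LIMSEQ_unique[OF L[unfolded chain] tendsto_minus[OF Rr]])
    then show ?thesis by simp
  qed
  then show ?thesis using l1 l2 by (simp add: has_weak_gradient_def)
qed

text \<open>Letting the saturation level tend to 0 in the chain rule shows that the gradient contributes
  nothing on the zero set.\<close>

lemma weak_gradient_positive_part:
  fixes f :: "'a::euclidean_space \<Rightarrow> real"
  assumes wg: "has_weak_gradient f Df" and f0: "\<And>x. f x \<ge> 0"
  shows "has_weak_gradient f (\<lambda>x. if f x > 0 then Df x else 0)"
proof -
  have lf: "locally_integrable f" and lD: "locally_integrable Df" using wg by (auto simp: has_weak_gradient_def)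
  have [measurable]: "f \<in> borel_measurable borel" "Df \<in> borel_measurable borel"
    by (rule locally_integrable_measurable lf lD)+
  have l2: "locally_integrable (\<lambda>x. if f x > 0 then Df x else 0)"
    by (rule locally_integrable_dominated[OF lD]) auto
  have "(\<integral>x. f x * partial_deriv i \<phi> x \<partial>lborel) = - (\<integral>x. ((if f x > 0 then Df x else 0) \<bullet> i) * \<phi> x \<partial>lborel)"
    if phi: "test_function \<phi>" and i: "i \<in> Basis" for \<phi> i
  proof -
    have sphi: "smooth \<phi>" using phi by (simp add: test_function_def)
    obtain R where R: "\<And>x. norm x > R \<Longrightarrow> \<phi> x = 0" "\<And>x. norm x > R \<Longrightarrow> partial_deriv i \<phi> x = 0"
      using test_function_support[OF phi] by metis
    have cphi: "continuous_on UNIV \<phi>" "continuous_on UNIV (partial_deriv i \<phi>)"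
      by (rule smooth_continuous[OF sphi] smooth_partial_continuous[OF sphi i])+
    have [measurable]: "\<phi> \<in> borel_measurable borel" "partial_deriv i \<phi> \<in> borel_measurable borel"
      using cphi by (auto intro: borel_measurable_continuous_onI)
    note lDi = locally_integrable_inner[OF lD i]
    have i1: "integrable lborel (\<lambda>x. f x * partial_deriv i \<phi> x)" by (rule locally_integrable_mult[OF lf cphi(2) R(2)])
    have i3: "integrable lborel (\<lambda>x. (Df x \<bullet> i) * \<phi> x)" by (rule locally_integrable_mult[OF lDi cphi(1) R(1)])
    define a where "a n = inverse (real (Suc n))" for n
    have a: "a n > 0" for n by (simp add: a_def)
    have alim: "a \<longlonglongrightarrow> 0" unfolding a_def[abs_def] by (rule LIMSEQ_inverse_real_of_nat)
    have eq: "(\<integral>x. satur (a n) (f x) * partial_deriv i \<phi> x \<partial>lborel) = - (\<integral>x. dsatur (a n) (f x) * (Df x \<bullet> i) * \<phi> x \<partial>lborel)" for n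
      using weak_gradient_satur[OF a wg f0] phi i by (simp add: has_weak_gradient_def)
    have sl: "(\<lambda>n. satur (a n) (f x)) \<longlonglongrightarrow> 0" for x
    proof (rule Lim_null_comparison[OF _ alim])
      show "\<forall>\<^sub>F n in sequentially. norm (satur (a n) (f x)) \<le> a n"
        using satur_nonneg[OF a f0] satur_le_bound[OF a f0] by (intro always_eventually allI) simp
    qed
    \<comment> \<open>In the limit the derivative of the saturation becomes the indicator of the
      zero set of f, while the saturated function itself tends to 0.\<close>
    have dl: "(\<lambda>n. dsatur (a n) (f x)) \<longlonglongrightarrow> (if f x > 0 then 0 else 1)" for x
    proof (cases "f x > 0")
      case True
      have "(\<lambda>n. (a n / (a n + f x))\<^sup>2) \<longlonglongrightarrow> (0 / (0 + f x))\<^sup>2"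
        using True by (intro tendsto_intros alim) auto
      then show ?thesis using True by (simp add: dsatur_def)
    next
      case False
      then have "f x = 0" using f0[of x] by simp
      then have "dsatur (a n) (f x) = 1" for n using a[of n] by (simp add: dsatur_def)
      then show ?thesis using False by simp
    qed
    have "(\<lambda>n. \<integral>x. satur (a n) (f x) * partial_deriv i \<phi> x \<partial>lborel) \<longlonglongrightarrow> (\<integral>x. (0::real) \<partial>(lborel::'a measure))"
    proof (rule integral_dominated_convergence[where w="\<lambda>x. \<bar>f x * partial_deriv i \<phi> x\<bar>"])
      show "AE x in lborel. (\<lambda>n. satur (a n) (f x) * partial_deriv i \<phi> x) \<longlonglongrightarrow> 0"
        using tendsto_mult_right[OF sl] by (intro AE_I2 tendsto_mult_left_zero sl)
      show "AE x in lborel. norm (satur (a n) (f x) * partial_deriv i \<phi> x) \<le> \<bar>f x * partial_deriv i \<phi> x\<bar>" for n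
        using satur_nonneg[OF a f0] satur_le[OF a f0] f0 by (intro AE_I2) (simp add: abs_mult mult_right_mono)
      show "integrable lborel (\<lambda>x. \<bar>f x * partial_deriv i \<phi> x\<bar>)" using i1 by auto
    qed auto
    then have L: "(\<lambda>n. \<integral>x. satur (a n) (f x) * partial_deriv i \<phi> x \<partial>lborel) \<longlonglongrightarrow> 0" by simp
    have Rr: "(\<lambda>n. \<integral>x. dsatur (a n) (f x) * (Df x \<bullet> i) * \<phi> x \<partial>lborel)
      \<longlonglongrightarrow> (\<integral>x. (if f x > 0 then 0 else 1) * (Df x \<bullet> i) * \<phi> x \<partial>lborel)"
    proof (rule integral_dominated_convergence[where w="\<lambda>x. \<bar>(Df x \<bullet> i) * \<phi> x\<bar>"])
      show "AE x in lborel. (\<lambda>n. dsatur (a n) (f x) * (Df x \<bullet> i) * \<phi> x) \<longlonglongrightarrow> (if f x > 0 then 0 else 1) * (Df x \<bullet> i) * \<phi> x"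
        by (intro AE_I2 tendsto_intros dl)
      show "AE x in lborel. norm (dsatur (a n) (f x) * (Df x \<bullet> i) * \<phi> x) \<le> \<bar>(Df x \<bullet> i) * \<phi> x\<bar>" for n
        using dsatur_le_1[OF a f0] dsatur_nonneg by (intro AE_I2) (simp add: abs_mult mult.assoc mult_left_le_one_le)
      show "integrable lborel (\<lambda>x. \<bar>(Df x \<bullet> i) * \<phi> x\<bar>)" using i3 by auto
    qed auto
    \<comment> \<open>The part of the gradient living on the zero set pairs to 0 with the test
      function, so it may be replaced by 0 there.\<close>
    have Z: "0 = - (\<integral>x. (if f x > 0 then 0 else 1) * (Df x \<bullet> i) * \<phi> x \<partial>lborel)"
      by (rule LIMSEQ_unique[OF L[unfolded eq] tendsto_minus[OF Rr]])
    have iz: "integrable lborel (\<lambda>x. (if f x > 0 then 0 else 1) * ((Df x \<bullet> i) * \<phi> x))"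
      by (rule integrable_mult_bounded[OF i3, where B=1]) auto
    have "(\<integral>x. ((if f x > 0 then Df x else 0) \<bullet> i) * \<phi> x \<partial>lborel)
      = (\<integral>x. (Df x \<bullet> i) * \<phi> x - (if f x > 0 then 0 else 1) * ((Df x \<bullet> i) * \<phi> x) \<partial>lborel)"
      by (intro Bochner_Integration.integral_cong) auto
    also have "\<dots> = (\<integral>x. (Df x \<bullet> i) * \<phi> x \<partial>lborel)" using i3 iz Z by (simp add: mult.assoc)
    finally show ?thesis using wg phi i by (simp add: has_weak_gradient_def)
  qed
  then show ?thesis using lf l2 by (simp add: has_weak_gradient_def)
qed

section \<open>De Bruijn's identity\<close>

lemma frechet_derivative_sum:
  fixes g :: "'a::euclidean_space \<Rightarrow> real"
  assumes "g differentiable_on UNIV"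
  shows "frechet_derivative g (at x) h = (\<Sum>i\<in>Basis. (h \<bullet> i) * partial_deriv i g x)"
proof -
  have lin: "linear (frechet_derivative g (at x))"
    by (rule has_derivative_linear[OF differentiable_has_partial[OF assms]])
  have "frechet_derivative g (at x) h = frechet_derivative g (at x) (\<Sum>i\<in>Basis. (h \<bullet> i) *\<^sub>R i)"
    by (simp add: euclidean_representation)
  also have "\<dots> = (\<Sum>i\<in>Basis. (h \<bullet> i) * partial_deriv i g x)"
    by (simp add: linear_sum[OF lin] linear_scale[OF lin] partial_deriv_def)
  finally show ?thesis .
qed

lemma bounded_partial_lipschitz:
  fixes g :: "'a::euclidean_space \<Rightarrow> real"
  assumes g: "g differentiable_on UNIV" and B: "\<And>i x. i \<in> Basis \<Longrightarrow> \<bar>partial_deriv i g x\<bar> \<le> B" and B0: "B \<ge> 0"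
  shows "\<bar>g y - g x\<bar> \<le> real DIM('a) * B * norm (y - x)"
proof -
  define h where "h = y - x"
  have "norm (g (x + 1 *\<^sub>R h) - g (x + 0 *\<^sub>R h)) \<le> real DIM('a) * B * norm h * norm (1 - 0 :: real)"
  proof (rule field_differentiable_bound[where S=UNIV and f'="\<lambda>s. frechet_derivative g (at (x + s *\<^sub>R h)) h"])
    fix s :: real
    show "((\<lambda>s. g (x + s *\<^sub>R h)) has_field_derivative frechet_derivative g (at (x + s *\<^sub>R h)) h) (at s)"
      by (rule has_derivative_along[OF differentiable_has_partial[OF g]])
    have "\<bar>frechet_derivative g (at (x + s *\<^sub>R h)) h\<bar> \<le> (\<Sum>i\<in>(Basis::'a set). norm h * B)"
      unfolding frechet_derivative_sum[OF g]
      by (rule order_trans[OF sum_abs], rule sum_mono)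
        (use B Basis_le_norm in \<open>auto simp: abs_mult intro!: mult_mono\<close>)
    then show "norm (frechet_derivative g (at (x + s *\<^sub>R h)) h) \<le> real DIM('a) * B * norm h" by (simp add: mult_ac)
  qed auto
  then show ?thesis by (simp add: h_def)
qed

text \<open>Classical integration by parts. It brings continuously differentiable functions under
  the commutation of the flow with weak gradients.\<close>

lemma weak_gradient_of_derivative:
  fixes u :: "'a::euclidean_space \<Rightarrow> real"
  assumes u: "u differentiable_on UNIV" and cu: "\<And>i. i \<in> Basis \<Longrightarrow> continuous_on UNIV (partial_deriv i u)"
  shows "has_weak_gradient u (grad u)"
proof -
  have cont: "continuous_on UNIV u" using u by (rule differentiable_imp_continuous_on)
  have cg: "continuous_on UNIV (grad u)"
    unfolding grad_def[abs_def] by (intro continuous_intros cu)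
  have loc: "locally_integrable v" if "continuous_on UNIV v" for v :: "'a \<Rightarrow> 'b::euclidean_space"
    unfolding locally_integrable_def set_integrable_def
    by (intro allI impI borel_integrable_compact continuous_on_subset[OF that subset_UNIV])
  have "(\<integral>x. u x * partial_deriv i \<phi> x \<partial>lborel) = - (\<integral>x. (grad u x \<bullet> i) * \<phi> x \<partial>lborel)"
    if phi: "test_function \<phi>" and i: "i \<in> Basis" for \<phi> i
  proof -
    have sphi: "smooth \<phi>" using phi by (simp add: test_function_def)
    obtain R where R: "\<And>x. norm x > R \<Longrightarrow> \<phi> x = 0" "\<And>x. norm x > R \<Longrightarrow> partial_deriv i \<phi> x = 0"
      using test_function_support[OF phi] by metis
    have cphi: "continuous_on UNIV \<phi>" "continuous_on UNIV (partial_deriv i \<phi>)"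
      by (rule smooth_continuous[OF sphi] smooth_partial_continuous[OF sphi i])+
    have c1: "continuous_on UNIV (\<lambda>x. u x * partial_deriv i \<phi> x)" "continuous_on UNIV (\<lambda>x. partial_deriv i u x * \<phi> x)"
      by (intro continuous_on_mult cont cphi cu i)+
    have "(\<integral>x. u x * partial_deriv i \<phi> x + partial_deriv i u x * \<phi> x \<partial>lborel) = 0"
      using integral_derivative_compact_support[OF has_derivative_mult[OF differentiable_has_partial[OF u] smooth_has_derivative[OF sphi]] _ _ i, of R]
        continuous_on_add[OF c1] R by (simp add: partial_deriv_def)
    moreover have "integrable lborel (\<lambda>x. u x * partial_deriv i \<phi> x)" "integrable lborel (\<lambda>x. partial_deriv i u x * \<phi> x)"
      by (rule integrable_lborel_compact_support[OF c1(1), of R] integrable_lborel_compact_support[OF c1(2), of R]; simp add: R)+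
    ultimately show ?thesis using i by (simp add: grad_inner)
  qed
  then show ?thesis using loc[OF cont] loc[OF cg] by (simp add: has_weak_gradient_def)
qed

lemma integrable_gauss_kernel_iff:
  assumes [measurable]: "v \<in> borel_measurable borel"
  shows "integrable lborel (\<lambda>y. v y * gauss_kernel c x y) \<longleftrightarrow> integrable std_gaussian (\<lambda>y. mehler c x y * v y)"
  by (subst integrable_std_gaussian_iff) (auto simp: gauss_kernel_def mult_ac)

text \<open>The kernel has no compact support, so the weak formulation enters through
  \<open>weak_gradient_by_parts\<close>. Integrability against the derivative of the kernel is the
  one already obtained when differentiating the flow.\<close>

lemma partial_deriv_ou_weak_gradient:
  fixes h :: "'a::euclidean_space \<Rightarrow> real"
  assumes c: "0 < c" "c < 1" and wg: "has_weak_gradient h W" and i: "i \<in> Basis"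
    and h: "integrable std_gaussian h" and W: "integrable std_gaussian (\<lambda>x. W x \<bullet> i)"
  shows "partial_deriv i (ou c h) x = c * ou c (\<lambda>x. W x \<bullet> i) x"
proof (rule partial_deriv_ou_weak[OF c h W i])
  have c': "0 \<le> c" "c < 1" using c by auto
  have s: "csn c > 0" using csn_pos c by auto
  have [measurable]: "h \<in> borel_measurable borel" "(\<lambda>x. W x \<bullet> i) \<in> borel_measurable borel"
    using h W by auto
  have "integrable lborel (\<lambda>y. ((y - c *\<^sub>R x) \<bullet> i / csn c * h y) * gauss_kernel c x y)"
    by (subst integrable_gauss_kernel_iff) (use partial_deriv_ou_mehler(1)[OF c h i, of x] in auto)
  then have "integrable lborel (\<lambda>y. (- 1 / csn c) * (((y - c *\<^sub>R x) \<bullet> i / csn c * h y) * gauss_kernel c x y))"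
    by (rule integrable_mult_right)
  also have "(\<lambda>y. (- 1 / csn c) * (((y - c *\<^sub>R x) \<bullet> i / csn c * h y) * gauss_kernel c x y))
     = (\<lambda>y. h y * partial_deriv i (gauss_kernel c x) y)"
    using s by (intro ext) (simp add: partial_deriv_gauss_kernel[OF c'] power2_eq_square)
  finally have 1: "integrable lborel (\<lambda>y. h y * partial_deriv i (gauss_kernel c x) y)" .
  show "(\<integral>y. h y * partial_deriv i (gauss_kernel c x) y \<partial>lborel) = - (\<integral>y. (W y \<bullet> i) * gauss_kernel c x y \<partial>lborel)"
    by (rule weak_gradient_by_parts[OF wg smooth_gauss_kernel[OF c'] i 1])
       (simp_all add: integrable_gauss_kernel_iff integrable_mehler[OF c'] h W)
qed

lemma csn_has_derivative:
  assumes "0 < c" "c < 1"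
  shows "(csn has_real_derivative - c / csn c) (at c)"
proof -
  have "c\<^sup>2 < 1" using assms by (simp add: power_less_one_iff abs_square_less_1)
  then show ?thesis
    unfolding csn_def[abs_def] by (auto intro!: derivative_eq_intros simp: field_simps)
qed

text \<open>The derivative of \<open>csn\<close> blows up at 1; the midpoint b = (1 + c) / 2 keeps
  the window at a positive distance from it.\<close>

lemma csn_lipschitz:
  assumes c: "0 < c" "c < 1"
  obtains K where "K \<ge> 0" "\<And>t. \<bar>t - c\<bar> < min c (1 - c) / 2 \<Longrightarrow> \<bar>csn t - csn c\<bar> \<le> K * \<bar>t - c\<bar>"
proof -
  define b where "b = (1 + c) / 2"
  have b: "0 < b" "b < 1" using c by (auto simp: b_def)
  have sb: "csn b > 0" using csn_pos b by auto
  have "\<bar>csn t - csn c\<bar> \<le> 1 / csn b * \<bar>t - c\<bar>" if t: "\<bar>t - c\<bar> < min c (1 - c) / 2" for t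
  proof -
    have "norm (csn t - csn c) \<le> 1 / csn b * norm (t - c)"
    proof (rule field_differentiable_bound[where f=csn and S="{0<..<b}" and f'="\<lambda>t. - t / csn t"])
      fix s assume s: "s \<in> {0<..<b}"
      show "(csn has_field_derivative - s / csn s) (at s within {0<..<b})"
        by (rule has_field_derivative_at_within, rule csn_has_derivative) (use s b in auto)
      have "s\<^sup>2 \<le> b\<^sup>2" using s by (intro power_mono) auto
      then have cb: "csn b \<le> csn s" unfolding csn_def by simp
      have "s / csn s \<le> 1 / csn b" by (rule frac_le) (use s b sb cb in auto)
      moreover have "norm (- s / csn s) = s / csn s" using s sb cb by simp
      ultimately show "norm (- s / csn s) \<le> 1 / csn b" by simp
    next
      have "\<bar>t - c\<bar> < c / 2" "\<bar>t - c\<bar> < (1 - c) / 2" using t by auto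
      moreover have "c - t \<le> \<bar>t - c\<bar>" "t - c \<le> \<bar>t - c\<bar>" by auto
      ultimately have "c - t < c / 2" "t - c < (1 - c) / 2" by linarith+
      then have "0 < t" "t < b" unfolding b_def diff_divide_distrib add_divide_distrib using c by linarith+
      then show "t \<in> {0<..<b}" by simp
      show "c \<in> {0<..<b}" using c by (simp add: b_def)
    qed auto
    then show ?thesis by simp
  qed
  then show ?thesis using that[of "1 / csn b"] sb by auto
qed

text \<open>The moving point c x + \<open>csn c\<close> z has velocity x - (c /
  \<open>csn c\<close>) z, so for Lipschitz g the difference quotients grow at most linearly in x
  and z, which the Gaussian measure integrates.\<close>

lemma ou_has_derivative_time:
  fixes g :: "'a::euclidean_space \<Rightarrow> real"
  assumes c: "0 < c" "c < 1" and g: "g differentiable_on UNIV"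
    and cg: "\<And>i. i \<in> Basis \<Longrightarrow> continuous_on UNIV (partial_deriv i g)"
    and B: "\<And>i x. i \<in> Basis \<Longrightarrow> \<bar>partial_deriv i g x\<bar> \<le> B" and B0: "B \<ge> 0"
    and bd: "\<And>x. \<bar>g x\<bar> \<le> M"
  obtains L \<delta> where "L \<ge> 0" "\<delta> > 0" "\<And>x t. \<bar>t - c\<bar> < \<delta> \<Longrightarrow> \<bar>ou t g x - ou c g x\<bar> \<le> L * (norm x + 1) * \<bar>t - c\<bar>"
    "\<And>x. ((\<lambda>t. ou t g x) has_real_derivative
        (\<integral>z. (\<Sum>i\<in>Basis. ((x - (c / csn c) *\<^sub>R z) \<bullet> i) * partial_deriv i g (c *\<^sub>R x + csn c *\<^sub>R z)) \<partial>std_gaussian)) (at c)"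
proof -
  have contg: "continuous_on UNIV g" using g by (rule differentiable_imp_continuous_on)
  have [measurable]: "g \<in> borel_measurable borel" by (rule borel_measurable_continuous_onI[OF contg])
  have [measurable]: "\<And>i. i \<in> Basis \<Longrightarrow> partial_deriv i g \<in> borel_measurable borel"
    by (rule borel_measurable_continuous_onI[OF cg])
  obtain K where K: "K \<ge> 0" "\<And>t. \<bar>t - c\<bar> < min c (1 - c) / 2 \<Longrightarrow> \<bar>csn t - csn c\<bar> \<le> K * \<bar>t - c\<bar>"
    using csn_lipschitz[OF c] by blast
  define \<delta> where "\<delta> = min c (1 - c) / 2"
  have d: "\<delta> > 0" using c by (simp add: \<delta>_def)
  define D where "D = real DIM('a) * B"
  have D0: "D \<ge> 0" using B0 by (simp add: D_def)
  have lip: "\<bar>g (t *\<^sub>R x + csn t *\<^sub>R z) - g (c *\<^sub>R x + csn c *\<^sub>R z)\<bar> \<le> D * (norm x + K * norm z) * \<bar>t - c\<bar>"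
    if t: "\<bar>t - c\<bar> < \<delta>" for t x z
  proof -
    have eq: "(t *\<^sub>R x + csn t *\<^sub>R z) - (c *\<^sub>R x + csn c *\<^sub>R z) = (t - c) *\<^sub>R x + (csn t - csn c) *\<^sub>R z"
      by (simp add: algebra_simps)
    have "\<bar>g (t *\<^sub>R x + csn t *\<^sub>R z) - g (c *\<^sub>R x + csn c *\<^sub>R z)\<bar> \<le> D * norm ((t *\<^sub>R x + csn t *\<^sub>R z) - (c *\<^sub>R x + csn c *\<^sub>R z))"
      unfolding D_def by (rule bounded_partial_lipschitz[OF g B B0])
    also have "\<dots> \<le> D * (\<bar>t - c\<bar> * norm x + (K * \<bar>t - c\<bar>) * norm z)"
      using D0 K(2)[of t] t unfolding \<delta>_def eq
      by (intro mult_left_mono order_trans[OF norm_triangle_ineq] add_mono) (auto intro: mult_right_mono)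
    finally show ?thesis by (simp add: algebra_simps)
  qed
  have int: "integrable std_gaussian (\<lambda>z. g (t *\<^sub>R x + csn t *\<^sub>R z))" for t x
    by (rule integrable_bounded[where B=M]) (use bd in auto)
  define E where "E = (\<integral>z. norm z \<partial>(std_gaussian::'a measure))"
  have E0: "E \<ge> 0" by (simp add: E_def)
  have iw: "integrable std_gaussian (\<lambda>z::'a. D * (norm x + K * norm z))" for x :: 'a
    using integrable_gauss_norm[where 'a='a] by auto
  have "\<bar>ou t g x - ou c g x\<bar> \<le> (D * (1 + K * E)) * (norm x + 1) * \<bar>t - c\<bar>" if t: "\<bar>t - c\<bar> < \<delta>" for t x
  proof -
    have eq: "ou t g x - ou c g x = (\<integral>z. g (t *\<^sub>R x + csn t *\<^sub>R z) - g (c *\<^sub>R x + csn c *\<^sub>R z) \<partial>std_gaussian)"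
      unfolding ou_def using int by simp
    have "\<bar>ou t g x - ou c g x\<bar> \<le> (\<integral>z. D * (norm x + K * norm z) * \<bar>t - c\<bar> \<partial>(std_gaussian::'a measure))"
      unfolding eq
    proof (rule Bochner_Integration.integral_abs_bound_integral)
      show "integrable std_gaussian (\<lambda>z::'a. D * (norm x + K * norm z) * \<bar>t - c\<bar>)"
        by (rule integrable_mult_left[OF iw])
    qed (use int lip[OF t] in auto)
    also have "\<dots> = D * (norm x + K * E) * \<bar>t - c\<bar>"
      using integrable_gauss_norm[where 'a='a] by (simp add: E_def)
    also have "\<dots> \<le> (D * ((1 + K * E) * (norm x + 1))) * \<bar>t - c\<bar>"
    proof -
      have "norm x + K * E \<le> (1 + K * E) * (norm x + 1)"
        using K(1) E0 by (simp add: algebra_simps)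
      then show ?thesis using D0 by (intro mult_right_mono mult_left_mono) auto
    qed
    finally show ?thesis by (simp add: mult_ac)
  qed
  moreover have "D * (1 + K * E) \<ge> 0" using D0 K(1) E0 by simp
  moreover have "((\<lambda>t. ou t g x) has_real_derivative
        (\<integral>z. (\<Sum>i\<in>Basis. ((x - (c / csn c) *\<^sub>R z) \<bullet> i) * partial_deriv i g (c *\<^sub>R x + csn c *\<^sub>R z)) \<partial>std_gaussian)) (at c)" for x
    unfolding ou_def
  proof (rule has_real_derivative_integral(1)[OF d int _ lip iw])
    fix z :: 'a
    have "((\<lambda>t. t *\<^sub>R x + csn t *\<^sub>R z) has_derivative (\<lambda>h. h *\<^sub>R x + ((- c / csn c) * h) *\<^sub>R z)) (at c)"
      using csn_has_derivative[OF c] unfolding has_field_derivative_def by (auto intro!: derivative_eq_intros)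
    from has_derivative_compose[OF this differentiable_has_partial[OF g]]
    have "((\<lambda>t. g (t *\<^sub>R x + csn t *\<^sub>R z)) has_derivative
       (\<lambda>h. frechet_derivative g (at (c *\<^sub>R x + csn c *\<^sub>R z)) (h *\<^sub>R x + ((- c / csn c) * h) *\<^sub>R z))) (at c)" .
    moreover have "frechet_derivative g (at y) (h *\<^sub>R x + ((- c / csn c) * h) *\<^sub>R z)
      = (\<Sum>i\<in>Basis. ((x - (c / csn c) *\<^sub>R z) \<bullet> i) * partial_deriv i g y) * h" for y h
      unfolding frechet_derivative_sum[OF g] sum_distrib_right
      by (rule sum.cong) (simp_all add: inner_add_left inner_diff_left algebra_simps)
    ultimately show "((\<lambda>t. g (t *\<^sub>R x + csn t *\<^sub>R z)) has_real_derivative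
       (\<Sum>i\<in>Basis. ((x - (c / csn c) *\<^sub>R z) \<bullet> i) * partial_deriv i g (c *\<^sub>R x + csn c *\<^sub>R z))) (at c)"
      by (simp add: has_field_derivative_def)
  next
    show "(\<lambda>z. \<Sum>i\<in>Basis. ((x - (c / csn c) *\<^sub>R z) \<bullet> i) * partial_deriv i g (c *\<^sub>R x + csn c *\<^sub>R z)) \<in> borel_measurable std_gaussian"
      by measurable
  qed
  ultimately show ?thesis using that[OF _ d] by blast
qed

section \<open>Entropy along the flow\<close>

definition xlnx :: "real \<Rightarrow> real" where "xlnx u = u * ln u"

lemma xlnx_measurable [measurable]: "xlnx \<in> borel_measurable borel"
  unfolding xlnx_def[abs_def] by measurable

lemma xlnx_has_derivative: "u > 0 \<Longrightarrow> (xlnx has_real_derivative (ln u + 1)) (at u)"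
  unfolding xlnx_def[abs_def] by (auto intro!: derivative_eq_intros)

lemma abs_ln_le: "0 < \<epsilon> \<Longrightarrow> \<epsilon> \<le> u \<Longrightarrow> u \<le> M \<Longrightarrow> \<bar>ln u\<bar> \<le> \<bar>ln \<epsilon>\<bar> + \<bar>ln M\<bar>" for u :: real
  using ln_mono[of \<epsilon> u] ln_mono[of u M] by linarith

lemma xlnx_lipschitz:
  assumes "\<epsilon> > 0" "\<epsilon> \<le> u" "u \<le> M" "\<epsilon> \<le> v" "v \<le> M"
  shows "\<bar>xlnx u - xlnx v\<bar> \<le> (\<bar>ln \<epsilon>\<bar> + \<bar>ln M\<bar> + 1) * \<bar>u - v\<bar>"
proof -
  have "norm (xlnx u - xlnx v) \<le> (\<bar>ln \<epsilon>\<bar> + \<bar>ln M\<bar> + 1) * norm (u - v)"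
  proof (rule field_differentiable_bound[where f=xlnx and S="{\<epsilon>..M}" and f'="\<lambda>u. ln u + 1"])
    fix s assume s: "s \<in> {\<epsilon>..M}"
    then have "s > 0" using assms(1) by simp
    then show "(xlnx has_field_derivative ln s + 1) (at s within {\<epsilon>..M})"
      by (rule has_field_derivative_at_within[OF xlnx_has_derivative])
    show "norm (ln s + 1) \<le> \<bar>ln \<epsilon>\<bar> + \<bar>ln M\<bar> + 1"
      using abs_ln_le[of \<epsilon> s M] assms(1) s by auto
  qed (use assms in auto)
  then show ?thesis by simp
qed

lemma ou_between:
  fixes v :: "'a::euclidean_space \<Rightarrow> real"
  assumes [measurable]: "v \<in> borel_measurable borel" and v: "\<And>x. \<epsilon> \<le> v x" "\<And>x. v x \<le> M"
  shows "\<epsilon> \<le> ou c v x" "ou c v x \<le> M"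
proof -
  have "\<bar>v x\<bar> \<le> \<bar>\<epsilon>\<bar> + \<bar>M\<bar>" for x using v(1)[of x] v(2)[of x] by linarith
  then have i: "integrable std_gaussian (\<lambda>z. v (c *\<^sub>R x + csn c *\<^sub>R z))"
    by (intro integrable_bounded) auto
  have "(\<integral>z. \<epsilon> \<partial>(std_gaussian::'a measure)) \<le> ou c v x" "ou c v x \<le> (\<integral>z. M \<partial>(std_gaussian::'a measure))"
    unfolding ou_def by (intro integral_mono i v; simp)+
  then show "\<epsilon> \<le> ou c v x" "ou c v x \<le> M" by simp_all
qed

lemma integrable_gauss2_snd_rot:
  fixes i :: "'a::euclidean_space"
  assumes c: "0 \<le> c" "c < 1"
  shows "integrable gauss2 (\<lambda>p. snd (rot c p) \<bullet> i)"
proof -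
  \<comment> \<open>The second coordinate is the linear combination with parameter 0, since
    \<open>csn 0 = 1\<close>.\<close>
  have "integrable gauss2 (\<lambda>p. (0 *\<^sub>R fst p + csn 0 *\<^sub>R snd p) \<bullet> i)"
    by (rule integrable_gauss2_comb) (auto simp: integrable_gauss_inner)
  then have "integrable gauss2 (\<lambda>p. snd p \<bullet> i)" by (simp add: csn_def)
  then show ?thesis by (subst integrable_gauss2_rot[OF c, of "\<lambda>p. snd p \<bullet> i"]) auto
qed

text \<open>De Bruijn's identity for a regular density, in the parameter \<open>c = exp (- t)\<close>. The rotation
  turns the time derivative into a Gaussian integration by parts in the second variable.\<close>

lemma entropy_derivative_smooth:
  fixes g :: "'a::euclidean_space \<Rightarrow> real"
  assumes c: "0 < c" "c < 1" and g: "smooth g"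
    and B: "\<And>i x. i \<in> Basis \<Longrightarrow> \<bar>partial_deriv i g x\<bar> \<le> B" and B0: "B \<ge> 0"
    and eps: "\<epsilon> > 0" and g1: "\<And>x. \<epsilon> \<le> g x" and g2: "\<And>x. g x \<le> M"
  shows "((\<lambda>t. \<integral>x. xlnx (ou t g x) \<partial>std_gaussian) has_real_derivative
    c * (\<Sum>i\<in>Basis. \<integral>x. (ou c (partial_deriv i g) x)\<^sup>2 / ou c g x \<partial>std_gaussian)) (at c)"
proof -
  note dg = smooth_differentiable[OF g] and cg = smooth_partial_continuous[OF g]
  have c': "0 \<le> c" "c < 1" using c by auto
  have s: "csn c > 0" using csn_pos[OF c'] .
  have gm[measurable]: "g \<in> borel_measurable borel" by (rule borel_measurable_continuous_onI[OF smooth_continuous[OF g]])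
  have dgm[measurable]: "\<And>i. i \<in> Basis \<Longrightarrow> partial_deriv i g \<in> borel_measurable borel"
    by (rule borel_measurable_continuous_onI[OF cg])
  have gM: "\<bar>g x\<bar> \<le> M" for x using eps g1[of x] g2[of x] by simp
  have M: "\<epsilon> \<le> M" using g1[of 0] g2[of 0] by linarith
  have ig: "integrable std_gaussian g" by (rule integrable_bounded[OF gm gM])
  have idg: "integrable std_gaussian (partial_deriv i g)" if "i \<in> Basis" for i
    by (rule integrable_bounded[OF dgm[OF that] B[OF that]])
  note ob = ou_between[OF gm g1 g2]
  define D where "D x = (\<integral>z. (\<Sum>i\<in>Basis. ((x - (c / csn c) *\<^sub>R z) \<bullet> i) * partial_deriv i g (c *\<^sub>R x + csn c *\<^sub>R z)) \<partial>std_gaussian)" for x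
  have Dm[measurable]: "D \<in> borel_measurable borel" unfolding D_def by measurable
  obtain L \<delta> where L: "L \<ge> 0" "\<delta> > 0"
    and lip: "\<And>x t. \<bar>t - c\<bar> < \<delta> \<Longrightarrow> \<bar>ou t g x - ou c g x\<bar> \<le> L * (norm x + 1) * \<bar>t - c\<bar>"
    and dt: "\<And>x. ((\<lambda>t. ou t g x) has_real_derivative D x) (at c)"
    using ou_has_derivative_time[OF c dg cg B B0 gM] unfolding D_def by blast
  define Q where "Q = \<bar>ln \<epsilon>\<bar> + \<bar>ln M\<bar> + 1"
  have Q: "Q \<ge> 0" by (simp add: Q_def)
  \<comment> \<open>The derivative of \<open>xlnx\<close> at the flowed density. The constant 1 is
    harmless, as only the gradient of u enters the result.\<close>
  define u where "u x = ln (ou c g x) + 1" for x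
  have um[measurable]: "u \<in> borel_measurable borel" unfolding u_def[abs_def] by measurable
  have ub: "\<bar>u x\<bar> \<le> Q" for x
    using abs_ln_le[OF eps ob(1)[of c x] ob(2)[of c x]] by (simp add: u_def Q_def)
  have pos: "ou c g x > 0" for x using eps ob(1)[of c x] by linarith
  have "((\<lambda>t. \<integral>x. xlnx (ou t g x) \<partial>std_gaussian) has_real_derivative (\<integral>x. u x * D x \<partial>std_gaussian)) (at c)"
  proof (rule has_real_derivative_integral(1)[OF L(2), where w="\<lambda>x. Q * (L * (norm x + 1))"])
    show "integrable std_gaussian (\<lambda>x. xlnx (ou t g x))" for t
    proof (rule integrable_bounded)
      show "\<bar>xlnx (ou t g x)\<bar> \<le> M * Q" for x
        unfolding xlnx_def abs_mult using abs_ln_le[OF eps ob(1)[of t x] ob(2)[of t x]] eps ob(1)[of t x] ob(2)[of t x]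
        by (intro mult_mono) (auto simp: Q_def)
    qed simp
    show "((\<lambda>t. xlnx (ou t g x)) has_real_derivative u x * D x) (at c)" for x
      unfolding u_def by (rule DERIV_chain2[OF xlnx_has_derivative[OF pos] dt])
    show "\<bar>xlnx (ou t g x) - xlnx (ou c g x)\<bar> \<le> Q * (L * (norm x + 1)) * \<bar>t - c\<bar>" if t: "\<bar>t - c\<bar> < \<delta>" for t x
    proof -
      have "\<bar>xlnx (ou t g x) - xlnx (ou c g x)\<bar> \<le> Q * \<bar>ou t g x - ou c g x\<bar>"
        unfolding Q_def by (rule xlnx_lipschitz[OF eps ob ob])
      also have "\<dots> \<le> Q * (L * (norm x + 1) * \<bar>t - c\<bar>)" using Q lip[OF t] by (intro mult_left_mono) auto
      finally show ?thesis by (simp add: mult_ac)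
    qed
    show "integrable std_gaussian (\<lambda>x::'a. Q * (L * (norm x + 1)))"
      using integrable_gauss_norm[where 'a='a] by auto
  qed simp
  moreover have "(\<integral>x. u x * D x \<partial>std_gaussian) = c * (\<Sum>i\<in>Basis. \<integral>x. (ou c (partial_deriv i g) x)\<^sup>2 / ou c g x \<partial>std_gaussian)"
  proof -
    have su: "smooth (ou c g)" by (rule smooth_ou[OF c ig])
    have du: "(u has_derivative (\<lambda>h. frechet_derivative (ou c g) (at x) h / ou c g x)) (at x)" for x
    proof -
      have "((\<lambda>x. ln (ou c g x)) has_derivative (\<lambda>h. inverse (ou c g x) * frechet_derivative (ou c g) (at x) h)) (at x)"
        by (rule has_derivative_compose[OF smooth_has_derivative[OF su] DERIV_ln[OF pos, unfolded has_field_derivative_def]])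
      then show ?thesis unfolding u_def[abs_def]
        by (intro has_derivative_eq_rhs[OF has_derivative_add[OF _ has_derivative_const]]) (auto simp: divide_inverse mult.commute)
    qed
    have pdou: "partial_deriv i (ou c g) x = c * ou c (partial_deriv i g) x" if i: "i \<in> Basis" for i x
      using partial_deriv_ou_weak_gradient[OF c weak_gradient_of_derivative[OF dg cg] i ig] idg[OF i] i
      by (simp add: grad_inner)
    have pu: "partial_deriv i u x = c * ou c (partial_deriv i g) x / ou c g x" if i: "i \<in> Basis" for i x
      using partial_deriv_eqI[OF du, of i x] pdou[OF i, of x] by (simp add: partial_deriv_def)
    have diffu: "u differentiable_on UNIV" using du unfolding differentiable_on_def differentiable_def by blast
    have cou: "continuous_on UNIV (ou c g)" "i \<in> Basis \<Longrightarrow> continuous_on UNIV (partial_deriv i (ou c g))" for i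
      by (rule smooth_continuous[OF su], rule smooth_partial_continuous[OF su])
    have nz: "ou c g x \<noteq> 0" for x using pos[of x] by simp
    have contu: "continuous_on UNIV (partial_deriv i u)" if i: "i \<in> Basis" for i
    proof -
      have "partial_deriv i u = (\<lambda>x. partial_deriv i (ou c g) x / ou c g x)" using pu[OF i] pdou[OF i] by auto
      then show ?thesis using nz cou(1) cou(2)[OF i] by (auto intro: continuous_on_divide)
    qed
    have iu: "integrable std_gaussian u" by (rule integrable_bounded[OF um ub])
    have oub: "\<bar>ou c (partial_deriv i g) x\<bar> \<le> B" if i: "i \<in> Basis" for i x by (rule abs_ou_le[OF dgm[OF i] B[OF i]])
    have idu: "integrable std_gaussian (partial_deriv i u)" if i: "i \<in> Basis" for i
    proof (rule integrable_bounded)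
      show "partial_deriv i u \<in> borel_measurable borel" by (rule borel_measurable_continuous_onI[OF contu[OF i]])
      fix x
      have "\<bar>partial_deriv i u x\<bar> = c * \<bar>ou c (partial_deriv i g) x\<bar> / ou c g x"
        using c pos[of x] by (simp add: pu[OF i] abs_mult)
      also have "\<dots> \<le> (1 * B) / \<epsilon>"
        using c eps oub[OF i] ob(1) B0 by (intro frac_le mult_mono) auto
      finally show "\<bar>partial_deriv i u x\<bar> \<le> B / \<epsilon>" by simp
    qed
    define k where "k i p = u (fst p) * (partial_deriv i g (fst (rot c p)) * (snd (rot c p) \<bullet> i))" for i p
    have km[measurable]: "k i \<in> borel_measurable (borel \<Otimes>\<^sub>M borel)" if "i \<in> Basis" for i
      using dgm[OF that] unfolding k_def[abs_def] by measurable
    have ik: "integrable gauss2 (k i)" if i: "i \<in> Basis" for i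
    proof -
      have [measurable]: "partial_deriv i g \<in> borel_measurable borel" using dgm[OF i] .
      have "\<bar>u (fst p) * partial_deriv i g (fst (rot c p))\<bar> \<le> Q * B" for p
        unfolding abs_mult by (intro mult_mono ub B[OF i] Q) auto
      then have "integrable gauss2 (\<lambda>p. (u (fst p) * partial_deriv i g (fst (rot c p))) * (snd (rot c p) \<bullet> i))"
        by (intro integrable_mult_bounded integrable_gauss2_snd_rot c') auto
      then show ?thesis by (simp add: k_def[abs_def] mult.assoc)
    qed
    \<comment> \<open>The velocity x - (c / s) z is 1 / s times s x - c z, the second component of
      \<open>rot c (x, z)\<close>.\<close>
    have Dk: "u x * D x = (\<integral>z. 1 / csn c * (\<Sum>i\<in>Basis. k i (x, z)) \<partial>std_gaussian)" for x
    proof -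
      have "((x - (c / csn c) *\<^sub>R z) \<bullet> i) = 1 / csn c * (snd (rot c (x, z)) \<bullet> i)" for z i
        using s by (simp add: rot_def inner_diff_left field_simps)
      then show ?thesis unfolding D_def
        by (subst integral_mult_right_zero[symmetric])
           (intro Bochner_Integration.integral_cong refl, simp add: k_def rot_def sum_distrib_left mult_ac)
    qed
    have "(\<integral>x. u x * D x \<partial>std_gaussian) = (\<integral>p. 1 / csn c * (\<Sum>i\<in>Basis. k i p) \<partial>gauss2)"
      unfolding Dk
      by (subst std_gaussian_pair.integral_fst'[symmetric])
         (auto intro!: integrable_mult_right Bochner_Integration.integrable_sum ik simp del: times_divide_eq_left mult_1_left)
    also have "\<dots> = 1 / csn c * (\<Sum>i\<in>Basis. \<integral>p. k i p \<partial>gauss2)"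
      by (subst integral_mult_right_zero) (simp add: Bochner_Integration.integral_sum ik)
    also have "(\<Sum>i\<in>Basis. \<integral>p. k i p \<partial>gauss2)
      = (\<Sum>i\<in>Basis. csn c * (c * (\<integral>x. (ou c (partial_deriv i g) x)\<^sup>2 / ou c g x \<partial>std_gaussian)))"
    proof (rule sum.cong)
      fix i :: 'a assume i: "i \<in> Basis"
      have [measurable]: "partial_deriv i g \<in> borel_measurable borel" using dgm[OF i] .
      \<comment> \<open>After substituting \<open>rot c\<close> the second component becomes the
        bare noise coordinate, and u is evaluated at the argument of the flow.\<close>
      have "(\<integral>p. k i p \<partial>gauss2) = (\<integral>p. k i (rot c p) \<partial>gauss2)"
        by (rule integral_gauss2_rot[OF c' km[OF i], symmetric])
      also have "\<dots> = (\<integral>y. \<integral>w. partial_deriv i g y * ((w \<bullet> i) * u (c *\<^sub>R y + csn c *\<^sub>R w)) \<partial>std_gaussian \<partial>std_gaussian)"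
        using ik[OF i] integrable_gauss2_rot[OF c' km[OF i]] c'
        by (subst std_gaussian_pair.integral_fst'[symmetric])
           (auto simp: k_def rot_rot fst_rot mult_ac intro!: Bochner_Integration.integral_cong)
      also have "\<dots> = (\<integral>y. partial_deriv i g y * (csn c * ou c (partial_deriv i u) y) \<partial>std_gaussian)"
      proof (intro Bochner_Integration.integral_cong refl)
        fix y
        \<comment> \<open>Gaussian integration by parts, obtained by computing the derivative of
          \<open>ou c u\<close> in two ways, on the kernel and on u.\<close>
        have "c / csn c * (\<integral>w. (w \<bullet> i) * u (c *\<^sub>R y + csn c *\<^sub>R w) \<partial>std_gaussian) = partial_deriv i (ou c u) y"
          by (rule partial_deriv_ou(2)[OF c iu i, symmetric])
        also have "\<dots> = c * ou c (partial_deriv i u) y"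
          using partial_deriv_ou_weak_gradient[OF c weak_gradient_of_derivative[OF diffu contu] i iu] idu[OF i] i
          by (simp add: grad_inner)
        finally have "(\<integral>w. (w \<bullet> i) * u (c *\<^sub>R y + csn c *\<^sub>R w) \<partial>std_gaussian) = csn c * ou c (partial_deriv i u) y"
          using c s by (simp add: field_simps)
        then show "(\<integral>w. partial_deriv i g y * ((w \<bullet> i) * u (c *\<^sub>R y + csn c *\<^sub>R w)) \<partial>std_gaussian)
          = partial_deriv i g y * (csn c * ou c (partial_deriv i u) y)" by simp
      qed
      also have "\<dots> = csn c * (\<integral>y. partial_deriv i g y * ou c (partial_deriv i u) y \<partial>std_gaussian)"
        by (subst integral_mult_right_zero[symmetric]) (simp add: mult_ac)
      \<comment> \<open>Symmetry lets the flow act on the gradient of g; the gradient of u contains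
        the same flowed gradient, so a square forms.\<close>
      also have "(\<integral>y. partial_deriv i g y * ou c (partial_deriv i u) y \<partial>std_gaussian)
         = (\<integral>y. ou c (partial_deriv i g) y * partial_deriv i u y \<partial>std_gaussian)"
        by (rule ou_symmetric[OF c' idu[OF i] dgm[OF i] B[OF i]])
      also have "\<dots> = c * (\<integral>x. (ou c (partial_deriv i g) x)\<^sup>2 / ou c g x \<partial>std_gaussian)"
        by (subst integral_mult_right_zero[symmetric]) (simp add: pu[OF i] power2_eq_square mult_ac)
      finally show "(\<integral>p. k i p \<partial>gauss2) = csn c * (c * (\<integral>x. (ou c (partial_deriv i g) x)\<^sup>2 / ou c g x \<partial>std_gaussian))" .
    qed simp
    finally show ?thesis using s by (simp add: sum_distrib_left)
  qed
  ultimately show ?thesis by simp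
qed

lemma ou_cmult: "ou c (\<lambda>x. r * v x) x = r * ou c v x"
  by (simp add: ou_def)

text \<open>The flow acts on the gradient field itself: for 0 < t < 1 and W the weak gradient of h,
  with both integrable, the Fisher information of \<open>ou t h\<close> is t^2 times this. Splitting
  off the damping leaves the part to which convexity and contraction apply.\<close>

definition flow_fisher :: "('a::euclidean_space \<Rightarrow> real) \<Rightarrow> ('a \<Rightarrow> 'a) \<Rightarrow> real \<Rightarrow> real" where
  "flow_fisher h W t = (\<Sum>i\<in>Basis. \<integral>x. (ou t (\<lambda>x. W x \<bullet> i) x)\<^sup>2 / ou t h x \<partial>std_gaussian)"

context
  fixes h :: "'a::euclidean_space \<Rightarrow> real" and W :: "'a \<Rightarrow> 'a" and \<epsilon> M :: real
  assumes eps: "\<epsilon> > 0" and h1: "\<And>x. \<epsilon> \<le> h x" and h2: "\<And>x. h x \<le> M"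
    and wg: "has_weak_gradient h W" and W: "\<And>i. i \<in> Basis \<Longrightarrow> integrable std_gaussian (\<lambda>x. W x \<bullet> i)"
begin

lemma bounded_density_measurable: "h \<in> borel_measurable borel"
  using wg locally_integrable_measurable by (auto simp: has_weak_gradient_def)

lemma bounded_density_abs_le: "\<bar>h x\<bar> \<le> M"
  using eps h1[of x] h2[of x] by simp

lemma bounded_density_integrable: "integrable std_gaussian h"
  by (rule integrable_bounded[OF bounded_density_measurable bounded_density_abs_le])

text \<open>The flow is split as t = d d with d = \<open>sqrt t\<close>: one half produces a smooth
  density with bounded gradient, and the smooth case then applies to the other half.\<close>

lemma entropy_derivative:
  assumes t: "0 < t" "t < 1"
  shows "((\<lambda>t. \<integral>x. xlnx (ou t h x) \<partial>std_gaussian) has_real_derivative t * flow_fisher h W t) (at t)"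
proof -
  define d where "d = sqrt t"
  have d: "0 < d" "d < 1" and dd: "d * d = t" using t by (auto simp: d_def)
  have d': "0 \<le> d" "d < 1" using d by auto
  have s: "csn d > 0" by (rule csn_pos[OF d'])
  define g where "g = ou d h"
  have pg: "partial_deriv i g = (\<lambda>x. d * ou d (\<lambda>x. W x \<bullet> i) x)" if i: "i \<in> Basis" for i
    unfolding g_def using partial_deriv_ou_weak_gradient[OF d wg i bounded_density_integrable W[OF i]] by auto
  define B where "B = d / csn d * M"
  have M0: "M \<ge> 0" using bounded_density_abs_le[of 0] by linarith
  have B0: "B \<ge> 0" using d s M0 by (simp add: B_def)
  \<comment> \<open>The reverse local Poincare inequality bounds the gradient of the half-flowed
    density in terms of M alone, whatever the size of W.\<close>
  have B: "\<bar>partial_deriv i g x\<bar> \<le> B" if i: "i \<in> Basis" for i x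
  proof -
    have "(partial_deriv i g x)\<^sup>2 \<le> (norm (grad g x))\<^sup>2"
      unfolding norm_grad_square using i by (intro member_le_sum) auto
    also have "\<dots> \<le> (d / csn d)\<^sup>2 * (ou d (\<lambda>y. (h y)\<^sup>2) x - (ou d h x)\<^sup>2)"
      unfolding g_def by (rule ou_gradient_bound[OF d bounded_density_measurable bounded_density_abs_le])
    also have "\<dots> \<le> (d / csn d)\<^sup>2 * M\<^sup>2"
    proof (intro mult_left_mono)
      have "\<bar>ou d (\<lambda>y. (h y)\<^sup>2) x\<bar> \<le> M\<^sup>2"
        by (rule abs_ou_le) (use bounded_density_measurable bounded_density_abs_le M0 in \<open>auto simp: abs_le_square_iff[symmetric]\<close>)
      then show "ou d (\<lambda>y. (h y)\<^sup>2) x - (ou d h x)\<^sup>2 \<le> M\<^sup>2" using zero_le_power2[of "ou d h x"] by linarith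
    qed simp
    also have "\<dots> = B\<^sup>2" by (simp add: B_def power_mult_distrib power_divide)
    finally show ?thesis using B0 abs_le_square_iff[of "partial_deriv i g x" B] by simp
  qed
  have "((\<lambda>t. \<integral>x. xlnx (ou t g x) \<partial>std_gaussian) has_real_derivative
    d * (\<Sum>i\<in>Basis. \<integral>x. (ou d (partial_deriv i g) x)\<^sup>2 / ou d g x \<partial>std_gaussian)) (at d)"
    unfolding g_def
    by (rule entropy_derivative_smooth[OF d smooth_ou[OF d bounded_density_integrable] B[unfolded g_def] B0 eps ou_between[OF bounded_density_measurable h1 h2]])
  also have "(\<Sum>i\<in>Basis. \<integral>x. (ou d (partial_deriv i g) x)\<^sup>2 / ou d g x \<partial>std_gaussian) = t * flow_fisher h W t"
    unfolding flow_fisher_def sum_distrib_left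
  proof (rule sum.cong)
    fix i :: 'a assume i: "i \<in> Basis"
    show "(\<integral>x. (ou d (partial_deriv i g) x)\<^sup>2 / ou d g x \<partial>std_gaussian)
      = t * (\<integral>x. (ou t (\<lambda>x. W x \<bullet> i) x)\<^sup>2 / ou t h x \<partial>std_gaussian)"
      unfolding pg[OF i] unfolding ou_cmult g_def ou_semigroup[OF d' d' W[OF i]] ou_semigroup[OF d' d' bounded_density_integrable] dd
      by (subst integral_mult_right_zero[symmetric]) (simp add: power_mult_distrib power2_eq_square[of d] dd)
  qed simp
  \<comment> \<open>With the first half d fixed, the second half carries the parameter
    \<open>\<tau> / d\<close>; its inner derivative 1 / d cancels the outer factor d.\<close>
  finally have "((\<lambda>\<tau>. \<integral>x. xlnx (ou (\<tau> / d) g x) \<partial>std_gaussian) has_real_derivative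
     (d * (t * flow_fisher h W t)) * (1 / d)) (at t)"
    using dd d by (intro DERIV_chain2[where g="\<lambda>\<tau>. \<tau> / d"]) (auto intro!: derivative_eq_intros simp: field_simps)
  then have "((\<lambda>\<tau>. \<integral>x. xlnx (ou (\<tau> / d) g x) \<partial>std_gaussian) has_real_derivative t * flow_fisher h W t) (at t)"
    using d by simp
  then show ?thesis
  proof (rule has_field_derivative_transform_within_open[where S="{0<..<d}"])
    \<comment> \<open>The semigroup law identifies the two functions for 0 < \<tau> < d, and this
      interval must contain t.\<close>
    have "t < d" using d dd mult_strict_left_mono[of d 1 d] by simp
    then show "t \<in> {0<..<d}" using t by simp
    fix \<tau> assume "\<tau> \<in> {0<..<d}"
    then have "0 \<le> \<tau> / d" "\<tau> / d < 1" using d by auto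
    then have "ou (\<tau> / d) g x = ou \<tau> h x" for x
      unfolding g_def using d ou_semigroup[OF _ _ d' bounded_density_integrable, of "\<tau> / d" x] by simp
    then show "(\<integral>x. xlnx (ou (\<tau> / d) g x) \<partial>std_gaussian) = (\<integral>x. xlnx (ou \<tau> h x) \<partial>std_gaussian)" by simp
  qed simp
qed

lemma flow_fisher_nonneg: "flow_fisher h W t \<ge> 0"
proof -
  have "0 \<le> ou t h x" for x using eps ou_between(1)[OF bounded_density_measurable h1 h2, of t x] by linarith
  then show ?thesis unfolding flow_fisher_def
    by (intro sum_nonneg Bochner_Integration.integral_nonneg divide_nonneg_nonneg) auto
qed

lemma csn_measurable [measurable]: "csn \<in> borel_measurable borel"
  unfolding csn_def[abs_def] by measurable

lemma flow_fisher_measurable: "flow_fisher h W \<in> borel_measurable borel"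
proof -
  have [measurable]: "h \<in> borel_measurable borel" "W \<in> borel_measurable borel"
    using wg locally_integrable_measurable by (auto simp: has_weak_gradient_def)
  show ?thesis unfolding flow_fisher_def[abs_def] ou_def by measurable
qed

text \<open>The derivative is integrated over compact subintervals of (0, 1), whose endpoints then
  tend to 0 and 1. At 1 the flow is the identity; at 0 it averages, so the entropy there is
  \<open>xlnx\<close> of the total mass.\<close>

lemma entropy_le_flow_fisher:
  "ennreal ((\<integral>x. xlnx (h x) \<partial>std_gaussian) - xlnx (integral\<^sup>L std_gaussian h))
    \<le> (\<integral>\<^sup>+t. ennreal (t * flow_fisher h W t) * indicator {0<..<1} t \<partial>lborel)"
proof -
  define F where "F t = (\<integral>x. xlnx (ou t h x) \<partial>std_gaussian)" for t
  define R where "R = (\<integral>\<^sup>+t. ennreal (t * flow_fisher h W t) * indicator {0<..<1} t \<partial>lborel)"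
  note [measurable] = bounded_density_measurable flow_fisher_measurable
  have le: "ennreal (F b - F a) \<le> R" if ab: "0 < a" "a \<le> b" "b < 1" for a b
  proof -
    have "(\<integral>\<^sup>+t. ennreal (t * flow_fisher h W t) * indicator {a..b} t \<partial>lborel) = ennreal (F b - F a)"
      by (rule nn_integral_FTC_Icc)
         (use ab flow_fisher_nonneg in \<open>auto simp: F_def intro!: entropy_derivative\<close>)
    moreover have "(\<integral>\<^sup>+t. ennreal (t * flow_fisher h W t) * indicator {a..b} t \<partial>lborel) \<le> R"
      unfolding R_def using ab by (intro nn_integral_mono) (auto simp: indicator_def)
    ultimately show ?thesis by simp
  qed
  define Q where "Q = \<bar>ln \<epsilon>\<bar> + \<bar>ln M\<bar> + 1"
  have xb: "\<bar>xlnx u\<bar> \<le> M * Q" if "\<epsilon> \<le> u" "u \<le> M" for u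
    unfolding xlnx_def abs_mult using abs_ln_le[OF eps that] eps that by (intro mult_mono) (auto simp: Q_def)
  note ob = ou_between[OF bounded_density_measurable h1 h2]
  define b where "b k = 1 - inverse (real (Suc (Suc k)))" for k
  define a where "a k = inverse (real (Suc (Suc k)))" for k
  have a: "0 < a k" "a k < 1" for k by (auto simp: a_def inverse_less_1_iff)
  have ba: "b k = 1 - a k" for k by (simp add: a_def b_def)
  have a2: "a k * (1 / 2) \<le> b k" for k
  proof -
    have "a k \<le> 1 / 2" by (simp add: a_def field_simps)
    then show ?thesis unfolding ba by linarith
  qed
  have alim: "a \<longlonglongrightarrow> 0" unfolding a_def[abs_def] by (intro LIMSEQ_Suc[OF LIMSEQ_inverse_real_of_nat])
  have blim: "b \<longlonglongrightarrow> 1" using tendsto_diff[OF tendsto_const alim, of 1] unfolding ba[abs_def] by simp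
  have b: "0 \<le> b k" "b k < 1" for k using a[of k] by (auto simp: ba)
  have F1: "(\<lambda>k. F (b k)) \<longlonglongrightarrow> (\<integral>x. xlnx (h x) \<partial>std_gaussian)"
  proof (rule LIM_zero_cancel, rule Lim_null_comparison)
    show "(\<lambda>k. Q * (\<integral>x. \<bar>ou (b k) h x - h x\<bar> \<partial>std_gaussian)) \<longlonglongrightarrow> 0"
      using tendsto_mult_right[OF ou_tendsto_L1[OF bounded_density_integrable blim b], of Q] by (simp add: mult.commute)
    show "\<forall>\<^sub>F k in sequentially. norm (F (b k) - (\<integral>x. xlnx (h x) \<partial>std_gaussian)) \<le> Q * (\<integral>x. \<bar>ou (b k) h x - h x\<bar> \<partial>std_gaussian)"
    proof (intro always_eventually allI)
      fix k
      have i1: "integrable std_gaussian (\<lambda>x. xlnx (ou (b k) h x))" "integrable std_gaussian (\<lambda>x. xlnx (h x))"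
        by (rule integrable_bounded[OF _ xb]; use ob h1 h2 in auto)+
      have i2: "integrable std_gaussian (\<lambda>x. \<bar>ou (b k) h x - h x\<bar>)"
        using integrable_ou[OF b bounded_density_integrable, of k] bounded_density_integrable by auto
      have "\<bar>\<integral>x. xlnx (ou (b k) h x) - xlnx (h x) \<partial>std_gaussian\<bar> \<le> (\<integral>x. Q * \<bar>ou (b k) h x - h x\<bar> \<partial>std_gaussian)"
      proof (rule Bochner_Integration.integral_abs_bound_integral)
        show "\<bar>xlnx (ou (b k) h x) - xlnx (h x)\<bar> \<le> Q * \<bar>ou (b k) h x - h x\<bar>" for x
          unfolding Q_def by (rule xlnx_lipschitz[OF eps ob h1 h2])
      qed (use i1 i2 in auto)
      then show "norm (F (b k) - (\<integral>x. xlnx (h x) \<partial>std_gaussian)) \<le> Q * (\<integral>x. \<bar>ou (b k) h x - h x\<bar> \<partial>std_gaussian)"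
        using i1 by (simp add: F_def)
    qed
  qed
  have F0: "(\<lambda>k. F (a k * (1 / 2))) \<longlonglongrightarrow> xlnx (integral\<^sup>L std_gaussian h)"
  proof -
    have half: "0 \<le> (1/2::real)" "(1/2::real) < 1" by auto
    \<comment> \<open>h need not be continuous. One flow step with parameter 1/2 makes it so, which
      is why the lower endpoints carry the factor 1/2.\<close>
    define g where "g = ou (1/2) h"
    have gc: "continuous_on UNIV g" unfolding g_def by (rule smooth_continuous[OF smooth_ou]) (auto simp: bounded_density_integrable)
    have gM: "\<bar>g x\<bar> \<le> M" for x unfolding g_def by (rule abs_ou_le[OF bounded_density_measurable bounded_density_abs_le])
    have og: "ou (a k) g x = ou (a k * (1/2)) h x" for k x
      unfolding g_def using a[of k] by (intro ou_semigroup half bounded_density_integrable) auto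
    have "ou 0 g x = integral\<^sup>L std_gaussian h" for x
      using integral_ou[OF half bounded_density_integrable] by (simp add: ou_def[of 0] csn_def g_def)
    then have lim: "(\<lambda>k. ou (a k * (1/2)) h x) \<longlonglongrightarrow> integral\<^sup>L std_gaussian h" for x
      using ou_tendsto_bounded_continuous[OF gc gM alim, of x] by (simp add: og)
    have "(\<integral>x. \<epsilon> \<partial>(std_gaussian::'a measure)) \<le> integral\<^sup>L std_gaussian h"
      by (intro integral_mono bounded_density_integrable h1) auto
    then have "integral\<^sup>L std_gaussian h > 0" using eps by simp
    then have cx: "isCont xlnx (integral\<^sup>L std_gaussian h)" by (rule DERIV_isCont[OF xlnx_has_derivative])
    have "(\<lambda>k. F (a k * (1/2))) \<longlonglongrightarrow> (\<integral>x. xlnx (integral\<^sup>L std_gaussian h) \<partial>(std_gaussian::'a measure))"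
      unfolding F_def
    proof (rule integral_dominated_convergence[where w="\<lambda>_. M * Q"])
      show "AE x in std_gaussian. (\<lambda>k. xlnx (ou (a k * (1/2)) h x)) \<longlonglongrightarrow> xlnx (integral\<^sup>L std_gaussian h)"
        by (intro AE_I2 isCont_tendsto_compose[OF cx] lim)
      show "AE x in std_gaussian. norm (xlnx (ou (a k * (1/2)) h x)) \<le> M * Q" for k
        using xb[OF ob] by (intro AE_I2) simp
    qed auto
    then show ?thesis by simp
  qed
  have "(\<lambda>k. ennreal (F (b k) - F (a k * (1 / 2)))) \<longlonglongrightarrow> ennreal ((\<integral>x. xlnx (h x) \<partial>std_gaussian) - xlnx (integral\<^sup>L std_gaussian h))"
    by (intro tendsto_ennrealI tendsto_diff F1 F0)
  then show ?thesis unfolding R_def[symmetric]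
    by (rule LIMSEQ_le_const2) (use le a a2 b in auto)
qed

end

section \<open>The logarithmic Sobolev inequality\<close>

lemma ln_less_minus_one: "x > 0 \<Longrightarrow> x \<noteq> 1 \<Longrightarrow> ln x < x - 1" for x :: real
  using ln_le_minus_one[of x] ln_eq_minus_one[of x] by force

text \<open>From ln lam < lam - 1 the numerator lies strictly below 1 - lam + lam (lam - 1) = (1 -
  lam)^2.\<close>

lemma lsi_const_less_1:
  assumes "lam > 0"
  shows "lsi_const lam < 1"
proof (cases "lam = 1")
  case False
  have "lam * ln lam < lam * (lam - 1)" using assms False ln_less_minus_one by simp
  then have "1 - lam + lam * ln lam < (1 - lam)\<^sup>2" by (simp add: power2_eq_square algebra_simps)
  moreover have "(1 - lam)\<^sup>2 > 0" using False by simp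
  ultimately show ?thesis using False by (simp add: lsi_const_def)
qed (simp add: lsi_const_def)

text \<open>The integrand is t^3 / q with q = lam + (1 - lam) t^2. Its primitive comes from t^3 / q
  = (t - lam t / q) / (1 - lam); for lam = 1 the integrand is t^3, with integral 1/4. Nonnegativity
  of the constant follows from monotonicity of the primitive.\<close>

lemma nn_integral_kappa:
  assumes lam: "lam > 0"
  shows "lsi_const lam \<ge> 0"
    and "(\<integral>\<^sup>+t. ennreal (t * kappa lam t) * indicator {0<..<1} t \<partial>lborel) \<le> ennreal (lsi_const lam / 2)"
proof -
  define q where "q t = lam + (1 - lam) * t\<^sup>2" for t :: real
  have q: "q t > 0" if "t \<in> {0..1}" for t
  proof -
    have "t\<^sup>2 \<le> 1" using that by (simp add: power_le_one)
    then have "0 \<le> lam * (1 - t\<^sup>2)" using lam by simp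
    moreover have "0 < lam * (1 - t\<^sup>2) \<or> 0 < t\<^sup>2" using lam that by (cases "t = 0") auto
    moreover have "q t = lam * (1 - t\<^sup>2) + t\<^sup>2" by (simp add: q_def algebra_simps)
    ultimately show ?thesis using zero_le_power2[of t] by linarith
  qed
  define F where "F t = (if lam = 1 then t ^ 4 / 4 else t\<^sup>2 * (1 / (2 * (1 - lam))) - lam / (2 * (1 - lam)\<^sup>2) * ln (q t))" for t
  define p where "p t = t ^ 3 / q t" for t
  have [measurable]: "p \<in> borel_measurable borel" unfolding p_def[abs_def] q_def[abs_def] by measurable
  have D: "DERIV F t :> p t" if t: "t \<in> {0..1}" for t
  proof (cases "lam = 1")
    case True
    then show ?thesis unfolding F_def p_def q_def by (auto intro!: derivative_eq_intros)
  next
    case False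
    have "((\<lambda>t. t\<^sup>2 * A - k * ln (q t)) has_real_derivative 2 * t * A - k * ((1 - lam) * (2 * t) / q t)) (at t)" for A k
      using q[OF t] unfolding q_def by (auto intro!: derivative_eq_intros)
    from this[of "1 / (2 * (1 - lam))" "lam / (2 * (1 - lam)\<^sup>2)"]
    have "((\<lambda>t. t\<^sup>2 * (1 / (2 * (1 - lam))) - lam / (2 * (1 - lam)\<^sup>2) * ln (q t)) has_real_derivative
       2 * t / (2 * (1 - lam)) - lam / (2 * (1 - lam)\<^sup>2) * ((1 - lam) * (2 * t) / q t)) (at t)"
      by simp
    moreover have "2 * t / (2 * (1 - lam)) - lam / (2 * (1 - lam)\<^sup>2) * ((1 - lam) * (2 * t) / q t) = p t"
    proof -
      have nz: "1 - lam \<noteq> 0" "q t \<noteq> 0" using False q[OF t] by auto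
      have "2 * t / (2 * (1 - lam)) - lam / (2 * (1 - lam)\<^sup>2) * ((1 - lam) * (2 * t) / q t)
        = t / (1 - lam) - lam * t / ((1 - lam) * q t)"
      proof -
        have "2 * t / (2 * m) - lam / (2 * m\<^sup>2) * (m * (2 * t) / Q) = t / m - lam * t / (m * Q)"
          if "m \<noteq> 0" "Q \<noteq> 0" for m Q :: real
          using that by (simp add: power2_eq_square)
        from this[OF nz] show ?thesis .
      qed
      also have "\<dots> = t * (q t - lam) / ((1 - lam) * q t)"
      proof -
        have "t / m - lam * t / (m * Q) = t * (Q - lam) / (m * Q)" if "m \<noteq> 0" "Q \<noteq> 0" for m Q :: real
          using that by (simp add: right_diff_distrib diff_divide_distrib)
        from this[OF nz] show ?thesis .
      qed
      also have "\<dots> = p t" using nz by (simp add: q_def[of t] p_def power2_eq_square power3_eq_cube)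
      finally show ?thesis .
    qed
    ultimately show ?thesis using False by (simp add: F_def[abs_def])
  qed
  have p0: "0 \<le> p t" if "t \<in> {0..1}" for t using q[OF that] that by (simp add: p_def)
  have FTC: "(\<integral>\<^sup>+t. ennreal (p t) * indicator {0..1} t \<partial>lborel) = ennreal (F 1 - F 0)"
    by (rule nn_integral_FTC_Icc) (use D p0 in auto)
  have "F 0 \<le> F 1"
    by (rule DERIV_nonneg_imp_nondecreasing[of 0 1 F]) (use D p0 in force)+
  moreover have e: "F 1 - F 0 = lsi_const lam / 2"
  proof (cases "lam = 1")
    case False
    then have nz: "1 - lam \<noteq> 0" by simp
    have "F 1 - F 0 = 1 / (2 * (1 - lam)) + lam / (2 * (1 - lam)\<^sup>2) * ln lam"
      using False by (simp add: F_def q_def)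
    also have "\<dots> = lsi_const lam / 2"
      using False nz by (simp add: lsi_const_def divide_simps power2_eq_square) (simp add: algebra_simps)
    finally show ?thesis .
  qed (simp add: F_def lsi_const_def)
  ultimately show "lsi_const lam \<ge> 0" by simp
  have "t * kappa lam t = p t" if "t \<in> {0<..<1}" for t
  proof -
    have cs: "(csn t)\<^sup>2 = 1 - t\<^sup>2" using csn_sq[of t] that by simp
    have "t\<^sup>2 + lam * (csn t)\<^sup>2 = q t" unfolding cs by (simp add: q_def algebra_simps)
    then show ?thesis by (simp add: kappa_def p_def power2_eq_square power3_eq_cube)
  qed
  then have "(\<integral>\<^sup>+t. ennreal (t * kappa lam t) * indicator {0<..<1} t \<partial>lborel) \<le> (\<integral>\<^sup>+t. ennreal (p t) * indicator {0..1} t \<partial>lborel)"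
    by (intro nn_integral_mono) (auto simp: indicator_def)
  then show "(\<integral>\<^sup>+t. ennreal (t * kappa lam t) * indicator {0<..<1} t \<partial>lborel) \<le> ennreal (lsi_const lam / 2)"
    by (simp add: FTC e)
qed

section \<open>Regularisation of the density and passage to the limit\<close>

lemma has_weak_gradient_add_const:
  fixes g :: "'a::euclidean_space \<Rightarrow> real"
  assumes wg: "has_weak_gradient g Dg"
  shows "has_weak_gradient (\<lambda>x. r + g x) Dg"
proof -
  have lg: "locally_integrable g" and lD: "locally_integrable Dg" using wg by (auto simp: has_weak_gradient_def)
  have "locally_integrable (\<lambda>x::'a. r)"
    unfolding locally_integrable_def set_integrable_def
    by (intro allI impI borel_integrable_compact continuous_on_const)
  then have l1: "locally_integrable (\<lambda>x. r + g x)"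
    using lg unfolding locally_integrable_def set_integrable_def by (simp add: distrib_left)
  have "(\<integral>x. (r + g x) * partial_deriv i \<phi> x \<partial>lborel) = - (\<integral>x. (Dg x \<bullet> i) * \<phi> x \<partial>lborel)"
    if phi: "test_function \<phi>" and i: "i \<in> Basis" for \<phi> i
  proof -
    have sphi: "smooth \<phi>" using phi by (simp add: test_function_def)
    obtain R where R: "\<And>x. norm x > R \<Longrightarrow> \<phi> x = 0" "\<And>x. norm x > R \<Longrightarrow> partial_deriv i \<phi> x = 0"
      using test_function_support[OF phi] by metis
    note cp = smooth_partial_continuous[OF sphi i, of UNIV]
    have i1: "integrable lborel (partial_deriv i \<phi>)" by (rule integrable_lborel_compact_support[OF cp R(2)])
    have i2: "integrable lborel (\<lambda>x. g x * partial_deriv i \<phi> x)" by (rule locally_integrable_mult[OF lg cp R(2)])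
    have "(\<integral>x. partial_deriv i \<phi> x \<partial>lborel) = 0"
      using integral_derivative_compact_support[OF smooth_has_derivative[OF sphi] _ R(1) i] cp by (simp add: partial_deriv_def)
    then show ?thesis using i1 i2 wg phi i by (simp add: has_weak_gradient_def distrib_right)
  qed
  then show ?thesis using l1 lD by (simp add: has_weak_gradient_def)
qed

text \<open>A dominating function, in terms of f alone, for the entropy integrands of the
  regularised densities: \<open>xlnx\<close> is at least - 1, increases from 1 on, and grows by at
  most 1 + r between r and 1 + r.\<close>

lemma xlnx_bound:
  fixes u r :: real
  assumes "0 < u" "u \<le> 1 + r" "0 \<le> r"
  shows "\<bar>xlnx u\<bar> \<le> 2 + r + \<bar>xlnx r\<bar>"
proof -
  have low: "xlnx u \<ge> - 1"
  proof -
    have "ln (1 / u) \<le> 1 / u - 1" using assms by (intro ln_le_minus_one) auto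
    then have "u * (1 - 1 / u) \<le> u * ln u" using assms by (intro mult_left_mono) (auto simp: ln_div)
    then show ?thesis using assms by (simp add: xlnx_def right_diff_distrib)
  qed
  have "xlnx (1 + r) \<le> xlnx r + 1 + r"
  proof (cases "r = 0")
    case False
    then have r: "r > 0" using assms by simp
    have "ln (1 + r) - ln r = ln ((1 + r) / r)" using r by (simp add: ln_div)
    also have "\<dots> \<le> (1 + r) / r - 1" using r by (intro ln_le_minus_one) auto
    also have "\<dots> = 1 / r" using r by (simp add: field_simps)
    finally have "r * (ln (1 + r) - ln r) \<le> r * (1 / r)" using r by (intro mult_left_mono) auto
    moreover have "ln (1 + r) \<le> r" using r by (intro ln_add_one_self_le_self) auto
    ultimately show ?thesis using r by (simp add: xlnx_def algebra_simps)
  qed (simp add: xlnx_def)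
  moreover have "xlnx u \<le> max 0 (xlnx (1 + r))"
  proof (cases "u \<ge> 1")
    case True
    have "u * ln u \<le> (1 + r) * ln (1 + r)" using True assms by (intro mult_mono) auto
    then show ?thesis by (simp add: xlnx_def)
  next
    case False
    then have "xlnx u \<le> 0" using assms by (simp add: xlnx_def mult_nonneg_nonpos)
    then show ?thesis by simp
  qed
  ultimately show ?thesis using low assms by linarith
qed

lemma entropy_le_lsi_const_fisher:
  fixes \<nu> :: "'a::euclidean_space measure"
  assumes lam: "lam > 0" and fm[measurable]: "f \<in> borel_measurable borel" and f0: "\<And>x. f x \<ge> 0"
    and nu: "\<nu> = density std_gaussian (\<lambda>x. ennreal (f x))" "prob_space \<nu>" "\<nu> \<in> poincare_class lam"
    and wg0: "has_weak_gradient f Df" and ent: "rel_entropy_finite f" and fis: "fisher_information_finite f Df"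
    and cen: "centered \<nu>"
  shows "rel_entropy f \<le> lsi_const lam / 2 * fisher_information f Df"
proof -
  interpret nu: prob_space \<nu> by (rule nu)
  have nnf: "(\<integral>\<^sup>+x. ennreal (f x) \<partial>std_gaussian) = 1"
    using nu.emeasure_space_1 unfolding nu(1) by (simp add: emeasure_density)
  have fi: "integrable std_gaussian f" by (rule integrableI_nonneg) (use f0 nnf in auto)
  have f1: "integral\<^sup>L std_gaussian f = 1" using nnf f0 by (simp add: integral_eq_nn_integral)
  then have fpos: "integral\<^sup>L std_gaussian f > 0" by simp
  \<comment> \<open>Clearing the gradient where f = 0 leaves the Fisher information unchanged and
    provides the vanishing condition of the weighted inequalities.\<close>
  define v where "v x = (if f x > 0 then Df x else 0)" for x
  have wg: "has_weak_gradient f v" unfolding v_def by (rule weak_gradient_positive_part[OF wg0 f0])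
  have [measurable]: "v \<in> borel_measurable borel"
    using wg locally_integrable_measurable by (auto simp: has_weak_gradient_def)
  have vf: "f x = 0 \<Longrightarrow> v x = 0" for x by (simp add: v_def)
  have fe: "indicator {x. f x > 0} x *\<^sub>R ((norm (Df x))\<^sup>2 / f x) = (norm (v x))\<^sup>2 / f x" for x
    by (simp add: v_def indicator_def)
  have Ii: "integrable std_gaussian (\<lambda>x. (norm (v x))\<^sup>2 / f x)"
    using fis unfolding fisher_information_finite_def set_integrable_def fe .
  define I where "I = fisher_information f Df"
  have Ie: "I = (\<integral>x. (norm (v x))\<^sup>2 / f x \<partial>std_gaussian)"
    unfolding I_def fisher_information_def set_lebesgue_integral_def fe ..
  have I0: "I \<ge> 0" unfolding Ie using f0 by simp
  have wi: "integrable std_gaussian (\<lambda>x. (v x \<bullet> i)\<^sup>2 / f x)" if i: "i \<in> Basis" for i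
  proof (rule Bochner_Integration.integrable_bound[OF Ii])
    have "(v x \<bullet> i)\<^sup>2 \<le> (norm (v x))\<^sup>2" for x
      using Basis_le_norm[OF i, of "v x"] by (simp add: abs_le_square_iff[symmetric])
    then show "AE x in std_gaussian. norm ((v x \<bullet> i)\<^sup>2 / f x) \<le> norm ((norm (v x))\<^sup>2 / f x)"
      using f0 by (intro AE_I2) (simp add: divide_right_mono)
  qed simp
  have vi: "integrable std_gaussian (\<lambda>x. v x \<bullet> i)" if i: "i \<in> Basis" for i
  proof (rule Bochner_Integration.integrable_bound)
    show "integrable std_gaussian (\<lambda>x. (v x \<bullet> i)\<^sup>2 / f x + f x)" using wi[OF i] fi by auto
    \<comment> \<open>From 2 |v| <= v^2 / f + f: finite Fisher information and finite mass make the
      gradient integrable.\<close>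
    have le: "\<bar>v x \<bullet> i\<bar> \<le> (v x \<bullet> i)\<^sup>2 / f x + f x" for x
    proof (cases "f x = 0")
      case False
      then have fx: "f x > 0" using f0[of x] by simp
      have "0 \<le> (\<bar>v x \<bullet> i\<bar> - f x)\<^sup>2 / f x" using fx by simp
      also have "\<dots> = (v x \<bullet> i)\<^sup>2 / f x + f x - 2 * \<bar>v x \<bullet> i\<bar>"
        using fx by (simp add: power2_diff diff_divide_distrib add_divide_distrib power2_eq_square[of "f x"])
      finally show ?thesis by simp
    qed (simp add: vf)
    show "AE x in std_gaussian. norm (v x \<bullet> i) \<le> norm ((v x \<bullet> i)\<^sup>2 / f x + f x)"
      using order_trans[OF le abs_ge_self] by (intro AE_I2) (simp only: real_norm_def)
  qed simp
  \<comment> \<open>The derivative of the Gaussian density is - x times the density, so integration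
    by parts against it turns the mean of the gradient into the mean of the measure, which is
    0.\<close>
  have v0: "(\<integral>x. v x \<bullet> i \<partial>std_gaussian) = 0" if i: "i \<in> Basis" for i
  proof -
    \<comment> \<open>The kernel with c = 0 and x = 0 is the density itself, whose smoothness and
      derivative are thus already available.\<close>
    have k0: "gauss_kernel 0 (0::'a) = gauss_dens" by (simp add: gauss_kernel_def mehler_def csn_def fun_eq_iff)
    have pd: "partial_deriv i gauss_dens x = - (x \<bullet> i) * gauss_dens x" for x :: 'a
      using partial_deriv_gauss_kernel[of 0 i "0::'a" x] by (simp add: k0) (simp add: csn_def)
    have "integrable \<nu> (\<lambda>x. x \<bullet> i)" "(\<integral>x. x \<bullet> i \<partial>\<nu>) = 0"
      using cen unfolding centered_def by (auto simp: integral_inner_left)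
    then have fx: "integrable std_gaussian (\<lambda>x. f x * (x \<bullet> i))" "(\<integral>x. f x * (x \<bullet> i) \<partial>std_gaussian) = 0"
      unfolding nu(1) using f0 by (simp_all add: integrable_density integral_density)
    have e1: "(\<lambda>x. f x * partial_deriv i gauss_dens x) = (\<lambda>x. - (gauss_dens x *\<^sub>R (f x * (x \<bullet> i))))"
      by (simp add: pd fun_eq_iff)
    have e2: "(\<lambda>x. (v x \<bullet> i) * gauss_dens x) = (\<lambda>x. gauss_dens x *\<^sub>R (v x \<bullet> i))" by (simp add: mult.commute)
    have "(\<integral>x. f x * partial_deriv i gauss_dens x \<partial>lborel) = - (\<integral>x. (v x \<bullet> i) * gauss_dens x \<partial>lborel)"
    proof (rule weak_gradient_by_parts[OF wg _ i])
      show "smooth (gauss_dens :: 'a \<Rightarrow> real)" using smooth_gauss_kernel[of 0 "0::'a"] by (simp add: k0)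
      show "integrable lborel (\<lambda>x. f x * partial_deriv i gauss_dens x)"
        unfolding e1 using fx(1) by (subst (asm) integrable_std_gaussian_iff) auto
      show "integrable lborel (\<lambda>x. f x * gauss_dens x)"
        using fi by (subst (asm) integrable_std_gaussian_iff) (auto simp: mult.commute)
      show "integrable lborel (\<lambda>x. (v x \<bullet> i) * gauss_dens x)"
        unfolding e2 using vi[OF i] by (subst (asm) integrable_std_gaussian_iff) auto
    qed
    moreover have "(\<integral>x. f x * partial_deriv i gauss_dens x \<partial>lborel) = - (\<integral>x. f x * (x \<bullet> i) \<partial>std_gaussian)"
      unfolding e1 by (subst integral_std_gaussian) auto
    moreover have "(\<integral>x. (v x \<bullet> i) * gauss_dens x \<partial>lborel) = (\<integral>x. v x \<bullet> i \<partial>std_gaussian)"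
      unfolding e2 by (subst integral_std_gaussian) auto
    ultimately show ?thesis using fx(2) by simp
  qed
  define a where "a n = real (Suc n)" for n
  define \<epsilon> where "\<epsilon> n = inverse (real (Suc n))" for n
  have a: "a n > 0" and eps: "\<epsilon> n > 0" "\<epsilon> n \<le> 1" for n
    unfolding a_def \<epsilon>_def by (simp, simp, simp add: inverse_le_1_iff)
  have elim: "\<epsilon> \<longlonglongrightarrow> 0" unfolding \<epsilon>_def[abs_def] by (rule LIMSEQ_inverse_real_of_nat)
  \<comment> \<open>Saturation bounds the density above, the added constant keeps it away from 0;
    one index drives both parameters.\<close>
  define h where "h n x = \<epsilon> n + satur (a n) (f x)" for n x
  define W where "W n x = dsatur (a n) (f x) *\<^sub>R v x" for n x
  have [measurable]: "h n \<in> borel_measurable borel" "W n \<in> borel_measurable borel" for n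
    unfolding h_def[abs_def] W_def[abs_def] by measurable
  have h1: "\<epsilon> n \<le> h n x" and h2: "h n x \<le> \<epsilon> n + a n" and h3: "h n x \<le> 1 + f x" for n x
    using satur_nonneg[OF a f0] satur_le_bound[OF a f0] satur_le[OF a f0] eps(2)[of n]
    by (auto simp: h_def intro: add_mono)
  have hpos: "h n x > 0" for n x using eps(1)[of n] h1[of n x] by linarith
  have wgh: "has_weak_gradient (h n) (W n)" for n
    unfolding h_def[abs_def] W_def[abs_def]
    by (intro has_weak_gradient_add_const weak_gradient_satur a wg f0)
  have Wle: "\<bar>W n x \<bullet> i\<bar> \<le> \<bar>v x \<bullet> i\<bar>" for n x i
    using dsatur_nonneg[of "a n" "f x"] dsatur_le_1[OF a f0, of n x] by (simp add: W_def abs_mult mult_left_le_one_le)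
  have Wi: "integrable std_gaussian (\<lambda>x. W n x \<bullet> i)" if i: "i \<in> Basis" for n i
    by (rule Bochner_Integration.integrable_bound[OF vi[OF i]]) (use Wle in auto)
  have hi: "integrable std_gaussian (h n)" for n
    by (rule integrable_bounded[where B="\<epsilon> n + a n"]) (use hpos h2 less_imp_le in \<open>auto simp: abs_of_pos\<close>)
  have alim: "(\<lambda>n. inverse (a n)) \<longlonglongrightarrow> 0" unfolding a_def by (rule LIMSEQ_inverse_real_of_nat)
  have rlim: "(\<lambda>n. a n / (a n + r)) \<longlonglongrightarrow> 1" if "r \<ge> 0" for r
  proof -
    have "(\<lambda>n. 1 / (1 + r * inverse (a n))) \<longlonglongrightarrow> 1 / (1 + r * 0)"
      by (intro tendsto_intros alim) auto
    moreover have "1 / (1 + r * inverse (a n)) = a n / (a n + r)" for n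
      using a[of n] that by (simp add: field_simps)
    ultimately show ?thesis by simp
  qed
  have hlim: "(\<lambda>n. h n x) \<longlonglongrightarrow> f x" for x
  proof -
    have "(\<lambda>n. \<epsilon> n + a n / (a n + f x) * f x) \<longlonglongrightarrow> 0 + 1 * f x"
      by (intro tendsto_intros elim rlim f0)
    then show ?thesis by (simp add: h_def satur_def)
  qed
  have Wlim: "(\<lambda>n. W n x \<bullet> i) \<longlonglongrightarrow> v x \<bullet> i" for x i
  proof -
    have "(\<lambda>n. (a n / (a n + f x))\<^sup>2 * (v x \<bullet> i)) \<longlonglongrightarrow> 1\<^sup>2 * (v x \<bullet> i)"
      by (intro tendsto_intros rlim f0)
    then show ?thesis by (simp add: W_def dsatur_def)
  qed
  \<comment> \<open>With q = a / (a + f) the saturated density is q f and its gradient q^2 v, so the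
    quotient changes by the factor q^3 <= 1; the added constant only decreases it further.\<close>
  have Wh: "(W n x \<bullet> i)\<^sup>2 / h n x \<le> (v x \<bullet> i)\<^sup>2 / f x" for n x i
  proof (cases "f x = 0")
    case False
    then have fx: "f x > 0" using f0[of x] by simp
    define q where "q = a n / (a n + f x)"
    have q: "0 < q" "q \<le> 1" using a[of n] fx by (auto simp: q_def)
    have "q ^ 4 * f x \<le> q * f x" using q fx power_decreasing[of 1 4 q] by (intro mult_right_mono) auto
    also have "q * f x = satur (a n) (f x)" by (simp add: q_def satur_def)
    also have "\<dots> \<le> h n x" using eps(1)[of n] by (simp add: h_def)
    finally have "q ^ 4 * f x \<le> h n x" .
    then have "(v x \<bullet> i)\<^sup>2 * (q ^ 4 * f x) \<le> (v x \<bullet> i)\<^sup>2 * h n x" by (intro mult_left_mono) auto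
    moreover have "(W n x \<bullet> i)\<^sup>2 = q ^ 4 * (v x \<bullet> i)\<^sup>2"
      by (simp add: W_def dsatur_def q_def[symmetric] power_mult_distrib)
    ultimately show ?thesis using fx hpos[of n x] by (simp add: divide_simps mult_ac)
  qed (simp add: W_def vf)
  have Whi: "integrable std_gaussian (\<lambda>x. (W n x \<bullet> i)\<^sup>2 / h n x)" if i: "i \<in> Basis" for n i
    by (rule Bochner_Integration.integrable_bound[OF wi[OF i]])
       (use Wh hpos f0 less_imp_le in \<open>auto simp: abs_of_pos\<close>)
  have hint: "integral\<^sup>L std_gaussian (h n) > 0" for n
  proof -
    have "(\<integral>x. \<epsilon> n \<partial>(std_gaussian::'a measure)) \<le> integral\<^sup>L std_gaussian (h n)"
      by (intro integral_mono hi h1) auto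
    then show ?thesis using eps(1)[of n] by simp
  qed
  have dom: "(ou t (\<lambda>x. W n x \<bullet> i) x)\<^sup>2 / ou t (h n) x \<le> ou t (\<lambda>x. (v x \<bullet> i)\<^sup>2 / f x) x"
    if t: "0 < t" "t < 1" and i: "i \<in> Basis" for t n x i
  proof -
    have t': "0 \<le> t" "t < 1" using t by auto
    have hn: "h n x \<noteq> 0" for n x using hpos[of n x] by simp
    have "(ou t (\<lambda>x. W n x \<bullet> i) x)\<^sup>2 / ou t (h n) x \<le> ou t (\<lambda>x. (W n x \<bullet> i)\<^sup>2 / h n x) x"
      by (rule ou_fisher_convex[OF t' Wi[OF i] hi Whi[OF i] less_imp_le[OF hpos] _ hint]) (use hn in simp)
    also have "\<dots> \<le> ou t (\<lambda>x. (v x \<bullet> i)\<^sup>2 / f x) x"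
      unfolding ou_def by (intro integral_mono ou_integrable[OF t' Whi[OF i]] ou_integrable[OF t' wi[OF i]] Wh)
    finally show ?thesis .
  qed
  have domi: "integrable std_gaussian (ou t (\<lambda>x. (v x \<bullet> i)\<^sup>2 / f x))"
    "integral\<^sup>L std_gaussian (ou t (\<lambda>x. (v x \<bullet> i)\<^sup>2 / f x)) = (\<integral>x. (v x \<bullet> i)\<^sup>2 / f x \<partial>std_gaussian)"
    if t: "0 < t" "t < 1" and i: "i \<in> Basis" for t i
    using integrable_ou[OF _ _ wi[OF i], of t] integral_ou[OF _ _ wi[OF i], of t] t by auto
  have sumI: "(\<Sum>i\<in>Basis. \<integral>x. (v x \<bullet> i)\<^sup>2 / f x \<partial>std_gaussian) = I"
    unfolding Ie norm_square_eq_sum sum_divide_distrib by (rule Bochner_Integration.integral_sum[symmetric]) (rule wi)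
  have ounn: "(ou t (\<lambda>x. W n x \<bullet> i) x)\<^sup>2 / ou t (h n) x \<ge> 0" for t n x i
    using less_imp_le[OF hpos] by (simp add: ou_def)
  have Jmeas[measurable]: "flow_fisher (h n) (W n) \<in> borel_measurable borel" for n
    by (rule flow_fisher_measurable[OF eps(1) h1 h2 wgh Wi])
  \<comment> \<open>Convexity alone, without contraction: a bound uniform in n and t that dominates
    the time integral.\<close>
  have Jle: "flow_fisher (h n) (W n) t \<le> I" if t: "0 < t" "t < 1" for n t
    unfolding flow_fisher_def sumI[symmetric]
  proof (rule sum_mono)
    fix i :: 'a assume i: "i \<in> Basis"
    have "(\<integral>x. (ou t (\<lambda>x. W n x \<bullet> i) x)\<^sup>2 / ou t (h n) x \<partial>std_gaussian)
      \<le> integral\<^sup>L std_gaussian (ou t (\<lambda>x. (v x \<bullet> i)\<^sup>2 / f x))"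
      by (rule integral_mono'[OF domi(1)[OF t i] dom[OF t i]]) (use ounn dom[OF t i] order_trans in blast)
    then show "(\<integral>x. (ou t (\<lambda>x. W n x \<bullet> i) x)\<^sup>2 / ou t (h n) x \<partial>std_gaussian) \<le> (\<integral>x. (v x \<bullet> i)\<^sup>2 / f x \<partial>std_gaussian)"
      by (simp add: domi(2)[OF t i])
  qed
  have Jlim: "(\<lambda>n. flow_fisher (h n) (W n) t) \<longlonglongrightarrow> flow_fisher f v t" if t: "0 < t" "t < 1" for t
    unfolding flow_fisher_def
  proof (rule tendsto_sum)
    fix i :: 'a assume i: "i \<in> Basis"
    have t': "0 \<le> t" "t < 1" using t by auto
    have l1: "(\<lambda>n. ou t (\<lambda>x. W n x \<bullet> i) x) \<longlonglongrightarrow> ou t (\<lambda>x. v x \<bullet> i) x" for x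
      unfolding ou_def
      by (rule integral_dominated_convergence[where w="\<lambda>z. \<bar>v (t *\<^sub>R x + csn t *\<^sub>R z) \<bullet> i\<bar>"])
         (use Wlim Wle ou_integrable[OF t' vi[OF i]] in auto)
    have l2: "(\<lambda>n. ou t (h n) x) \<longlonglongrightarrow> ou t f x" for x
      unfolding ou_def
    proof (rule integral_dominated_convergence[where w="\<lambda>z. 1 + f (t *\<^sub>R x + csn t *\<^sub>R z)"])
      show "AE z in std_gaussian. norm (h n (t *\<^sub>R x + csn t *\<^sub>R z)) \<le> 1 + f (t *\<^sub>R x + csn t *\<^sub>R z)" for n
        using h3 hpos by (intro AE_I2) (simp add: abs_of_pos)
    qed (use hlim ou_integrable[OF t' fi] in auto)
    have nz: "ou t f x \<noteq> 0" for x using ou_pos[OF t' fi f0 fpos, of x] by simp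
    show "(\<lambda>n. \<integral>x. (ou t (\<lambda>x. W n x \<bullet> i) x)\<^sup>2 / ou t (h n) x \<partial>std_gaussian)
      \<longlonglongrightarrow> (\<integral>x. (ou t (\<lambda>x. v x \<bullet> i) x)\<^sup>2 / ou t f x \<partial>std_gaussian)"
    proof (rule integral_dominated_convergence[where w="ou t (\<lambda>x. (v x \<bullet> i)\<^sup>2 / f x)"])
      show "AE x in std_gaussian. (\<lambda>n. (ou t (\<lambda>x. W n x \<bullet> i) x)\<^sup>2 / ou t (h n) x) \<longlonglongrightarrow> (ou t (\<lambda>x. v x \<bullet> i) x)\<^sup>2 / ou t f x"
        by (intro AE_I2 tendsto_intros l1 l2 nz)
      show "AE x in std_gaussian. norm ((ou t (\<lambda>x. W n x \<bullet> i) x)\<^sup>2 / ou t (h n) x) \<le> ou t (\<lambda>x. (v x \<bullet> i)\<^sup>2 / f x) x" for n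
        unfolding real_norm_def abs_of_nonneg[OF ounn] by (intro AE_I2 dom[OF t i])
    qed (use domi[OF t i] in auto)
  qed
  \<comment> \<open>The contraction is applied to f itself, for which the Poincare inequality and
    the mean-zero gradient are at hand.\<close>
  have Jkappa: "flow_fisher f v t \<le> kappa lam t * I" if t: "0 < t" "t < 1" for t
    unfolding flow_fisher_def sumI[symmetric] sum_distrib_left
    by (intro sum_mono ou_fisher_contraction[OF t lam f0 fi fpos nu vi wi _ v0]) (auto simp: vf)
  define E where "E n = (\<integral>x. xlnx (h n x) \<partial>std_gaussian) - xlnx (integral\<^sup>L std_gaussian (h n))" for n
  have Ele: "ennreal (E n) \<le> (\<integral>\<^sup>+t. ennreal (t * flow_fisher (h n) (W n) t) * indicator {0<..<1} t \<partial>lborel)" for n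
    unfolding E_def by (rule entropy_le_flow_fisher[OF eps(1) h1 h2 wgh Wi])
  \<comment> \<open>The subtracted 0 is the limit of \<open>xlnx\<close> of the total masses, which
    tend to 1.\<close>
  have Elim: "E \<longlonglongrightarrow> rel_entropy f - 0"
    unfolding E_def[abs_def]
  proof (rule tendsto_diff)
    have xe: "rel_entropy f = (\<integral>x. xlnx (f x) \<partial>std_gaussian)" by (simp add: rel_entropy_def xlnx_def)
    have xi: "integrable std_gaussian (\<lambda>x. xlnx (f x))" using ent by (simp add: rel_entropy_finite_def xlnx_def)
    show "(\<lambda>n. \<integral>x. xlnx (h n x) \<partial>std_gaussian) \<longlonglongrightarrow> rel_entropy f"
      unfolding xe
    proof (rule integral_dominated_convergence[where w="\<lambda>x. 2 + f x + \<bar>xlnx (f x)\<bar>"])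
      show "AE x in std_gaussian. (\<lambda>n. xlnx (h n x)) \<longlonglongrightarrow> xlnx (f x)"
      proof (intro AE_I2)
        fix x
        show "(\<lambda>n. xlnx (h n x)) \<longlonglongrightarrow> xlnx (f x)"
        proof (cases "f x = 0")
          case True
          then have "h n x = \<epsilon> n" for n by (simp add: h_def satur_def)
          \<comment> \<open>Where f = 0 only the added constant remains, and along 1 / m the value
            of \<open>xlnx\<close> is - ln m / m, which tends to 0.\<close>
          moreover have "(\<lambda>n. xlnx (\<epsilon> n)) \<longlonglongrightarrow> 0"
          proof -
            have "xlnx (\<epsilon> n) = - (ln (real (Suc n)) / real (Suc n))" for n
              by (simp add: xlnx_def \<epsilon>_def ln_inverse divide_inverse)
            then show ?thesis using tendsto_minus[OF LIMSEQ_Suc[OF lim_ln_over_n]] by simp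
          qed
          ultimately show ?thesis using True by (simp add: xlnx_def)
        next
          case False
          then have "isCont xlnx (f x)" using f0[of x] by (intro DERIV_isCont[OF xlnx_has_derivative]) simp
          then show ?thesis by (rule isCont_tendsto_compose[OF _ hlim])
        qed
      qed
      show "AE x in std_gaussian. norm (xlnx (h n x)) \<le> 2 + f x + \<bar>xlnx (f x)\<bar>" for n
        using xlnx_bound[OF hpos h3 f0] by (intro AE_I2) simp
    qed (use xi fi in auto)
    have "(\<lambda>n. integral\<^sup>L std_gaussian (h n)) \<longlonglongrightarrow> integral\<^sup>L std_gaussian f"
    proof (rule integral_dominated_convergence[where w="\<lambda>x. 1 + f x"])
      show "AE x in std_gaussian. norm (h n x) \<le> 1 + f x" for n
        using h3 hpos by (intro AE_I2) (simp add: abs_of_pos)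
    qed (use hlim fi in auto)
    then have "(\<lambda>n. integral\<^sup>L std_gaussian (h n)) \<longlonglongrightarrow> 1" by (simp add: f1)
    moreover have "isCont xlnx 1" by (rule DERIV_isCont[OF xlnx_has_derivative]) simp
    ultimately have "(\<lambda>n. xlnx (integral\<^sup>L std_gaussian (h n))) \<longlonglongrightarrow> xlnx 1"
      by (rule isCont_tendsto_compose[rotated])
    then show "(\<lambda>n. xlnx (integral\<^sup>L std_gaussian (h n))) \<longlonglongrightarrow> 0" by (simp add: xlnx_def)
  qed
  define Jt where "Jt t = ennreal (t * flow_fisher f v t) * indicator {0<..<1} t" for t :: real
  have pt: "(\<lambda>n. ennreal (t * flow_fisher (h n) (W n) t) * indicator {0<..<1} t) \<longlonglongrightarrow> Jt t" for t
  proof (cases "t \<in> {0<..<1}")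
    case True
    then show ?thesis unfolding Jt_def using Jlim[of t] by (auto intro!: tendsto_ennrealI tendsto_intros)
  qed (simp add: Jt_def)
  have [measurable]: "Jt \<in> borel_measurable lborel"
    by (rule borel_measurable_LIMSEQ_order[OF pt]) measurable
  have R: "(\<lambda>n. \<integral>\<^sup>+t. ennreal (t * flow_fisher (h n) (W n) t) * indicator {0<..<1} t \<partial>lborel) \<longlonglongrightarrow> (\<integral>\<^sup>+t. Jt t \<partial>lborel)"
  proof (rule nn_integral_dominated_convergence[where w="\<lambda>t. ennreal I * indicator {0<..<1} t"])
    show "AE t in lborel. ennreal (t * flow_fisher (h n) (W n) t) * indicator {0<..<1} t \<le> ennreal I * indicator {0<..<1} t" for n
    proof (intro AE_I2)
      fix t :: real
      have "t * flow_fisher (h n) (W n) t \<le> 1 * I" if "t \<in> {0<..<1}"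
        using that Jle[of t n] flow_fisher_nonneg[OF eps(1) h1 h2 wgh Wi, of n t] by (intro mult_mono) auto
      then show "ennreal (t * flow_fisher (h n) (W n) t) * indicator {0<..<1} t \<le> ennreal I * indicator {0<..<1} t"
        by (auto simp: indicator_def intro!: ennreal_leI)
    qed
    show "(\<integral>\<^sup>+t. ennreal I * indicator {0<..<1::real} t \<partial>lborel) < \<infinity>"
      by (simp add: nn_integral_cmult_indicator)
  qed (use pt in auto)
  have "ennreal (rel_entropy f) \<le> (\<integral>\<^sup>+t. Jt t \<partial>lborel)"
    using LIMSEQ_le[OF tendsto_ennrealI[OF Elim] R] Ele by auto
  also have "\<dots> \<le> (\<integral>\<^sup>+t. ennreal I * (ennreal (t * kappa lam t) * indicator {0<..<1} t) \<partial>lborel)"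
  proof (rule nn_integral_mono)
    fix t :: real
    show "Jt t \<le> ennreal I * (ennreal (t * kappa lam t) * indicator {0<..<1} t)"
    proof (cases "t \<in> {0<..<1}")
      case True
      then have "t * flow_fisher f v t \<le> t * (kappa lam t * I)" using Jkappa[of t] by (intro mult_left_mono) auto
      then have "ennreal (t * flow_fisher f v t) \<le> ennreal (I * (t * kappa lam t))" by (intro ennreal_leI) (simp add: mult_ac)
      then show ?thesis using True I0 kappa_pos[of t lam] lam by (simp add: Jt_def ennreal_mult')
    qed (simp add: Jt_def)
  qed
  also have "\<dots> = ennreal I * (\<integral>\<^sup>+t. ennreal (t * kappa lam t) * indicator {0<..<1} t \<partial>lborel)"
    by (rule nn_integral_cmult) (simp add: kappa_def[abs_def] csn_def)
  also have "\<dots> \<le> ennreal I * ennreal (lsi_const lam / 2)"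
    by (intro mult_left_mono nn_integral_kappa(2) lam) simp
  also have "\<dots> = ennreal (lsi_const lam / 2 * I)" using I0 by (simp add: ennreal_mult'[symmetric] mult.commute)
  \<comment> \<open>\<open>ennreal\<close> sends a negative entropy to 0; the real inequality is
    recovered because the right-hand side is nonnegative.\<close>
  finally show ?thesis using I0 nn_integral_kappa(1)[OF lam] by (simp add: I_def)
qed

theorem theorem1:
  fixes \<nu> :: "(real ^ 'n) measure"
    and f :: "real ^ 'n \<Rightarrow> real" and Df :: "real ^ 'n \<Rightarrow> real ^ 'n"
    and lam :: real
  assumes "lam > 0"
    and "f \<in> borel_measurable borel" and "\<And>x. f x \<ge> 0"
    and "\<nu> = density std_gaussian (\<lambda>x. ennreal (f x))"
    and "prob_space \<nu>"
    and "has_weak_gradient f Df"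
    and "rel_entropy_finite f"
    and "fisher_information_finite f Df"
    and "centered \<nu>"
    and "\<nu> \<in> poincare_class lam"
  shows "lsi_const lam < 1 \<and>
         rel_entropy f \<le> lsi_const lam / 2 * fisher_information f Df"
  using lsi_const_less_1[OF assms(1)]
    entropy_le_lsi_const_fisher[OF assms(1,2,3,4,5,10,6,7,8,9)] by blast

end
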